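(* There exist absolute (numerical) constants $A_0,c_0,c_1,C>0$ such that the following holds. Let $p\ge2$, let $X\in\mathbb{R}^{n\times p}$ have unit-normed columns and obey the coherence property $\mu(X)\le A_0(\log p)^{-1}$, let $\sigma>0$, and set $S_0=\lfloor c_0\,p/[\|X\|^2\log p]\rfloor$. Define $\mathcal{A}_S$ and $\mathcal{A}_{0,S}\subset\mathcal{A}_S$ (the latter with constant $c_1$) as in the context. Then: (a) for each $S\le S_0$, $|\mathcal{A}_{0,S}|/|\mathcal{A}_S|\ge 1-C\,p^{-1}$; (b) for each fixed $X\beta\in\mathbb{R}^n$ ($\beta\in\mathbb{R}^p$), if $y=X\beta+z$ with $z\sim\mathcal{N}(0,\sigma^2I_n)$ and $\hat\beta\in\arg\min_{b\in\mathbb{R}^p}\tfrac12\|y-Xb\|_{\ell_2}^2+\lambda\sigma\|b\|_{\ell_1}$ with $\lambda=2\sqrt{2\log p}$, then, with $C_0'=12+10\sqrt2$, $$\|X\beta-X\hat\beta\|_{\ell_2}^2\le\min_{S\le S_0}\ \inf_{b\in\mathbb{R}^p:\,\mathrm{sgn}(b)\in\mathcal{A}_{0,S}}(1+\sqrt2)\Big[\|X\beta-Xb\|_{\ell_2}^2+C_0'(2\log p)\cdot S\cdot\sigma^2\Big]$$ with probability at least $1-C\,p^{-1}$ (with respect to the distribution of $z$).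
   Context: $\|X\|$ is the operator norm (largest singular value) of $X$, and also denotes the Euclidean norm of vectors. Writing $X_i$ for the $i$th column of $X$ (with $\|X_i\|_{\ell_2}=1$), the coherence is $\mu(X)=\sup_{1\le i<j\le p}|\langle X_i,X_j\rangle|$. For an index set $I$, $x_I$ is the restriction of the vector $x$ to $I$, $X_I$ is the submatrix of the columns of $X$ with indices in $I$, $I^c$ is the complement of $I$ in $\{1,\dots,p\}$, and $X^*$ is the transpose. For $b\in\mathbb{R}^p$, $\mathrm{sgn}(b)\in\{-1,0,1\}^p$ is taken entrywise, with $\mathrm{sgn}(0)=0$. $\mathcal{A}_S\subset\{-1,0,1\}^p$ is the set of sign vectors with exactly $S$ nonzero entries. For $b\in\mathcal{A}_S$ with support $I$, we say $b\in\mathcal{A}_{0,S}$ if and only if: (1) $X_I^*X_I$ is invertible and $\|(X_I^*X_I)^{-1}\|\le2$; (2) $\|X_{I^c}^*X_I(X_I^*X_I)^{-1}b_I\|_{\ell_\infty}\le1/4$; (3) $\max_{i\notin I}\|X_I(X_I^*X_I)^{-1}X_I^*X_i\|\le c_1/\sqrt{\log p}$. An infimum over the empty set is $+\infty$. *)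

theory Defs
  imports
    "HOL-Probability.Probability"
    "Jordan_Normal_Form.Gauss_Jordan_Elimination"
    "Jordan_Normal_Form.DL_Submatrix"
begin

(* Vectors and matrices are those of Jordan_Normal_Form, so that dimensions are natural numbers
   that can be quantified after the absolute constants. Indices start at 0. *)

unbundle no inner_syntax
unbundle no vec_syntax
hide_type (open) Finite_Cartesian_Product.vec
hide_const (open) Finite_Cartesian_Product.vec

definition l2_norm :: "real vec \<Rightarrow> real" where
  "l2_norm v = sqrt (v \<bullet> v)"

definition l1_norm :: "real vec \<Rightarrow> real" where
  "l1_norm v = (\<Sum>i<dim_vec v. \<bar>v $ i\<bar>)"

(* The inserted 0 only matters for the vector of dimension 0. *)
definition linf_norm :: "real vec \<Rightarrow> real" where
  "linf_norm v = Max (insert 0 ((\<lambda>i. \<bar>v $ i\<bar>) ` {..<dim_vec v}))"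

definition op_norm :: "real mat \<Rightarrow> real" where
  "op_norm A = (SUP v\<in>{v \<in> carrier_vec (dim_col A). l2_norm v \<le> 1}. l2_norm (A *\<^sub>v v))"

definition coherence :: "real mat \<Rightarrow> real" where
  "coherence X = (SUP (i, j)\<in>{(i, j). i < j \<and> j < dim_col X}. \<bar>col X i \<bullet> col X j\<bar>)"

(* Both enumerate the index set increasingly, through pick. *)
definition cols_sub :: "real mat \<Rightarrow> nat set \<Rightarrow> real mat" where
  "cols_sub X I = submatrix X UNIV I"

definition vec_restrict :: "real vec \<Rightarrow> nat set \<Rightarrow> real vec" where
  "vec_restrict v I = vec (card {i. i < dim_vec v \<and> i \<in> I}) (\<lambda>k. v $ pick I k)"

definition supp :: "real vec \<Rightarrow> nat set" where
  "supp v = {i. i < dim_vec v \<and> v $ i \<noteq> 0}"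

definition sgn_vec :: "real vec \<Rightarrow> real vec" where
  "sgn_vec v = map_vec sgn v"

definition sign_vecs :: "nat \<Rightarrow> nat \<Rightarrow> real vec set" where
  "sign_vecs p S = {b \<in> carrier_vec p. (\<forall>i<p. b $ i \<in> {-1, 0, 1}) \<and> card (supp b) = S}"

(* "the (mat_inverse G)" is the inverse of G only when G is invertible, which condition (1)
   ensures. *)
definition good_sign_vecs :: "real \<Rightarrow> real mat \<Rightarrow> nat \<Rightarrow> real vec set" where
  "good_sign_vecs c1 X S = {b \<in> sign_vecs (dim_col X) S.
     let p = dim_col X;
         I = supp b;
         Ic = {..<p} - I;
         XI = cols_sub X I;
         XIc = cols_sub X Ic;
         G = transpose_mat XI * XI;
         Ginv = the (mat_inverse G)
     in (invertible_mat G \<and> op_norm Ginv \<le> 2)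
        \<and> linf_norm ((transpose_mat XIc * XI * Ginv) *\<^sub>v vec_restrict b I) \<le> 1 / 4
        \<and> (\<forall>i\<in>Ic. l2_norm ((XI * Ginv * transpose_mat XI) *\<^sub>v col X i) \<le> c1 / sqrt (ln (real p)))}"

(* The law N(0, sigma^2 I_n), on functions on {..<n}. *)
definition gaussian_noise :: "nat \<Rightarrow> real \<Rightarrow> (nat \<Rightarrow> real) measure" where
  "gaussian_noise n \<sigma> = (\<Pi>\<^sub>M i\<in>{..<n}. density lborel (\<lambda>x. ennreal (normal_density 0 \<sigma> x)))"

definition lasso_objective :: "real mat \<Rightarrow> real vec \<Rightarrow> real \<Rightarrow> real vec \<Rightarrow> real" where
  "lasso_objective X y \<tau> b = 1 / 2 * (l2_norm (y - X *\<^sub>v b))\<^sup>2 + \<tau> * l1_norm b"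

definition is_lasso :: "real mat \<Rightarrow> real vec \<Rightarrow> real \<Rightarrow> real vec \<Rightarrow> bool" where
  "is_lasso X y \<tau> b \<longleftrightarrow> is_arg_min (lasso_objective X y \<tau>) (\<lambda>b. b \<in> carrier_vec (dim_col X)) b"

end

theory Submission
  imports Defs "Jordan_Normal_Form.Determinant"
begin

text \<open>
Write x_j for the columns of X, g for their Gram matrix, B for the squared operator norm of X and L
for log p. The hypotheses say that the off-diagonal entries of g are at most a small multiple of
1/L and that the sparsity S satisfies S * B <= c * p / L for a small c.

Part (a) is about a uniformly random support I of size S with independent signs. The conditions for
a good sign vector follow from two facts about I: the hollow Gram matrix (g without its diagonal) restricted
to I has norm at most 1/2, and every row of g outside I has squared norm at most a small multiple of
1/L on I. The first fact controls the inverse Gram matrix. Together they bound the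
projections of the columns outside I, and with Hoeffding's inequality for the signs they bound the
correlations of these columns with the signs, up to a probability O(1/p).

Both facts come from one concentration inequality, lemma frame_chernoff: for a uniformly random
s-subset I, the sum over I of the rank-one operators x_j x_j^T has large norm only with small
probability. The proof is a trace moment computation instead of the usual matrix Laplace
transform. Singling out one occurrence of an index j of I in tr(M_I^q) and expanding
(M + x_j x_j^T)^(q-1) gives only terms that are products of numbers <x_j, M^a x_j>; these numbers
form a log-convex sequence, so each product collapses to a single such number. The result is the
moment recursion of a Poisson variable, and double counting of the pairs (I, j) with j in I replaces
the independence of the usual model. Applied to the rows of g, as vectors of dimension one, the
inequality gives the second fact.

For the first fact, the hollow quadratic form is four times the average of its cross forms over all
splittings of I into two parts (lemma decoupling). Given one part, the cross form is governed by a sum of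
rank-one operators over the other part, which is a uniformly random set; these operators are small
by the second fact, and their sum has small mean because the norm of X restricted to the first part
is O(sqrt L). So the concentration inequality is used three times: for the columns, for the entries of a
row, and for the truncated rows of g.

Part (b) rests on the variational inequality for a minimizer of a convex function, which gives
|X beta - X betahat|^2 <= |X beta - X b|^2 + |v|^2, where v is the vector in the span of the columns in
the support of b with <x_j, v> = <x_j, z> - tau sgn(b_j) on that support, provided that the columns
outside the support have correlation at most tau with z - v (lemma oracle_inequality). If sgn(b) is
good, the inverse Gram matrix bounds v, and the correlations with the signs reduce the proviso to
Gaussian inequalities, one for each column, that depend on b only through its sign pattern. There are finitely many sign
patterns, so one of them attains the infimum on the right-hand side, and a union bound over p
directions for this single pattern suffices. The event is measurable because X betahat is a
nonexpansive function of y.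
\<close>

section \<open>Frame operators and their moments\<close>

text \<open>Vectors are functions on the natural numbers of which only the first d values matter. The
dimension is then an ordinary variable, and the argument below needs it to be n, p and 1.\<close>

definition ip :: "nat \<Rightarrow> (nat \<Rightarrow> real) \<Rightarrow> (nat \<Rightarrow> real) \<Rightarrow> real" where
  "ip d u v = (\<Sum>i<d. u i * v i)"

text \<open>In matrix notation, with the vectors x_j as the columns of X: the operator X_I X_I^T.\<close>
definition frame_op :: "nat \<Rightarrow> (nat \<Rightarrow> nat \<Rightarrow> real) \<Rightarrow> nat set \<Rightarrow> (nat \<Rightarrow> real) \<Rightarrow> nat \<Rightarrow> real" where
  "frame_op d x I v = (\<lambda>k. \<Sum>j\<in>I. ip d (x j) v * x j k)"

lemma ip_commute: "ip d u v = ip d v u"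
  by (simp add: ip_def mult.commute)

lemma ip_nonneg: "0 \<le> ip d u u"
  by (simp add: ip_def sum_nonneg)

lemma ip_sum_right: "ip d u (\<lambda>k. \<Sum>j\<in>I. c j * y j k) = (\<Sum>j\<in>I. c j * ip d u (y j))"
  unfolding ip_def sum_distrib_left
  by (subst sum.swap) (simp add: ac_simps)

lemma ip_add_right: "ip d u (\<lambda>k. v k + w k) = ip d u v + ip d u w"
  by (simp add: ip_def algebra_simps sum.distrib)

lemma ip_diff_right: "ip d u (\<lambda>k. v k - w k) = ip d u v - ip d u w"
  by (simp add: ip_def algebra_simps sum_subtractf)

lemma ip_scale_right: "ip d u (\<lambda>k. c * v k) = c * ip d u v"
  by (simp add: ip_def sum_distrib_left algebra_simps)

lemmas ip_linear_right = ip_sum_right ip_add_right ip_diff_right ip_scale_right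

lemma ip_linear_left:
  "ip d (\<lambda>k. \<Sum>j\<in>I. c j * y j k) u = (\<Sum>j\<in>I. c j * ip d (y j) u)"
  "ip d (\<lambda>k. v k + w k) u = ip d v u + ip d w u"
  "ip d (\<lambda>k. v k - w k) u = ip d v u - ip d w u"
  "ip d (\<lambda>k. a * v k) u = a * ip d v u"
  by (simp_all add: ip_commute[of d _ u] ip_linear_right)

lemma ip_Cauchy_Schwarz: "(ip d u v)\<^sup>2 \<le> ip d u u * ip d v v"
  using Cauchy_Schwarz_ineq_sum[of u v "{..<d}"] by (simp add: ip_def power2_eq_square)

lemma frame_op_form: "ip d u (frame_op d x I v) = (\<Sum>j\<in>I. ip d (x j) u * ip d (x j) v)"
  unfolding frame_op_def ip_sum_right by (simp add: ip_commute mult.commute)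

lemma frame_op_sym: "ip d u (frame_op d x I v) = ip d (frame_op d x I u) v"
  using frame_op_form[of d u x I v] frame_op_form[of d v x I u]
  by (simp add: ip_commute mult.commute)

lemma frame_op_pow_sym: "ip d u ((frame_op d x I ^^ k) v) = ip d ((frame_op d x I ^^ k) u) v"
proof (induction k arbitrary: u v)
  case (Suc k)
  have "ip d u ((frame_op d x I ^^ Suc k) v) = ip d ((frame_op d x I ^^ k) (frame_op d x I u)) v"
    using Suc[of "frame_op d x I u" v] by (simp add: frame_op_sym)
  then show ?case
    by (simp add: funpow_swap1)
qed simp

definition frame_moment :: "nat \<Rightarrow> (nat \<Rightarrow> nat \<Rightarrow> real) \<Rightarrow> nat set \<Rightarrow> (nat \<Rightarrow> real) \<Rightarrow> nat \<Rightarrow> real" where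
  "frame_moment d x I v k = ip d v ((frame_op d x I ^^ k) v)"

lemma frame_moment_split:
  "frame_moment d x I v (k + l) = ip d ((frame_op d x I ^^ k) v) ((frame_op d x I ^^ l) v)"
  unfolding frame_moment_def funpow_add comp_def frame_op_pow_sym[of d v k x I] ..

lemma frame_moment_split_odd:
  "frame_moment d x I v (Suc (k + l)) =
     (\<Sum>j\<in>I. ip d (x j) ((frame_op d x I ^^ k) v) * ip d (x j) ((frame_op d x I ^^ l) v))"
  using frame_moment_split[of d x I v k "Suc l"] by (simp add: frame_op_form)

lemma frame_moment_nonneg: "0 \<le> frame_moment d x I v k"
proof (cases "even k")
  case True
  then obtain l where k: "k = l + l" by (metis evenE mult_2)
  show ?thesis unfolding k frame_moment_split by (rule ip_nonneg)
next
  case False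
  then obtain l where k: "k = Suc (l + l)" by (metis oddE mult_2 Suc_eq_plus1)
  show ?thesis unfolding k frame_moment_split_odd by (simp add: sum_nonneg)
qed

text \<open>The operator is positive semidefinite, so its moments at v are those of a positive measure, and
log-convexity is the Cauchy-Schwarz inequality. Splitting the power into two halves, with one copy
of the operator left between them if k is odd, avoids square roots of operators.\<close>
lemma frame_moment_log_convex:
  "(frame_moment d x I v (Suc k))\<^sup>2 \<le> frame_moment d x I v k * frame_moment d x I v (Suc (Suc k))"
proof (cases "even k")
  case True
  then obtain l where k: "k = l + l" by (metis evenE mult_2)
  show ?thesis
    using ip_Cauchy_Schwarz[of d "(frame_op d x I ^^ l) v" "(frame_op d x I ^^ Suc l) v"]
      frame_moment_split[of d x I v l l] frame_moment_split[of d x I v l "Suc l"]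
      frame_moment_split[of d x I v "Suc l" "Suc l"]
    by (simp add: k)
next
  case False
  then obtain l where k: "k = Suc (l + l)" by (metis oddE mult_2 Suc_eq_plus1)
  show ?thesis
    using Cauchy_Schwarz_ineq_sum[of "\<lambda>j. ip d (x j) ((frame_op d x I ^^ l) v)"
        "\<lambda>j. ip d (x j) ((frame_op d x I ^^ Suc l) v)" I]
      frame_moment_split_odd[of d x I v l l] frame_moment_split_odd[of d x I v l "Suc l"]
      frame_moment_split_odd[of d x I v "Suc l" "Suc l"]
    by (simp add: k power2_eq_square)
qed

lemma log_convex_shift:
  fixes m :: "nat \<Rightarrow> real"
  assumes nonneg: "\<And>k. 0 \<le> m k" and lc: "\<And>k. (m (Suc k))\<^sup>2 \<le> m k * m (Suc (Suc k))"
  shows "m (Suc i) * m (i + t) \<le> m i * m (Suc (i + t))"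
proof (induction t)
  case (Suc t)
  let ?j = "i + t"
  show ?case
  proof (cases "m ?j = 0")
    case True
    then have "m (Suc ?j) = 0" using lc[of ?j] by simp
    then show ?thesis using nonneg by simp
  next
    case False
    then have pos: "0 < m ?j" using nonneg[of ?j] by simp
    have "m ?j * (m (Suc i) * m (Suc ?j)) = (m (Suc i) * m ?j) * m (Suc ?j)" by simp
    also have "\<dots> \<le> (m i * m (Suc ?j)) * m (Suc ?j)"
      by (rule mult_right_mono[OF Suc nonneg])
    also have "\<dots> = m i * (m (Suc ?j))\<^sup>2" by (simp add: power2_eq_square)
    also have "\<dots> \<le> m i * (m ?j * m (Suc (Suc ?j)))"
      by (rule mult_left_mono[OF lc nonneg])
    finally have "m ?j * (m (Suc i) * m (Suc ?j)) \<le> m ?j * (m i * m (Suc (Suc ?j)))"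
      by (simp add: ac_simps)
    then show ?thesis using pos by simp
  qed
qed simp

text \<open>This is how a product of moments, as it arises from expanding a power of a rank-one perturbation,
becomes a single moment.\<close>
lemma log_convex_super:
  fixes m :: "nat \<Rightarrow> real"
  assumes nonneg: "\<And>k. 0 \<le> m k" and lc: "\<And>k. (m (Suc k))\<^sup>2 \<le> m k * m (Suc (Suc k))"
  shows "m a * m b \<le> m 0 * m (a + b)"
proof -
  have *: "m a * m b \<le> m 0 * m (a + b)" if "a \<le> b" for a b
    using that
  proof (induction a arbitrary: b)
    case (Suc a)
    obtain t where b: "b = a + t" using Suc.prems by (metis Suc_leD le_add_diff_inverse)
    have "m (Suc a) * m b \<le> m a * m (Suc b)"
      unfolding b using log_convex_shift[of m a t] nonneg lc by blast
    also have "\<dots> \<le> m 0 * m (a + Suc b)" using Suc.prems by (intro Suc.IH) simp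
    finally show ?case by simp
  qed simp
  show ?thesis
    using *[of a b] *[of b a] by (cases "a \<le> b") (auto simp: ac_simps)
qed

lemma frame_moment_super:
  "frame_moment d x I v a * frame_moment d x I v b \<le> frame_moment d x I v 0 * frame_moment d x I v (a + b)"
  by (rule log_convex_super[of "frame_moment d x I v"]) (rule frame_moment_nonneg frame_moment_log_convex)+

text \<open>Jensen's inequality for the moments; it bounds the quadratic form of the operator, hence its norm,
by a high moment.\<close>
lemma frame_moment_power:
  "(frame_moment d x I v 1) ^ Suc q \<le> (ip d v v) ^ q * frame_moment d x I v (Suc q)"
proof (induction q)
  case (Suc q)
  let ?m = "frame_moment d x I v"
  have "?m 1 ^ Suc (Suc q) \<le> ?m 1 * (ip d v v ^ q * ?m (Suc q))"
    using mult_left_mono[OF Suc, of "?m 1"] frame_moment_nonneg by simp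
  also have "\<dots> = ip d v v ^ q * (?m 1 * ?m (Suc q))" by simp
  also have "\<dots> \<le> ip d v v ^ q * (?m 0 * ?m (1 + Suc q))"
    by (intro mult_left_mono frame_moment_super) (simp add: ip_nonneg)
  finally show ?case by (simp add: frame_moment_def ac_simps)
qed simp

lemma frame_op_insert:
  assumes "finite I" "j \<notin> I"
  shows "ip d u (frame_op d x (insert j I) v) =
    ip d u (frame_op d x I v) + ip d (x j) u * ip d (x j) v"
  using assms by (simp add: frame_op_form)

text \<open>Expanding a power of M + x_j x_j^T at x_j produces products of moments of M at x_j, all of them
nonnegative. Each product with k factors M collapses to R^(q-k) times the k-th moment, and there
are q choose k of them, as for a binomial expansion of commuting variables.\<close>
lemma frame_moment_insert:
  assumes I: "finite I" "j \<notin> I" and R: "ip d (x j) (x j) \<le> R"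
  shows "frame_moment d x (insert j I) (x j) q
    \<le> (\<Sum>k\<le>q. real (q choose k) * R ^ (q - k) * frame_moment d x I (x j) k)"
proof -
  let ?m = "frame_moment d x I (x j)"
  let ?M = "frame_op d x I" and ?N = "frame_op d x (insert j I)"
  \<comment> \<open>The exponent a records the copies of M already moved to the left; the recursion in q is then that of Pascal.\<close>
  define g where "g q a = ip d ((?M ^^ a) (x j)) ((?N ^^ q) (x j))" for q a
  have R0: "0 \<le> R" using R ip_nonneg[of d "x j"] by simp
  have g: "g (Suc q) a = g q (Suc a) + ?m a * g q 0" for q a
  proof -
    let ?u = "(?M ^^ a) (x j)" and ?w = "(?N ^^ q) (x j)"
    have "ip d ?u (?N ?w) = ip d (?M ?u) ?w + ip d (x j) ?u * ip d (x j) ?w"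
      using frame_op_insert[OF I, of d ?u x ?w] by (simp only: frame_op_sym[of d ?u x I])
    then show ?thesis by (simp add: g_def frame_moment_def)
  qed
  have "g q a \<le> (\<Sum>k\<le>q. real (q choose k) * R ^ (q - k) * ?m (a + k))" for a
  proof (induction q arbitrary: a)
    case 0
    show ?case unfolding g_def frame_moment_def by (simp add: ip_commute)
  next
    case (Suc q)
    have m0: "?m 0 \<le> R" using R by (simp add: frame_moment_def)
    have "?m a * g q 0 \<le> ?m a * (\<Sum>k\<le>q. real (q choose k) * R ^ (q - k) * ?m (0 + k))"
      by (rule mult_left_mono[OF Suc frame_moment_nonneg])
    also have "\<dots> = (\<Sum>k\<le>q. real (q choose k) * R ^ (q - k) * (?m a * ?m k))"
      by (simp add: sum_distrib_left ac_simps)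
    also have "\<dots> \<le> (\<Sum>k\<le>q. real (q choose k) * R ^ (q - k) * (R * ?m (a + k)))"
    proof (intro sum_mono mult_left_mono)
      fix k
      show "?m a * ?m k \<le> R * ?m (a + k)"
        using frame_moment_super[of d x I "x j" a k] mult_right_mono[OF m0 frame_moment_nonneg[of d x I "x j" "a+k"]]
        by linarith
    qed (simp add: R0)
    also have "\<dots> = (\<Sum>k\<le>q. real (q choose k) * R ^ (Suc q - k) * ?m (a + k))"
      by (intro sum.cong) (auto simp: Suc_diff_le)
    finally have "g (Suc q) a \<le> (\<Sum>k\<le>q. real (q choose k) * R ^ (q - k) * ?m (Suc a + k))
       + (\<Sum>k\<le>q. real (q choose k) * R ^ (Suc q - k) * ?m (a + k))"
      using Suc[of "Suc a"] g by simp
    also have "(\<Sum>k\<le>q. real (q choose k) * R ^ (Suc q - k) * ?m (a + k))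
       = (\<Sum>k\<le>Suc q. real (q choose k) * R ^ (Suc q - k) * ?m (a + k))"
      by (simp add: binomial_eq_0)
    also have "\<dots> = R ^ Suc q * ?m a + (\<Sum>k\<le>q. real (q choose Suc k) * R ^ (q - k) * ?m (Suc a + k))"
      by (subst sum.atMost_Suc_shift) simp
    also have "(\<Sum>k\<le>q. real (q choose k) * R ^ (q - k) * ?m (Suc a + k)) +
       (R ^ Suc q * ?m a + (\<Sum>k\<le>q. real (q choose Suc k) * R ^ (q - k) * ?m (Suc a + k)))
       = R ^ Suc q * ?m a + (\<Sum>k\<le>q. real (Suc q choose Suc k) * R ^ (q - k) * ?m (Suc a + k))"
      by (simp add: sum.distrib[symmetric] algebra_simps)
    also have "\<dots> = (\<Sum>k\<le>Suc q. real (Suc q choose k) * R ^ (Suc q - k) * ?m (a + k))"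
      by (subst sum.atMost_Suc_shift) simp
    finally show ?case .
  qed
  from this[of 0] show ?thesis
    by (simp add: g_def frame_moment_def)
qed

definition unit_fn :: "nat \<Rightarrow> nat \<Rightarrow> real" where
  "unit_fn i = (\<lambda>k. if k = i then 1 else 0)"

definition frame_trace :: "nat \<Rightarrow> (nat \<Rightarrow> nat \<Rightarrow> real) \<Rightarrow> nat set \<Rightarrow> nat \<Rightarrow> real" where
  "frame_trace d x I k = (\<Sum>i<d. frame_moment d x I (unit_fn i) k)"

lemma ip_unit: "i < d \<Longrightarrow> ip d u (unit_fn i) = u i"
  by (simp add: ip_def unit_fn_def if_distrib sum.delta cong: if_cong)

lemma ip_parseval: "(\<Sum>i<d. ip d u (unit_fn i) * ip d v (unit_fn i)) = ip d u v"
  by (simp add: ip_unit) (simp add: ip_def)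

lemma frame_trace_Suc: "frame_trace d x I (Suc k) = (\<Sum>j\<in>I. frame_moment d x I (x j) k)"
proof -
  have "frame_trace d x I (Suc k) =
     (\<Sum>i<d. \<Sum>j\<in>I. ip d (x j) (unit_fn i) * ip d ((frame_op d x I ^^ k) (x j)) (unit_fn i))"
    unfolding frame_trace_def frame_moment_def
    by (simp add: frame_op_form frame_op_pow_sym)
  also have "\<dots> = (\<Sum>j\<in>I. ip d (x j) ((frame_op d x I ^^ k) (x j)))"
    by (subst sum.swap) (simp add: ip_parseval)
  finally show ?thesis by (simp add: frame_moment_def)
qed

lemma frame_trace_even:
  "frame_trace d x I (l + l) = (\<Sum>i<d. ip d ((frame_op d x I ^^ l) (unit_fn i)) ((frame_op d x I ^^ l) (unit_fn i)))"
  unfolding frame_trace_def frame_moment_split ..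

text \<open>The operator M_V of all vectors is at most B, so tr(M_V M^k) <= B tr(M^k). As in the proof of
log-convexity, M^k is split symmetrically to reduce this to the frame bound itself.\<close>
lemma frame_moment_sum_le_trace:
  assumes V: "finite V" and B: "\<And>u. (\<Sum>j\<in>V. (ip d (x j) u)\<^sup>2) \<le> B * ip d u u"
  shows "(\<Sum>j\<in>V. frame_moment d y I (x j) k) \<le> B * frame_trace d y I k"
proof (cases "even k")
  case True
  then obtain l where k: "k = l + l" by (metis evenE mult_2)
  let ?F = "frame_op d y I ^^ l"
  have "(\<Sum>j\<in>V. frame_moment d y I (x j) k) = (\<Sum>j\<in>V. \<Sum>i<d. (ip d (x j) (?F (unit_fn i)))\<^sup>2)"
    unfolding k frame_moment_split
    by (subst ip_parseval[symmetric]) (simp add: power2_eq_square frame_op_pow_sym)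
  also have "\<dots> = (\<Sum>i<d. \<Sum>j\<in>V. (ip d (x j) (?F (unit_fn i)))\<^sup>2)"
    by (rule sum.swap)
  also have "\<dots> \<le> (\<Sum>i<d. B * ip d (?F (unit_fn i)) (?F (unit_fn i)))"
    by (intro sum_mono B)
  finally show ?thesis unfolding k frame_trace_even by (simp add: sum_distrib_left)
next
  case False
  then obtain l where k: "k = Suc (l + l)" by (metis oddE mult_2 Suc_eq_plus1)
  let ?F = "frame_op d y I ^^ l"
  have "(\<Sum>j\<in>V. frame_moment d y I (x j) k) = (\<Sum>j\<in>V. \<Sum>a\<in>I. (ip d (x j) (?F (y a)))\<^sup>2)"
    unfolding k frame_moment_split_odd
    by (simp add: power2_eq_square frame_op_pow_sym[of d "y _"] ip_commute[of d "x _"])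
  also have "\<dots> = (\<Sum>a\<in>I. \<Sum>j\<in>V. (ip d (x j) (?F (y a)))\<^sup>2)"
    by (rule sum.swap)
  also have "\<dots> \<le> (\<Sum>a\<in>I. B * ip d (?F (y a)) (?F (y a)))"
    by (intro sum_mono B)
  finally show ?thesis unfolding k frame_trace_Suc frame_moment_split by (simp add: sum_distrib_left)
qed

lemma frame_moment_le_trace:
  "frame_moment d x I u k \<le> ip d u u * frame_trace d x I k"
proof -
  have "(\<Sum>j\<in>{0::nat}. frame_moment d x I ((\<lambda>_. u) j) k) \<le> ip d u u * frame_trace d x I k"
    by (rule frame_moment_sum_le_trace) (use ip_Cauchy_Schwarz[of d u] in auto)
  then show ?thesis by simp
qed


section \<open>Concentration for random subsets\<close>
definition subsets_of_size :: "nat set \<Rightarrow> nat \<Rightarrow> nat set set" where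
  "subsets_of_size V s = {I. I \<subseteq> V \<and> card I = s}"

lemma finite_subsets_of_size: "finite V \<Longrightarrow> finite (subsets_of_size V s)"
  unfolding subsets_of_size_def by (rule finite_subset[of _ "Pow V"]) auto

lemma card_subsets_of_size: "finite V \<Longrightarrow> card (subsets_of_size V s) = card V choose s"
  unfolding subsets_of_size_def by (rule n_subsets)

text \<open>In the uniform model this double counting takes the place of independence: removing a point from a
random (s+1)-set leaves a set and a point outside it.\<close>
lemma sum_delete_point:
  assumes V: "finite V"
  shows "(\<Sum>I\<in>subsets_of_size V (Suc s). \<Sum>j\<in>I. f j (I - {j})) =
    (\<Sum>I\<in>subsets_of_size V s. \<Sum>j\<in>V - I. f j I)"
proof -
  have fin: "\<forall>I\<in>subsets_of_size V t. finite I" for t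
    using V by (auto simp: subsets_of_size_def intro: finite_subset)
  have "(\<Sum>I\<in>subsets_of_size V (Suc s). \<Sum>j\<in>I. f j (I - {j})) =
    (\<Sum>(I, j)\<in>Sigma (subsets_of_size V (Suc s)) (\<lambda>I. I). f j (I - {j}))"
    by (rule sum.Sigma[OF finite_subsets_of_size[OF V] fin])
  also have "\<dots> = (\<Sum>(I, j)\<in>Sigma (subsets_of_size V s) (\<lambda>I. V - I). f j I)"
  proof (rule sum.reindex_bij_witness[where i = "\<lambda>(I, j). (insert j I, j)" and j = "\<lambda>(I, j). (I - {j}, j)"])
    fix a assume a: "a \<in> Sigma (subsets_of_size V (Suc s)) (\<lambda>I. I)"
    obtain I j where [simp]: "a = (I, j)" by (cases a)
    have I: "I \<subseteq> V" "card I = Suc s" "j \<in> I" using a by (auto simp: subsets_of_size_def)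
    have "finite I" using I V by (auto intro: finite_subset)
    then have "card (I - {j}) = s" using I by simp
    then show "(case a of (I, j) \<Rightarrow> (I - {j}, j)) \<in> Sigma (subsets_of_size V s) (\<lambda>I. V - I)"
      using I by (auto simp: subsets_of_size_def)
    show "(case case a of (I, j) \<Rightarrow> (I - {j}, j) of (I, j) \<Rightarrow> (insert j I, j)) = a"
      using I by auto
  next
    fix b assume b: "b \<in> Sigma (subsets_of_size V s) (\<lambda>I. V - I)"
    obtain I j where [simp]: "b = (I, j)" by (cases b)
    have I: "I \<subseteq> V" "card I = s" "j \<in> V" "j \<notin> I" using b by (auto simp: subsets_of_size_def)
    have "finite I" using I V by (auto intro: finite_subset)
    then have "card (insert j I) = Suc s" using I by simp
    then show "(case b of (I, j) \<Rightarrow> (insert j I, j)) \<in> Sigma (subsets_of_size V (Suc s)) (\<lambda>I. I)"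
      using I by (auto simp: subsets_of_size_def)
    show "(case case b of (I, j) \<Rightarrow> (insert j I, j) of (I, j) \<Rightarrow> (I - {j}, j)) = b"
      using I by auto
  qed auto
  also have "\<dots> = (\<Sum>I\<in>subsets_of_size V s. \<Sum>j\<in>V - I. f j I)"
    by (rule sum.Sigma[symmetric]) (use V finite_subsets_of_size in auto)
  finally show ?thesis .
qed

lemma power_one_plus_le:
  fixes R K :: real
  assumes "0 \<le> R" "0 < K" "R * real Q \<le> K" "q \<le> Q"
  shows "(R + K) ^ q \<le> exp 1 * K ^ q"
proof (cases "q = 0")
  case False
  have q: "R / K * real q \<le> 1"
    using assms mult_left_mono[of "real q" "real Q" R] by (simp add: field_simps)
  have "(R + K) ^ q = (1 + R / K) ^ q * K ^ q"
    using assms by (simp add: field_simps flip: power_mult_distrib)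
  also have "\<dots> \<le> exp (R / K) ^ q * K ^ q"
    using assms by (intro mult_right_mono power_mono) auto
  also have "exp (R / K) ^ q = exp (R / K * real q)"
    by (rule exp_of_nat2_mult[symmetric])
  also have "\<dots> * K ^ q \<le> exp 1 * K ^ q"
    using assms q by (intro mult_right_mono) auto
  finally show ?thesis .
qed simp

text \<open>Induction on the size s. For the average T(q) of the trace over all s-sets, deleting one point and
expanding gives the recursion T(q) <= m * sum_k (q-1 choose k) R^(q-1-k) T'(k), where T' is the average over
sets of one point less and m = B s / (N - s + 1). The bound D K^q solves it once R Q <= K, as then
(R + K)^(q-1) <= e K^(q-1), and e m <= K.
For k = 0 the trace of the identity is replaced by D, so that the bound does not involve the
dimension d, which may be much larger than the number of vectors.\<close>
lemma frame_trace_sum_le: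
  fixes K :: real
  assumes V: "finite V" and R: "\<And>j. j \<in> V \<Longrightarrow> ip d (x j) (x j) \<le> R" and R0: "0 \<le> R"
    and B: "\<And>u. (\<Sum>j\<in>V. (ip d (x j) u)\<^sup>2) \<le> B * ip d u u" and B0: "0 \<le> B"
    and D: "(\<Sum>j\<in>V. ip d (x j) (x j)) \<le> B * D" and D0: "0 \<le> D"
    and K: "0 < K" "R * real Q \<le> K" "exp 1 * B * real S \<le> K * (real (card V) - real S + 1)"
    and S: "S \<le> card V"
  shows "s \<le> S \<Longrightarrow> 1 \<le> q \<Longrightarrow> q \<le> Q \<Longrightarrow>
    (\<Sum>I\<in>subsets_of_size V s. frame_trace d x I q) \<le> real (card V choose s) * D * K ^ q"
proof (induction s arbitrary: q)
  case 0
  have "frame_trace d x I q = 0" if "I \<in> subsets_of_size V 0" for I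
  proof -
    have "I = {}" using that V by (auto simp: subsets_of_size_def dest: finite_subset)
    then show ?thesis using 0 by (cases q) (auto simp: frame_trace_Suc)
  qed
  then show ?case using D0 K by simp
next
  case (Suc s)
  obtain r where q: "q = Suc r" using Suc.prems by (cases q) auto
  let ?N = "card V"
  have fin: "finite I" if "I \<in> subsets_of_size V t" for I t
    using V that by (auto simp: subsets_of_size_def intro: finite_subset)
  have step: "(\<Sum>j\<in>V - I. frame_moment d x I (x j) k) \<le> (\<Sum>j\<in>V. frame_moment d x I (x j) k)" for I k
    using V by (intro sum_mono2) (auto simp: frame_moment_nonneg)
  have tr: "(\<Sum>I\<in>subsets_of_size V s. \<Sum>j\<in>V - I. frame_moment d x I (x j) k)
      \<le> B * (real (?N choose s) * D * K ^ k)" if k: "k \<le> r" for k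
  proof (cases "k = 0")
    case True
    have "(\<Sum>I\<in>subsets_of_size V s. \<Sum>j\<in>V - I. frame_moment d x I (x j) k)
      \<le> (\<Sum>I\<in>subsets_of_size V s. B * D)"
      using D True by (intro sum_mono order_trans[OF step]) (simp add: frame_moment_def)
    then show ?thesis using True by (simp add: card_subsets_of_size[OF V] ac_simps)
  next
    case False
    have "(\<Sum>I\<in>subsets_of_size V s. \<Sum>j\<in>V - I. frame_moment d x I (x j) k)
      \<le> (\<Sum>I\<in>subsets_of_size V s. B * frame_trace d x I k)"
      by (intro sum_mono order_trans[OF step] frame_moment_sum_le_trace V B)
    also have "\<dots> \<le> B * (real (?N choose s) * D * K ^ k)"
      unfolding sum_distrib_left[symmetric] using Suc.prems q k False
      by (intro mult_left_mono[OF Suc.IH B0]) auto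
    finally show ?thesis .
  qed
  have "(\<Sum>I\<in>subsets_of_size V (Suc s). frame_trace d x I q)
    = (\<Sum>I\<in>subsets_of_size V (Suc s). \<Sum>j\<in>I. frame_moment d x (insert j (I - {j})) (x j) r)"
    unfolding q frame_trace_Suc by (intro sum.cong refl) (simp add: insert_absorb)
  also have "\<dots> \<le> (\<Sum>I\<in>subsets_of_size V (Suc s). \<Sum>j\<in>I.
      \<Sum>k\<le>r. real (r choose k) * R ^ (r - k) * frame_moment d x (I - {j}) (x j) k)"
    using fin R by (intro sum_mono frame_moment_insert) (auto simp: subsets_of_size_def)
  also have "\<dots> = (\<Sum>I\<in>subsets_of_size V s. \<Sum>j\<in>V - I.
      \<Sum>k\<le>r. real (r choose k) * R ^ (r - k) * frame_moment d x I (x j) k)"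
    by (rule sum_delete_point[OF V])
  also have "\<dots> = (\<Sum>k\<le>r. real (r choose k) * R ^ (r - k) *
      (\<Sum>I\<in>subsets_of_size V s. \<Sum>j\<in>V - I. frame_moment d x I (x j) k))"
    by (simp add: sum_distrib_left sum.swap[of _ "{..r}"])
  also have "\<dots> \<le> (\<Sum>k\<le>r. real (r choose k) * R ^ (r - k) * (B * (real (?N choose s) * D * K ^ k)))"
    using R0 by (intro sum_mono mult_left_mono tr) auto
  also have "\<dots> = B * real (?N choose s) * D * (\<Sum>k\<le>r. real (r choose k) * K ^ k * R ^ (r - k))"
    by (simp add: sum_distrib_left ac_simps)
  also have "(\<Sum>k\<le>r. real (r choose k) * K ^ k * R ^ (r - k)) = (R + K) ^ r"
    by (subst add.commute, subst binomial_ring) simp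
  also have "B * real (?N choose s) * D * (R + K) ^ r \<le> B * real (?N choose s) * D * (exp 1 * K ^ r)"
    using Suc.prems q R0 K B0 D0 by (intro mult_left_mono power_one_plus_le) auto
  also have "\<dots> = (exp 1 * B * real (?N choose s)) * (D * K ^ r)" by simp
  also have "\<dots> \<le> (real (?N choose Suc s) * K) * (D * K ^ r)"
  proof (rule mult_right_mono)
    have "real (Suc s) * real (?N choose Suc s) = real (?N - s) * real (?N choose s)"
      using binomial_absorb_comp[of ?N s] binomial_absorption[of s ?N]
      by (metis of_nat_mult choose_mult_lemma binomial_absorption mult.commute)
    then have c: "real (?N choose Suc s) = real (?N - s) * real (?N choose s) / real (Suc s)"
      by (simp add: field_simps)
    have "exp 1 * B * real (Suc s) \<le> exp 1 * B * real S"
      using Suc.prems B0 by (intro mult_left_mono) auto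
    also have "\<dots> \<le> K * (real ?N - real S + 1)" by (rule K(3))
    also have "\<dots> \<le> K * real (?N - s)"
      using Suc.prems S K by (intro mult_left_mono) (auto simp: of_nat_diff)
    finally have "exp 1 * B * real (Suc s) \<le> K * real (?N - s)" .
    then have "exp 1 * B \<le> K * real (?N - s) / real (Suc s)"
      by (simp add: field_simps)
    then have "exp 1 * B * real (?N choose s) \<le> K * real (?N - s) / real (Suc s) * real (?N choose s)"
      by (rule mult_right_mono) simp
    then show "exp 1 * B * real (?N choose s) \<le> real (?N choose Suc s) * K"
      by (simp add: c ac_simps)
  qed (use D0 K in auto)
  finally show ?case by (simp add: q ac_simps)
qed

lemma card_le_sum_of_ge:
  fixes f :: "'a \<Rightarrow> real"
  assumes "finite A" "\<And>a. a \<in> A \<Longrightarrow> 0 \<le> f a" "\<And>a. a \<in> A \<Longrightarrow> P a \<Longrightarrow> c \<le> f a"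
  shows "c * real (card {a\<in>A. P a}) \<le> sum f A"
proof -
  have "c * real (card {a\<in>A. P a}) = (\<Sum>a\<in>{a\<in>A. P a}. c)" by simp
  also have "\<dots> \<le> (\<Sum>a\<in>{a\<in>A. P a}. f a)" using assms by (intro sum_mono) auto
  also have "\<dots> \<le> sum f A" using assms by (intro sum_mono2) auto
  finally show ?thesis .
qed

text \<open>Markov's inequality for the trace of the Q-th power: each set on which the form exceeds
exp 2 * K contributes at least (exp 2 * K)^Q.\<close>
lemma frame_chernoff:
  fixes K :: real
  assumes V: "finite V" and R: "\<And>j. j \<in> V \<Longrightarrow> ip d (x j) (x j) \<le> R" and R0: "0 \<le> R"
    and B: "\<And>u. (\<Sum>j\<in>V. (ip d (x j) u)\<^sup>2) \<le> B * ip d u u" and B0: "0 \<le> B"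
    and D: "(\<Sum>j\<in>V. ip d (x j) (x j)) \<le> B * D" and D0: "0 \<le> D"
    and K: "0 < K" "R * real Q \<le> K" "exp 1 * B * real s \<le> K * (real (card V) - real s + 1)"
    and s: "s \<le> card V" and Q: "1 \<le> Q"
  shows "real (card {I\<in>subsets_of_size V s. \<not> (\<forall>u. (\<Sum>j\<in>I. (ip d (x j) u)\<^sup>2) \<le> exp 2 * K * ip d u u)})
     \<le> real (card V choose s) * D * exp (- 2 * real Q)"
proof -
  have "(exp 2 * K) ^ Q \<le> frame_trace d x I Q"
    if bad: "\<not> (\<forall>u. (\<Sum>j\<in>I. (ip d (x j) u)\<^sup>2) \<le> exp 2 * K * ip d u u)" for I
  proof -
    obtain u where u: "exp 2 * K * ip d u u < (\<Sum>j\<in>I. (ip d (x j) u)\<^sup>2)" using bad by (auto simp: not_le)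
    have m1: "frame_moment d x I u 1 = (\<Sum>j\<in>I. (ip d (x j) u)\<^sup>2)"
      by (simp add: frame_moment_def frame_op_form power2_eq_square)
    have "ip d u u \<noteq> 0"
    proof
      assume 0: "ip d u u = 0"
      then have "ip d (x j) u = 0" for j using ip_Cauchy_Schwarz[of d "x j" u] by simp
      then show False using u 0 by simp
    qed
    then have pos: "0 < ip d u u" using ip_nonneg[of d u] by simp
    obtain q where q: "Q = Suc q" using Q by (cases Q) auto
    have "ip d u u ^ Q * (exp 2 * K) ^ Q = (exp 2 * K * ip d u u) ^ Q"
      by (simp add: power_mult_distrib)
    also have "\<dots> \<le> frame_moment d x I u 1 ^ Q"
      unfolding m1 using u K pos by (intro power_mono) auto
    also have "\<dots> \<le> ip d u u ^ q * frame_moment d x I u Q"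
      unfolding q by (rule frame_moment_power)
    also have "\<dots> \<le> ip d u u ^ q * (ip d u u * frame_trace d x I Q)"
      using pos by (intro mult_left_mono frame_moment_le_trace) auto
    finally have "ip d u u ^ Q * (exp 2 * K) ^ Q \<le> ip d u u ^ Q * frame_trace d x I Q"
      by (simp add: q ac_simps)
    then show ?thesis using pos by simp
  qed
  moreover have "0 \<le> frame_trace d x I Q" for I
    by (simp add: frame_trace_def sum_nonneg frame_moment_nonneg)
  ultimately have "(exp 2 * K) ^ Q * real (card {I\<in>subsets_of_size V s.
      \<not> (\<forall>u. (\<Sum>j\<in>I. (ip d (x j) u)\<^sup>2) \<le> exp 2 * K * ip d u u)})
    \<le> (\<Sum>I\<in>subsets_of_size V s. frame_trace d x I Q)"
    by (intro card_le_sum_of_ge finite_subsets_of_size[OF V])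
  also have "\<dots> \<le> real (card V choose s) * D * K ^ Q"
    using Q by (intro frame_trace_sum_le[OF V R R0 B B0 D D0 K s]) auto
  finally have "exp 2 ^ Q * real (card {I\<in>subsets_of_size V s.
      \<not> (\<forall>u. (\<Sum>j\<in>I. (ip d (x j) u)\<^sup>2) \<le> exp 2 * K * ip d u u)}) \<le> real (card V choose s) * D"
    using K by (simp add: power_mult_distrib ac_simps)
  moreover have "exp 2 ^ Q = (exp (2 * real Q) :: real)" by (simp add: exp_of_nat2_mult)
  ultimately show ?thesis by (simp add: exp_minus field_simps)
qed


section \<open>Decoupling and random signs\<close>
lemma card_Pow_separating:
  assumes I: "finite I" and ij: "i \<in> I" "j \<in> I" "i \<noteq> j"
  shows "4 * real (card {\<eta>\<in>Pow I. i \<notin> \<eta> \<and> j \<in> \<eta>}) = 2 ^ card I"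
proof -
  have "{\<eta>\<in>Pow I. i \<notin> \<eta> \<and> j \<in> \<eta>} = insert j ` Pow (I - {i, j})"
  proof (intro equalityI subsetI)
    fix \<eta> assume "\<eta> \<in> {\<eta>\<in>Pow I. i \<notin> \<eta> \<and> j \<in> \<eta>}"
    then have "\<eta> = insert j (\<eta> - {j})" "\<eta> - {j} \<in> Pow (I - {i, j})" by auto
    then show "\<eta> \<in> insert j ` Pow (I - {i, j})" by blast
  qed (use ij in auto)
  moreover have "inj_on (insert j) (Pow (I - {i, j}))"
    by (auto simp: inj_on_def)
  ultimately have "card {\<eta>\<in>Pow I. i \<notin> \<eta> \<and> j \<in> \<eta>} = 2 ^ card (I - {i, j})"
    using I by (simp add: card_image card_Pow)
  moreover have "card (I - {i, j}) + 2 = card I"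
    using I ij card_mono[OF I, of "{i, j}"] by (simp add: card_Diff_subset)
  then have "(2::real) ^ card I = 4 * 2 ^ card (I - {i, j})"
    by (simp flip: \<open>card (I - {i, j}) + 2 = card I\<close> add: power_add)
  ultimately show ?thesis by simp
qed

definition hollow_form :: "(nat \<Rightarrow> nat \<Rightarrow> real) \<Rightarrow> nat set \<Rightarrow> (nat \<Rightarrow> real) \<Rightarrow> real" where
  "hollow_form g I u = (\<Sum>i\<in>I. \<Sum>j\<in>I - {i}. u i * u j * g i j)"

definition cross_form :: "(nat \<Rightarrow> nat \<Rightarrow> real) \<Rightarrow> nat set \<Rightarrow> nat set \<Rightarrow> (nat \<Rightarrow> real) \<Rightarrow> real" where
  "cross_form g J I u = (\<Sum>i\<in>J. \<Sum>j\<in>I. u i * u j * g i j)"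

lemma hollow_form_alt:
  "finite I \<Longrightarrow> hollow_form g I u = (\<Sum>i\<in>I. \<Sum>j\<in>I. if i = j then 0 else u i * u j * g i j)"
  unfolding hollow_form_def
  by (rule sum.cong[OF refl], rule sum.mono_neutral_cong_left) auto

lemma cross_form_alt:
  assumes "finite I" "\<eta> \<subseteq> I"
  shows "cross_form g (I - \<eta>) \<eta> u = (\<Sum>i\<in>I. \<Sum>j\<in>I. if i \<notin> \<eta> \<and> j \<in> \<eta> then u i * u j * g i j else 0)"
proof -
  have "cross_form g (I - \<eta>) \<eta> u =
    (\<Sum>i\<in>I - \<eta>. \<Sum>j\<in>I. if i \<notin> \<eta> \<and> j \<in> \<eta> then u i * u j * g i j else 0)"
    unfolding cross_form_def using assms
    by (intro sum.cong[OF refl], intro sum.mono_neutral_cong_left) auto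
  also have "\<dots> = (\<Sum>i\<in>I. \<Sum>j\<in>I. if i \<notin> \<eta> \<and> j \<in> \<eta> then u i * u j * g i j else 0)"
    using assms by (intro sum.mono_neutral_left) auto
  finally show ?thesis .
qed

text \<open>An ordered pair of distinct points is separated by a quarter of all splittings.\<close>
lemma hollow_form_average:
  assumes I: "finite I"
  shows "2 ^ card I * hollow_form g I u = 4 * (\<Sum>\<eta>\<in>Pow I. cross_form g (I - \<eta>) \<eta> u)"
proof -
  have "(\<Sum>\<eta>\<in>Pow I. cross_form g (I - \<eta>) \<eta> u) =
     (\<Sum>\<eta>\<in>Pow I. \<Sum>i\<in>I. \<Sum>j\<in>I. if i \<notin> \<eta> \<and> j \<in> \<eta> then u i * u j * g i j else 0)"
    using I by (intro sum.cong refl cross_form_alt) auto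
  also have "\<dots> = (\<Sum>i\<in>I. \<Sum>j\<in>I. \<Sum>\<eta>\<in>Pow I. if i \<notin> \<eta> \<and> j \<in> \<eta> then u i * u j * g i j else 0)"
    by (subst sum.swap, intro sum.cong refl, rule sum.swap)
  also have "\<dots> = (\<Sum>i\<in>I. \<Sum>j\<in>I. real (card {\<eta>\<in>Pow I. i \<notin> \<eta> \<and> j \<in> \<eta>}) * (u i * u j * g i j))"
    using I by (intro sum.cong refl) (simp add: sum.If_cases Int_def)
  finally have "4 * (\<Sum>\<eta>\<in>Pow I. cross_form g (I - \<eta>) \<eta> u) =
     (\<Sum>i\<in>I. \<Sum>j\<in>I. (4 * real (card {\<eta>\<in>Pow I. i \<notin> \<eta> \<and> j \<in> \<eta>})) * (u i * u j * g i j))"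
    by (simp add: sum_distrib_left ac_simps)
  also have "\<dots> = (\<Sum>i\<in>I. \<Sum>j\<in>I. 2 ^ card I * (if i = j then 0 else u i * u j * g i j))"
  proof (intro sum.cong refl)
    fix i j assume ij: "i \<in> I" "j \<in> I"
    show "4 * real (card {\<eta>\<in>Pow I. i \<notin> \<eta> \<and> j \<in> \<eta>}) * (u i * u j * g i j) =
      2 ^ card I * (if i = j then 0 else u i * u j * g i j)"
    proof (cases "i = j")
      case True
      then have "{\<eta>\<in>Pow I. i \<notin> \<eta> \<and> j \<in> \<eta>} = {}" by auto
      then show ?thesis using True by (simp only: card.empty) simp
    next
      case False
      then show ?thesis using card_Pow_separating[OF I ij] by simp
    qed
  qed
  finally show ?thesis using I by (simp add: hollow_form_alt sum_distrib_left)
qed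

text \<open>Changing the sign of u on one side of the splitting changes the hollow form by four times the
cross form.\<close>
lemma cross_form_le_hollow:
  assumes I: "finite I" and \<eta>: "\<eta> \<subseteq> I" and sym: "\<And>i j. g i j = g j i"
    and N: "\<And>u. \<bar>hollow_form g I u\<bar> \<le> N * (\<Sum>i\<in>I. (u i)\<^sup>2)"
  shows "\<bar>cross_form g (I - \<eta>) \<eta> u\<bar> \<le> N / 2 * (\<Sum>i\<in>I. (u i)\<^sup>2)"
proof -
  define v where "v i = (if i \<in> \<eta> then u i else - u i)" for i
  let ?c = "\<lambda>i j. if i \<notin> \<eta> \<and> j \<in> \<eta> then u i * u j * g i j else 0"
  have "hollow_form g I u - hollow_form g I v = (\<Sum>i\<in>I. \<Sum>j\<in>I. 2 * (?c i j + ?c j i))"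
    unfolding hollow_form_alt[OF I] sum_subtractf[symmetric]
    by (intro sum.cong refl) (auto simp: v_def sym)
  also have "\<dots> = 2 * ((\<Sum>i\<in>I. \<Sum>j\<in>I. ?c i j) + (\<Sum>i\<in>I. \<Sum>j\<in>I. ?c j i))"
    by (simp only: sum_distrib_left[symmetric] sum.distrib)
  also have "(\<Sum>i\<in>I. \<Sum>j\<in>I. ?c j i) = (\<Sum>i\<in>I. \<Sum>j\<in>I. ?c i j)"
    by (rule sum.swap)
  finally have "hollow_form g I u - hollow_form g I v = 4 * cross_form g (I - \<eta>) \<eta> u"
    unfolding cross_form_alt[OF I \<eta>] by simp
  moreover have "(\<Sum>i\<in>I. (v i)\<^sup>2) = (\<Sum>i\<in>I. (u i)\<^sup>2)"
    by (intro sum.cong) (auto simp: v_def)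
  ultimately show ?thesis using N[of u] N[of v] by simp
qed

lemma hollow_form_trivial_bound:
  assumes I: "finite I"
  shows "\<exists>N. \<forall>u. \<bar>hollow_form g I u\<bar> \<le> N * (\<Sum>i\<in>I. (u i)\<^sup>2)"
proof -
  let ?N = "\<Sum>i\<in>I. \<Sum>j\<in>I. \<bar>g i j\<bar>"
  have "\<bar>hollow_form g I u\<bar> \<le> ?N * (\<Sum>i\<in>I. (u i)\<^sup>2)" for u
  proof -
    have sq: "(u i)\<^sup>2 \<le> (\<Sum>i\<in>I. (u i)\<^sup>2)" if "i \<in> I" for i
      using I that by (intro member_le_sum) auto
    have "\<bar>hollow_form g I u\<bar> \<le> (\<Sum>i\<in>I. \<Sum>j\<in>I. \<bar>if i = j then 0 else u i * u j * g i j\<bar>)"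
      unfolding hollow_form_alt[OF I] by (intro order_trans[OF sum_abs] sum_mono sum_abs)
    also have "\<dots> \<le> (\<Sum>i\<in>I. \<Sum>j\<in>I. \<bar>g i j\<bar> * (\<Sum>i\<in>I. (u i)\<^sup>2))"
    proof (intro sum_mono)
      fix i j assume ij: "i \<in> I" "j \<in> I"
      have "2 * (\<bar>u i\<bar> * \<bar>u j\<bar>) \<le> (u i)\<^sup>2 + (u j)\<^sup>2"
        using sum_squares_bound[of "\<bar>u i\<bar>" "\<bar>u j\<bar>"] by simp
      then have "\<bar>u i\<bar> * \<bar>u j\<bar> \<le> (\<Sum>i\<in>I. (u i)\<^sup>2)"
        using sq[OF ij(1)] sq[OF ij(2)] by linarith
      then have "\<bar>g i j\<bar> * (\<bar>u i\<bar> * \<bar>u j\<bar>) \<le> \<bar>g i j\<bar> * (\<Sum>i\<in>I. (u i)\<^sup>2)"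
        by (rule mult_left_mono) simp
      then show "\<bar>if i = j then 0 else u i * u j * g i j\<bar> \<le> \<bar>g i j\<bar> * (\<Sum>i\<in>I. (u i)\<^sup>2)"
        by (auto simp: abs_mult ac_simps sum_nonneg)
    qed
    finally show ?thesis by (simp add: sum_distrib_right)
  qed
  then show ?thesis by blast
qed

text \<open>Averaging over the splittings bounds the hollow form by 4 * (tau + N/8) if N is any bound for it,
since the at most one quarter of bad splittings contribute at most N/2 each. Thus a
bound N improves to 4 tau + N/2, and iterating leaves 8 tau. This replaces the choice of a maximizing u.\<close>
lemma decoupling:
  assumes I: "finite I" and sym: "\<And>i j. g i j = g j i" and \<tau>: "0 \<le> \<tau>"
    and few: "4 * card {\<eta>\<in>Pow I. \<not> (\<forall>u. \<bar>cross_form g (I - \<eta>) \<eta> u\<bar> \<le> \<tau> * (\<Sum>i\<in>I. (u i)\<^sup>2))} \<le> 2 ^ card I"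
  shows "\<bar>hollow_form g I u\<bar> \<le> 8 * \<tau> * (\<Sum>i\<in>I. (u i)\<^sup>2)"
proof -
  let ?E = "\<lambda>u :: nat \<Rightarrow> real. \<Sum>i\<in>I. (u i)\<^sup>2"
  define bad where "bad = {\<eta>\<in>Pow I. \<not> (\<forall>u. \<bar>cross_form g (I - \<eta>) \<eta> u\<bar> \<le> \<tau> * ?E u)}"
  have fin: "finite (Pow I)" using I by simp
  have few': "4 * real (card bad) \<le> 2 ^ card I"
    using of_nat_mono[OF few, where 'a = real] unfolding bad_def by simp
  have E0: "0 \<le> ?E u" for u by (rule sum_nonneg) simp
  have improve: "\<bar>hollow_form g I u\<bar> \<le> (4 * \<tau> + N / 2) * ?E u"
    if N: "\<And>u. \<bar>hollow_form g I u\<bar> \<le> N * ?E u" and N0: "0 \<le> N" for N u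
  proof -
    have "2 ^ card I * \<bar>hollow_form g I u\<bar> = \<bar>4 * (\<Sum>\<eta>\<in>Pow I. cross_form g (I - \<eta>) \<eta> u)\<bar>"
      by (simp flip: hollow_form_average[OF I] add: abs_mult)
    also have "\<dots> \<le> 4 * (\<Sum>\<eta>\<in>Pow I. \<bar>cross_form g (I - \<eta>) \<eta> u\<bar>)"
      by (simp add: abs_mult sum_abs)
    also have "(\<Sum>\<eta>\<in>Pow I. \<bar>cross_form g (I - \<eta>) \<eta> u\<bar>)
      \<le> (\<Sum>\<eta>\<in>Pow I. \<tau> * ?E u + (if \<eta> \<in> bad then N / 2 * ?E u else 0))"
    proof (rule sum_mono)
      fix \<eta> assume \<eta>: "\<eta> \<in> Pow I"
      show "\<bar>cross_form g (I - \<eta>) \<eta> u\<bar> \<le> \<tau> * ?E u + (if \<eta> \<in> bad then N / 2 * ?E u else 0)"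
      proof (cases "\<eta> \<in> bad")
        case True
        then show ?thesis
          using cross_form_le_hollow[OF I _ sym N, of \<eta> u] \<eta> \<tau> E0[of u]
          by (simp add: add_increasing)
      next
        case False
        then show ?thesis using \<eta> by (auto simp: bad_def)
      qed
    qed
    also have "\<dots> = 2 ^ card I * (\<tau> * ?E u) + real (card bad) * (N / 2 * ?E u)"
    proof -
      have "Pow I \<inter> bad = bad" by (auto simp: bad_def)
      then show ?thesis using I by (simp add: sum.distrib card_Pow sum.If_cases)
    qed
    finally have "2 ^ card I * \<bar>hollow_form g I u\<bar>
      \<le> 2 ^ card I * (4 * \<tau> * ?E u) + (4 * real (card bad)) * (N / 2 * ?E u)" by simp
    also have "(4 * real (card bad)) * (N / 2 * ?E u) \<le> 2 ^ card I * (N / 2 * ?E u)"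
      using few' N0 E0 by (intro mult_right_mono) auto
    finally have "2 ^ card I * \<bar>hollow_form g I u\<bar> \<le> 2 ^ card I * ((4 * \<tau> + N / 2) * ?E u)"
      by (simp add: algebra_simps)
    then show ?thesis by simp
  qed
  obtain N0 where N0: "\<And>u. \<bar>hollow_form g I u\<bar> \<le> N0 * ?E u"
    using hollow_form_trivial_bound[OF I] by blast
  have iter: "\<bar>hollow_form g I u\<bar> \<le> (8 * \<tau> + \<bar>N0\<bar> / 2 ^ k) * ?E u" for k u
  proof (induction k arbitrary: u)
    case 0
    have "N0 * ?E u \<le> (8 * \<tau> + \<bar>N0\<bar>) * ?E u"
      using \<tau> E0 by (intro mult_right_mono) auto
    then show ?case using N0[of u] by simp
  next
    case (Suc k)
    have "\<bar>hollow_form g I u\<bar> \<le> (4 * \<tau> + (8 * \<tau> + \<bar>N0\<bar> / 2 ^ k) / 2) * ?E u"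
      by (rule improve[OF Suc]) (use \<tau> in auto)
    then show ?case by (simp add: field_simps)
  qed
  have "(\<lambda>k. (8 * \<tau> + \<bar>N0\<bar> * (1 / 2) ^ k) * ?E u) \<longlonglongrightarrow> (8 * \<tau> + \<bar>N0\<bar> * 0) * ?E u"
    by (intro tendsto_intros LIMSEQ_power_zero) auto
  then show ?thesis
    using iter[of u] by (intro LIMSEQ_le_const) (auto simp: power_divide)
qed

text \<open>Hoeffding's lemma for a symmetric sign, in the form cosh a <= exp(a^2/2).\<close>
lemma exp_plus_exp_minus_le: "exp a + exp (- a) \<le> 2 * exp (a\<^sup>2 / 2)" for a :: real
proof -
  have *: "exp a + exp (- a) \<le> 2 * exp (a\<^sup>2 / 2)" if a: "0 < a" for a :: real
  proof -
    have "- (2 * a) * (1/2) + ln (1 + (1/2) * (exp (2 * a) - 1)) \<le> (2 * a)\<^sup>2 / 8"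
      using a by (intro Hoeffdings_lemma_aux) auto
    then have "ln ((1 + exp (2 * a)) / 2) \<le> a + a\<^sup>2 / 2"
      by (simp add: field_simps power2_eq_square)
    then have "(1 + exp (2 * a)) / 2 \<le> exp (a + a\<^sup>2 / 2)"
    proof -
      have "0 < (1 + exp (2 * a)) / 2" by (simp add: add_pos_pos)
      then show ?thesis
        using \<open>ln ((1 + exp (2 * a)) / 2) \<le> a + a\<^sup>2 / 2\<close> by (metis exp_le_cancel_iff exp_ln)
    qed
    then have "exp (- a) * ((1 + exp (2 * a)) / 2) \<le> exp (- a) * exp (a + a\<^sup>2 / 2)"
      by (intro mult_left_mono) auto
    moreover have "exp (- a) * exp (a + a\<^sup>2 / 2) = exp (a\<^sup>2 / 2)"
      by (simp flip: exp_add)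
    moreover have "exp (- a) * ((1 + exp (2 * a)) / 2) = (exp (- a) + exp a) / 2"
      by (simp add: algebra_simps flip: exp_add add_divide_distrib)
    ultimately show ?thesis by simp
  qed
  show ?thesis using *[of a] *[of "- a"] by (cases a "0::real" rule: linorder_cases) auto
qed

definition sign_on :: "nat set \<Rightarrow> nat \<Rightarrow> real" where
  "sign_on \<eta> j = (if j \<in> \<eta> then 1 else - 1)"

lemma sum_exp_signs_le:
  assumes I: "finite I"
  shows "(\<Sum>\<eta>\<in>Pow I. exp (\<Sum>j\<in>I. sign_on \<eta> j * a j)) \<le> 2 ^ card I * exp ((\<Sum>j\<in>I. (a j)\<^sup>2) / 2)"
proof -
  have "(\<Sum>\<eta>\<in>Pow I. exp (\<Sum>j\<in>I. sign_on \<eta> j * a j)) =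
    (\<Sum>\<eta>\<in>Pow I. (\<Prod>j\<in>\<eta>. exp (a j)) * (\<Prod>j\<in>I - \<eta>. exp (- a j)))"
  proof (intro sum.cong refl)
    fix \<eta> assume \<eta>: "\<eta> \<in> Pow I"
    have "(\<Sum>j\<in>I. sign_on \<eta> j * a j) = (\<Sum>j\<in>I - \<eta>. sign_on \<eta> j * a j) + (\<Sum>j\<in>\<eta>. sign_on \<eta> j * a j)"
      using I \<eta> by (intro sum.subset_diff) auto
    also have "\<dots> = (\<Sum>j\<in>I - \<eta>. - a j) + (\<Sum>j\<in>\<eta>. a j)"
      by (intro arg_cong2[where f="(+)"] sum.cong) (auto simp: sign_on_def)
    finally show "exp (\<Sum>j\<in>I. sign_on \<eta> j * a j) = (\<Prod>j\<in>\<eta>. exp (a j)) * (\<Prod>j\<in>I - \<eta>. exp (- a j))"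
      using I \<eta> by (simp add: exp_add exp_sum finite_subset del: sum_negf)
  qed
  also have "\<dots> = (\<Prod>j\<in>I. exp (a j) + exp (- a j))"
    by (rule prod_add[symmetric]) (rule I)
  also have "\<dots> \<le> (\<Prod>j\<in>I. 2 * exp ((a j)\<^sup>2 / 2))"
    by (intro prod_mono) (auto simp: exp_plus_exp_minus_le add_nonneg_nonneg)
  also have "\<dots> = 2 ^ card I * exp ((\<Sum>j\<in>I. (a j)\<^sup>2) / 2)"
    using I by (simp add: prod.distrib exp_sum sum_divide_distrib)
  finally show ?thesis .
qed

lemma sign_hoeffding:
  assumes I: "finite I" and v: "(\<Sum>j\<in>I. (w j)\<^sup>2) \<le> v" "0 < v" and t: "0 \<le> t"
  shows "real (card {\<eta>\<in>Pow I. t < \<bar>\<Sum>j\<in>I. sign_on \<eta> j * w j\<bar>}) \<le> 2 ^ card I * (2 * exp (- t\<^sup>2 / (2 * v)))"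
proof -
  have tail: "real (card {\<eta>\<in>Pow I. t < (\<Sum>j\<in>I. sign_on \<eta> j * y j)}) \<le> 2 ^ card I * exp (- t\<^sup>2 / (2 * v))"
    if y: "(\<Sum>j\<in>I. (y j)\<^sup>2) \<le> v" for y
  proof -
    define l where "l = t / v"
    have l: "0 \<le> l" using t v by (simp add: l_def)
    have "exp (l * t) * real (card {\<eta>\<in>Pow I. t < (\<Sum>j\<in>I. sign_on \<eta> j * y j)})
      \<le> (\<Sum>\<eta>\<in>Pow I. exp (\<Sum>j\<in>I. sign_on \<eta> j * (l * y j)))"
    proof (rule card_le_sum_of_ge)
      fix \<eta> assume "t < (\<Sum>j\<in>I. sign_on \<eta> j * y j)"
      then have "l * t \<le> l * (\<Sum>j\<in>I. sign_on \<eta> j * y j)"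
        using l by (intro mult_left_mono) auto
      then show "exp (l * t) \<le> exp (\<Sum>j\<in>I. sign_on \<eta> j * (l * y j))"
        by (simp add: sum_distrib_left ac_simps)
    qed (use I in auto)
    also have "\<dots> \<le> 2 ^ card I * exp ((\<Sum>j\<in>I. (l * y j)\<^sup>2) / 2)"
      by (rule sum_exp_signs_le[OF I])
    also have "\<dots> \<le> 2 ^ card I * exp (l\<^sup>2 * v / 2)"
      using mult_left_mono[OF y, of "l\<^sup>2"] by (simp add: power_mult_distrib sum_distrib_left)
    finally have "real (card {\<eta>\<in>Pow I. t < (\<Sum>j\<in>I. sign_on \<eta> j * y j)})
      \<le> 2 ^ card I * exp (l\<^sup>2 * v / 2) / exp (l * t)" by (simp add: field_simps)
    also have "\<dots> = 2 ^ card I * exp (- t\<^sup>2 / (2 * v))"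
    proof -
      have "l\<^sup>2 * v / 2 - l * t = - t\<^sup>2 / (2 * v)"
        using v by (simp add: l_def field_simps power2_eq_square)
      then show ?thesis by (metis exp_diff times_divide_eq_right)
    qed
    finally show ?thesis .
  qed
  have "{\<eta>\<in>Pow I. t < \<bar>\<Sum>j\<in>I. sign_on \<eta> j * w j\<bar>} \<subseteq>
    {\<eta>\<in>Pow I. t < (\<Sum>j\<in>I. sign_on \<eta> j * w j)} \<union> {\<eta>\<in>Pow I. t < (\<Sum>j\<in>I. sign_on \<eta> j * (- w j))}"
    by (auto simp: abs_if sum_negf split: if_splits)
  then have "card {\<eta>\<in>Pow I. t < \<bar>\<Sum>j\<in>I. sign_on \<eta> j * w j\<bar>} \<le>
    card {\<eta>\<in>Pow I. t < (\<Sum>j\<in>I. sign_on \<eta> j * w j)} + card {\<eta>\<in>Pow I. t < (\<Sum>j\<in>I. sign_on \<eta> j * (- w j))}"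
    using I by (intro order_trans[OF card_mono card_Un_le]) auto
  then show ?thesis using tail[of w] tail[of "\<lambda>j. - w j"] v by simp
qed

text \<open>Splitting a random S-set is the same as choosing the first part and then, in its complement, the
second part; the second part is again uniformly distributed.\<close>
lemma sum_subset_pairs:
  fixes f :: "nat set \<Rightarrow> nat set \<Rightarrow> 'a::comm_monoid_add"
  assumes V: "finite V"
  shows "(\<Sum>I\<in>subsets_of_size V S. \<Sum>\<eta>\<in>Pow I. f \<eta> (I - \<eta>)) =
    (\<Sum>s\<le>S. \<Sum>\<eta>\<in>subsets_of_size V s. \<Sum>J\<in>subsets_of_size (V - \<eta>) (S - s). f \<eta> J)"
proof -
  have fin: "finite I" if "I \<in> subsets_of_size V t" for I t
    using V that by (auto simp: subsets_of_size_def intro: finite_subset)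
  let ?A = "Sigma (subsets_of_size V S) Pow"
  let ?B = "Sigma {..S} (\<lambda>s. Sigma (subsets_of_size V s) (\<lambda>\<eta>. subsets_of_size (V - \<eta>) (S - s)))"
  have "(\<Sum>I\<in>subsets_of_size V S. \<Sum>\<eta>\<in>Pow I. f \<eta> (I - \<eta>)) = (\<Sum>(I, \<eta>)\<in>?A. f \<eta> (I - \<eta>))"
    by (rule sum.Sigma) (use finite_subsets_of_size[OF V] fin in auto)
  also have "\<dots> = (\<Sum>(s, \<eta>, J)\<in>?B. f \<eta> J)"
  proof (rule sum.reindex_bij_witness[where i = "\<lambda>(s, \<eta>, J). (\<eta> \<union> J, \<eta>)" and j = "\<lambda>(I, \<eta>). (card \<eta>, \<eta>, I - \<eta>)"])
    fix a assume a: "a \<in> ?A"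
    obtain I \<eta> where [simp]: "a = (I, \<eta>)" by (cases a)
    have I: "I \<subseteq> V" "card I = S" "\<eta> \<subseteq> I" "finite I"
      using a fin[of I S] by (simp_all add: subsets_of_size_def)
    have "card \<eta> \<le> S" using card_mono[OF I(4,3)] I(2) by simp
    then show "(case a of (I, \<eta>) \<Rightarrow> (card \<eta>, \<eta>, I - \<eta>)) \<in> ?B"
      using I finite_subset[OF I(3,4)] by (auto simp: subsets_of_size_def card_Diff_subset)
    show "(case case a of (I, \<eta>) \<Rightarrow> (card \<eta>, \<eta>, I - \<eta>) of (s, \<eta>, J) \<Rightarrow> (\<eta> \<union> J, \<eta>)) = a"
      using I by auto
  next
    fix b assume b: "b \<in> ?B"
    obtain s \<eta> J where [simp]: "b = (s, \<eta>, J)" by (cases b)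
    have I: "s \<le> S" "\<eta> \<subseteq> V" "card \<eta> = s" "J \<subseteq> V - \<eta>" "card J = S - s"
      using b by (simp_all add: subsets_of_size_def)
    have "finite \<eta>" "finite J" "\<eta> \<inter> J = {}" using I V by (auto intro: finite_subset)
    then have "card (\<eta> \<union> J) = S" using I by (simp add: card_Un_disjoint)
    then show "(case b of (s, \<eta>, J) \<Rightarrow> (\<eta> \<union> J, \<eta>)) \<in> ?A"
      using I by (auto simp: subsets_of_size_def)
    show "(case case b of (s, \<eta>, J) \<Rightarrow> (\<eta> \<union> J, \<eta>) of (I, \<eta>) \<Rightarrow> (card \<eta>, \<eta>, I - \<eta>)) = b"
      using I by auto
  qed auto
  also have "\<dots> = (\<Sum>s\<le>S. \<Sum>(\<eta>, J)\<in>Sigma (subsets_of_size V s) (\<lambda>\<eta>. subsets_of_size (V - \<eta>) (S - s)). f \<eta> J)"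
    by (subst sum.Sigma) (use V in \<open>auto intro!: finite_SigmaI finite_subsets_of_size simp: split_beta\<close>)
  also have "\<dots> = (\<Sum>s\<le>S. \<Sum>\<eta>\<in>subsets_of_size V s. \<Sum>J\<in>subsets_of_size (V - \<eta>) (S - s). f \<eta> J)"
    by (intro sum.cong refl sum.Sigma[symmetric]) (use V in \<open>auto intro!: finite_subsets_of_size\<close>)
  finally show ?thesis .
qed


section \<open>Random supports of an incoherent frame\<close>
corollary frame_chernoff_le:
  fixes K T :: real
  assumes "finite V" "\<And>j. j \<in> V \<Longrightarrow> ip d (x j) (x j) \<le> R" "0 \<le> R"
    and "\<And>u. (\<Sum>j\<in>V. (ip d (x j) u)\<^sup>2) \<le> B * ip d u u" "0 \<le> B"
    and "(\<Sum>j\<in>V. ip d (x j) (x j)) \<le> B * D" "0 \<le> D"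
    and "0 < K" "R * real Q \<le> K" "exp 1 * B * real s \<le> K * (real (card V) - real s + 1)"
    and "s \<le> card V" "1 \<le> Q" and T: "exp 2 * K \<le> T"
    and P: "\<And>I. I \<in> subsets_of_size V s \<Longrightarrow> (\<And>u. (\<Sum>j\<in>I. (ip d (x j) u)\<^sup>2) \<le> T * ip d u u) \<Longrightarrow> P I"
  shows "real (card {I\<in>subsets_of_size V s. \<not> P I}) \<le> real (card V choose s) * D * exp (- 2 * real Q)"
proof -
  have sub: "{I\<in>subsets_of_size V s. \<not> P I} \<subseteq> {I\<in>subsets_of_size V s.
      \<not> (\<forall>u. (\<Sum>j\<in>I. (ip d (x j) u)\<^sup>2) \<le> exp 2 * K * ip d u u)}"
  proof
    fix I assume I: "I \<in> {I\<in>subsets_of_size V s. \<not> P I}"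
    have "P I" if a: "\<forall>u. (\<Sum>j\<in>I. (ip d (x j) u)\<^sup>2) \<le> exp 2 * K * ip d u u"
    proof (rule P)
      fix u show "(\<Sum>j\<in>I. (ip d (x j) u)\<^sup>2) \<le> T * ip d u u"
        using a[rule_format, of u] mult_right_mono[OF T ip_nonneg, of d u] by linarith
    qed (use I in simp)
    then show "I \<in> {I\<in>subsets_of_size V s.
      \<not> (\<forall>u. (\<Sum>j\<in>I. (ip d (x j) u)\<^sup>2) \<le> exp 2 * K * ip d u u)}" using I by blast
  qed
  have "real (card {I\<in>subsets_of_size V s. \<not> P I}) \<le> real (card {I\<in>subsets_of_size V s.
      \<not> (\<forall>u. (\<Sum>j\<in>I. (ip d (x j) u)\<^sup>2) \<le> exp 2 * K * ip d u u)})"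
    using finite_subsets_of_size[OF assms(1)] by (intro of_nat_mono card_mono sub) auto
  also have "\<dots> \<le> real (card V choose s) * D * exp (- 2 * real Q)"
    by (rule frame_chernoff) (use assms in auto)
  finally show ?thesis .
qed

definition synth :: "(nat \<Rightarrow> nat \<Rightarrow> real) \<Rightarrow> nat set \<Rightarrow> (nat \<Rightarrow> real) \<Rightarrow> nat \<Rightarrow> real" where
  "synth x I w = (\<lambda>k. \<Sum>j\<in>I. w j * x j k)"

lemma ip_synth_right: "ip d u (synth x I w) = (\<Sum>j\<in>I. w j * ip d u (x j))"
  unfolding synth_def by (rule ip_sum_right)

text \<open>Synthesis is the adjoint of analysis, so both have the same norm.\<close>
lemma synth_norm_le:
  assumes t0: "0 \<le> t" and t: "\<And>u. (\<Sum>j\<in>I. (ip d (x j) u)\<^sup>2) \<le> t * ip d u u"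
  shows "ip d (synth x I w) (synth x I w) \<le> t * (\<Sum>j\<in>I. (w j)\<^sup>2)"
proof (cases "ip d (synth x I w) (synth x I w) = 0")
  case True
  then show ?thesis using t0 by (simp add: sum_nonneg)
next
  case False
  let ?y = "synth x I w"
  have pos: "0 < ip d ?y ?y" using False ip_nonneg[of d ?y] by simp
  have "(ip d ?y ?y)\<^sup>2 = (\<Sum>j\<in>I. w j * ip d (x j) ?y)\<^sup>2"
    by (subst ip_synth_right) (simp add: ip_commute)
  also have "\<dots> \<le> (\<Sum>j\<in>I. (w j)\<^sup>2) * (\<Sum>j\<in>I. (ip d (x j) ?y)\<^sup>2)"
    by (rule Cauchy_Schwarz_ineq_sum)
  also have "\<dots> \<le> (\<Sum>j\<in>I. (w j)\<^sup>2) * (t * ip d ?y ?y)"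
    by (intro mult_left_mono t sum_nonneg) auto
  finally show ?thesis using pos by (simp add: power2_eq_square ac_simps)
qed

lemma exp_1_le_3: "exp 1 \<le> (3::real)"
  using exp_le by simp

lemma exp_2_le_8: "exp 2 \<le> (8::real)"
proof -
  have "exp (2::real) = exp 1 ^ 2" by (simp flip: exp_of_nat_mult)
  also have "\<dots> \<le> (272 / 100)\<^sup>2" using e_less_272 by (intro power_mono) auto
  also have "\<dots> \<le> 8" by (simp add: power2_eq_square)
  finally show ?thesis .
qed

text \<open>The constants are chosen backwards from the requirement that cross forms be at most 1/16, so that
decoupling yields 1/2. With coherence 2^(-9)/L and sparsity constant 2^(-17), the concentration inequality, which
loses the factor exp 2 <= 8, bounds the squared rows by 2^(-12)/L and the squared norm of the cross
forms by 2^(-8) = (1/16)^2. The assumption p >= e means L >= 1.\<close>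
locale incoherent_frame =
  fixes n p :: nat and x :: "nat \<Rightarrow> nat \<Rightarrow> real" and B :: real and S :: nat
  assumes p_ge: "exp 1 \<le> real p"
    and unit: "\<And>j. j < p \<Longrightarrow> ip n (x j) (x j) = 1"
    and frame: "\<And>u. (\<Sum>j<p. (ip n (x j) u)\<^sup>2) \<le> B * ip n u u"
    and coherent: "\<And>i j. i < p \<Longrightarrow> j < p \<Longrightarrow> i \<noteq> j \<Longrightarrow> \<bar>ip n (x i) (x j)\<bar> \<le> 1 / 512 / ln (real p)"
    and sparse: "real S * (B * ln (real p)) \<le> 1 / 131072 * real p"
begin

abbreviation L :: real where "L \<equiv> ln (real p)"

text \<open>The order of the moments: a failure probability exp(-2Q) <= p^(-2) leaves room for a union bound
over p events.\<close>
definition Q :: nat where "Q = nat \<lceil>L\<rceil>"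

lemma p_pos: "0 < real p"
  using p_ge exp_gt_zero[of "1::real"] by linarith

lemma L_ge: "1 \<le> L"
  using p_ge p_pos by (simp add: ln_ge_iff)

lemma Q_bounds: "L \<le> real Q" "real Q \<le> 2 * L" "1 \<le> Q"
proof -
  show "L \<le> real Q" unfolding Q_def by (rule real_nat_ceiling_ge)
  have "real Q < L + 1" unfolding Q_def using L_ge by linarith
  then show "real Q \<le> 2 * L" using L_ge by linarith
  show "1 \<le> Q" using \<open>L \<le> real Q\<close> L_ge by linarith
qed

lemma exp_Q: "real p * exp (- 2 * real Q) \<le> 1 / real p" "exp (- 2 * real Q) \<le> 1 / (real p * real p)"
proof -
  have "exp (- 2 * real Q) \<le> exp (- L + - L)" using Q_bounds by simp
  also have "\<dots> = 1 / (real p * real p)"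
    unfolding exp_add exp_minus using p_pos by (simp add: field_simps)
  finally show *: "exp (- 2 * real Q) \<le> 1 / (real p * real p)" .
  show "real p * exp (- 2 * real Q) \<le> 1 / real p"
    using mult_left_mono[OF *, of "real p"] p_pos by simp
qed

lemma B_ge: "1 \<le> B"
proof -
  have 0: "0 < p" using p_pos by simp
  have "1 = (ip n (x 0) (x 0))\<^sup>2" using unit[OF 0] by simp
  also have "\<dots> \<le> (\<Sum>j<p. (ip n (x j) (x 0))\<^sup>2)"
    using 0 by (intro member_le_sum) auto
  also have "\<dots> \<le> B" using frame[of "x 0"] unit[OF 0] by simp
  finally show ?thesis .
qed

lemma SB_le:
  assumes "s \<le> S"
  shows "B * real s \<le> 1 / 131072 * real p / L"
proof -
  from assms have "B * real s \<le> B * real S" using B_ge by (intro mult_left_mono) auto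
  also have "\<dots> \<le> 1 / 131072 * real p / L" using sparse L_ge by (simp add: field_simps)
  finally show ?thesis .
qed

lemma S_le: "s \<le> S \<Longrightarrow> real s \<le> real p / 4" "S \<le> p"
proof -
  have *: "real s \<le> real p / 4" if s: "s \<le> S" for s
  proof -
    have "real s \<le> B * real s" using B_ge by (simp add: mult_le_cancel_right1)
    also have "\<dots> \<le> 1 / 131072 * real p / L" by (rule SB_le[OF s])
    also have "\<dots> \<le> 1 / 131072 * real p" using L_ge by (simp add: field_simps mult_le_cancel_left1)
    finally show ?thesis using p_pos by (simp add: field_simps)
  qed
  then show "s \<le> S \<Longrightarrow> real s \<le> real p / 4" .
  show "S \<le> p" using *[of S] by simp
qed

definition bounded_on :: "nat set \<Rightarrow> bool" where
  "bounded_on I \<longleftrightarrow> (\<forall>u. (\<Sum>j\<in>I. (ip n (x j) u)\<^sup>2) \<le> 16 * L * ip n u u)"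

definition spread_on :: "nat set \<Rightarrow> bool" where
  "spread_on I \<longleftrightarrow> (\<forall>i\<in>{..<p} - I. (\<Sum>j\<in>I. (ip n (x i) (x j))\<^sup>2) \<le> 1 / 4096 / L)"

abbreviation gram :: "nat \<Rightarrow> nat \<Rightarrow> real" where
  "gram i j \<equiv> ip n (x i) (x j)"

definition cross_small :: "nat set \<Rightarrow> nat set \<Rightarrow> bool" where
  "cross_small \<eta> J \<longleftrightarrow> (\<forall>u. \<bar>cross_form gram J \<eta> u\<bar> \<le> 1 / 16 * (\<Sum>i\<in>\<eta> \<union> J. (u i)\<^sup>2))"

lemma few_unbounded:
  assumes s: "s \<le> S"
  shows "real (card {I\<in>subsets_of_size {..<p} s. \<not> bounded_on I}) \<le> real (p choose s) / real p"
proof -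
  have "real (card {I\<in>subsets_of_size {..<p} s. \<not> bounded_on I})
    \<le> real (card {..<p} choose s) * real p * exp (- 2 * real Q)"
  proof (rule frame_chernoff_le[where R = 1 and B = B and K = "2 * L" and T = "16 * L"])
    show "(\<Sum>j<p. ip n (x j) (x j)) \<le> B * real p"
      using unit B_ge by (simp add: mult_le_cancel_right1)
    have "exp 1 * (B * real s) \<le> 3 * (1 / 131072 * real p / L)"
      using SB_le[OF s] exp_1_le_3 B_ge L_ge by (intro mult_mono) auto
    also have "\<dots> \<le> 3 * (1 / 131072 * real p)"
      using L_ge by (simp add: field_simps mult_le_cancel_left1)
    also have "\<dots> \<le> 1 * (real p - real s + 1)"
      using S_le(1)[OF s] by simp
    also have "\<dots> \<le> 2 * L * (real p - real s + 1)"
      using S_le(1)[OF s] L_ge by (intro mult_right_mono) auto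
    finally show "exp 1 * B * real s \<le> 2 * L * (real (card {..<p}) - real s + 1)" by simp
    show "exp 2 * (2 * L) \<le> 16 * L" using exp_2_le_8 L_ge by simp
    show "s \<le> card {..<p}" using s S_le(2) by simp
  qed (use unit frame B_ge Q_bounds L_ge in \<open>auto simp: bounded_on_def\<close>)
  also have "\<dots> \<le> real (p choose s) * (1 / real p)"
    using mult_left_mono[OF exp_Q(1), of "real (p choose s)"] by (simp add: ac_simps)
  finally show ?thesis by simp
qed

text \<open>Concentration for a sum of scalars: the entries of one row are vectors of dimension one. The
diagonal entry is not small and is set to 0; for i outside I the sum does not contain it.\<close>
lemma few_unspread_at:
  assumes s: "s \<le> S" and i: "i < p"
  shows "real (card {I\<in>subsets_of_size {..<p} s. \<not> (i \<notin> I \<longrightarrow> (\<Sum>j\<in>I. (gram i j)\<^sup>2) \<le> 1 / 4096 / L)})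
    \<le> real (p choose s) * exp (- 2 * real Q)"
proof -
  define y where "y j = (\<lambda>_::nat. if j = i then 0 else gram i j)" for j
  have ip1: "ip 1 (y j) u = (if j = i then 0 else gram i j) * u 0" for j u
    by (simp add: ip_def y_def)
  have row: "(\<Sum>j<p. (if j = i then 0 else gram i j)\<^sup>2) \<le> B"
  proof -
    have "(\<Sum>j<p. (if j = i then 0 else gram i j)\<^sup>2) \<le> (\<Sum>j<p. (ip n (x j) (x i))\<^sup>2)"
      by (intro sum_mono) (auto simp: ip_commute)
    then show ?thesis using frame[of "x i"] unit[OF i] by simp
  qed
  have "real (card {I\<in>subsets_of_size {..<p} s. \<not> (i \<notin> I \<longrightarrow> (\<Sum>j\<in>I. (gram i j)\<^sup>2) \<le> 1 / 4096 / L)})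
    \<le> real (card {..<p} choose s) * 1 * exp (- 2 * real Q)"
  proof (rule frame_chernoff_le[where d = 1 and x = y and R = "(1 / 512 / L)\<^sup>2" and B = B
        and K = "1 / 32768 / L" and T = "1 / 4096 / L"])
    show "ip 1 (y j) (y j) \<le> (1 / 512 / L)\<^sup>2" if "j \<in> {..<p}" for j
    proof (cases "j = i")
      case False
      then have "(gram i j)\<^sup>2 \<le> (1 / 512 / L)\<^sup>2"
        using coherent[OF i, of j] that by (subst abs_le_square_iff[symmetric]) (use L_ge in simp)
      then show ?thesis using False unfolding ip1 by (simp add: y_def power2_eq_square)
    next
      case True
      then show ?thesis unfolding ip1 by simp
    qed
    show "(\<Sum>j<p. (ip 1 (y j) u)\<^sup>2) \<le> B * ip 1 u u" for u
    proof -
      have "(\<Sum>j<p. (ip 1 (y j) u)\<^sup>2) = (\<Sum>j<p. (if j = i then 0 else gram i j)\<^sup>2) * (u 0)\<^sup>2"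
        unfolding ip1 by (simp add: power_mult_distrib sum_distrib_right)
      also have "\<dots> \<le> B * (u 0)\<^sup>2" by (intro mult_right_mono row) simp
      finally show ?thesis by (simp add: ip_def power2_eq_square)
    qed
    show "(\<Sum>j<p. ip 1 (y j) (y j)) \<le> B * 1"
      using row unfolding ip1 by (simp add: y_def power2_eq_square)
    have "(1 / 512 / L)\<^sup>2 * real Q \<le> (1 / 512 / L)\<^sup>2 * (2 * L)"
      using Q_bounds by (intro mult_left_mono) auto
    also have "\<dots> \<le> 1 / 32768 / L"
      using L_ge by (simp add: field_simps power2_eq_square)
    finally show "(1 / 512 / L)\<^sup>2 * real Q \<le> 1 / 32768 / L" .
    have "exp 1 * (B * real s) \<le> 3 * (1 / 131072 * real p / L)"
      using SB_le[OF s] exp_1_le_3 B_ge L_ge by (intro mult_mono) auto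
    also have "\<dots> = 1 / 32768 / L * (3 / 4 * real p)" by simp
    also have "\<dots> \<le> 1 / 32768 / L * (real p - real s + 1)"
      using S_le(1)[OF s] L_ge by (intro mult_left_mono) auto
    finally show "exp 1 * B * real s \<le> 1 / 32768 / L * (real (card {..<p}) - real s + 1)" by simp
    show "exp 2 * (1 / 32768 / L) \<le> 1 / 4096 / L"
      using exp_2_le_8 L_ge by (simp add: field_simps)
    show "s \<le> card {..<p}" using s S_le(2) by simp
    show "i \<notin> I \<longrightarrow> (\<Sum>j\<in>I. (gram i j)\<^sup>2) \<le> 1 / 4096 / L"
      if "\<And>u. (\<Sum>j\<in>I. (ip 1 (y j) u)\<^sup>2) \<le> 1 / 4096 / L * ip 1 u u" for I
    proof
      assume "i \<notin> I"
      then have "(\<Sum>j\<in>I. (gram i j)\<^sup>2) = (\<Sum>j\<in>I. (ip 1 (y j) (\<lambda>_. 1))\<^sup>2)"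
        unfolding ip1 by (intro sum.cong) auto
      then show "(\<Sum>j\<in>I. (gram i j)\<^sup>2) \<le> 1 / 4096 / L"
        using that[of "\<lambda>_. 1"] by (simp add: ip_def)
    qed
  qed (use B_ge Q_bounds L_ge in auto)
  then show ?thesis by simp
qed

lemma few_unspread:
  assumes s: "s \<le> S"
  shows "real (card {I\<in>subsets_of_size {..<p} s. \<not> spread_on I}) \<le> real (p choose s) / real p"
proof -
  let ?b = "\<lambda>i. {I\<in>subsets_of_size {..<p} s. \<not> (i \<notin> I \<longrightarrow> (\<Sum>j\<in>I. (gram i j)\<^sup>2) \<le> 1 / 4096 / L)}"
  have "card {I\<in>subsets_of_size {..<p} s. \<not> spread_on I} \<le> card (\<Union>i<p. ?b i)"
    by (intro card_mono) (auto simp: spread_on_def finite_subsets_of_size)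
  also have "\<dots> \<le> (\<Sum>i<p. card (?b i))" by (intro card_UN_le) simp
  finally have "real (card {I\<in>subsets_of_size {..<p} s. \<not> spread_on I}) \<le> real (\<Sum>i<p. card (?b i))"
    by (rule of_nat_mono)
  also have "\<dots> = (\<Sum>i<p. real (card (?b i)))" by (rule of_nat_sum)
  also have "\<dots> \<le> (\<Sum>i<p. real (p choose s) * exp (- 2 * real Q))"
    by (intro sum_mono few_unspread_at s) simp
  also have "\<dots> = real (p choose s) * (real p * exp (- 2 * real Q))" by simp
  also have "\<dots> \<le> real (p choose s) * (1 / real p)"
    by (intro mult_left_mono exp_Q) simp
  finally show ?thesis by simp
qed

text \<open>With the part eta fixed, the rows of the Gram matrix truncated to eta are vectors of dimension p:
each is short because eta is spread, and together they form a frame with bound 16 L B because eta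
is bounded. The factor L is compensated by the factor 1/L in the sparsity.\<close>
lemma few_cross_large:
  assumes \<eta>: "\<eta> \<in> subsets_of_size {..<p} s" "bounded_on \<eta>" "spread_on \<eta>" and s: "s \<le> S"
  shows "real (card {J\<in>subsets_of_size ({..<p} - \<eta>) (S - s). \<not> cross_small \<eta> J})
    \<le> real ((p - s) choose (S - s)) / real p"
proof -
  let ?V = "{..<p} - \<eta>"
  define h where "h i = (\<lambda>j. if j \<in> \<eta> then gram i j else 0)" for i
  have \<eta>': "\<eta> \<subseteq> {..<p}" "card \<eta> = s" using \<eta> by (simp_all add: subsets_of_size_def)
  then have fin: "finite \<eta>" by (auto intro: finite_subset)
  have cV: "card ?V = p - s" using \<eta>' fin by (simp add: card_Diff_subset)
  have sp: "s \<le> p" using s S_le(2) by simp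
  have ip_h: "ip p (h i) u = (\<Sum>j\<in>\<eta>. u j * gram i j)" for i u
  proof -
    have "ip p (h i) u = (\<Sum>j<p. if j \<in> \<eta> then u j * gram i j else 0)"
      unfolding ip_def h_def by (intro sum.cong) auto
    also have "\<dots> = (\<Sum>j\<in>\<eta>. u j * gram i j)"
      using \<eta>' fin by (simp add: sum.If_cases Int_absorb1)
    finally show ?thesis .
  qed
  have R: "ip p (h i) (h i) \<le> 1 / 4096 / L" if "i \<in> ?V" for i
  proof -
    have "ip p (h i) (h i) = (\<Sum>j\<in>\<eta>. (gram i j)\<^sup>2)"
      unfolding ip_h by (intro sum.cong) (auto simp: h_def power2_eq_square)
    then show ?thesis using \<eta>(3) that by (simp add: spread_on_def)
  qed
  have fr: "(\<Sum>i\<in>?V. (ip p (h i) u)\<^sup>2) \<le> 16 * L * B * ip p u u" for u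
  proof -
    have "(\<Sum>i\<in>?V. (ip p (h i) u)\<^sup>2) = (\<Sum>i\<in>?V. (ip n (x i) (synth x \<eta> u))\<^sup>2)"
      by (simp add: ip_h ip_synth_right)
    also have "\<dots> \<le> (\<Sum>i<p. (ip n (x i) (synth x \<eta> u))\<^sup>2)"
      by (intro sum_mono2) auto
    also have "\<dots> \<le> B * ip n (synth x \<eta> u) (synth x \<eta> u)" by (rule frame)
    also have "\<dots> \<le> B * (16 * L * (\<Sum>j\<in>\<eta>. (u j)\<^sup>2))"
      using \<eta>(2) B_ge L_ge by (intro mult_left_mono synth_norm_le) (auto simp: bounded_on_def)
    also have "\<dots> \<le> B * (16 * L * ip p u u)"
      using B_ge L_ge \<eta>' unfolding ip_def power2_eq_square by (intro mult_left_mono sum_mono2) auto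
    finally show ?thesis by (simp add: ac_simps)
  qed
  have "real (card {J\<in>subsets_of_size ?V (S - s). \<not> cross_small \<eta> J})
    \<le> real (card ?V choose (S - s)) * real p * exp (- 2 * real Q)"
  proof (rule frame_chernoff_le[where d = p and x = h and R = "1 / 4096 / L" and B = "16 * L * B"
        and K = "1 / 2048" and T = "1 / 256"])
    have "(\<Sum>i\<in>?V. ip p (h i) (h i)) \<le> (\<Sum>i\<in>?V. 1)"
    proof (intro sum_mono)
      fix i assume "i \<in> ?V"
      have "1 / 4096 / L \<le> 1" using L_ge by (simp add: field_simps)
      then show "ip p (h i) (h i) \<le> 1" using R[OF \<open>i \<in> ?V\<close>] by simp
    qed
    also have "\<dots> \<le> 1 * 1 * real p" by (simp add: cV)
    also have "\<dots> \<le> 16 * L * B * real p"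
      using B_ge L_ge by (intro mult_right_mono mult_mono) auto
    finally show "(\<Sum>i\<in>?V. ip p (h i) (h i)) \<le> 16 * L * B * real p" .
    have "1 / 4096 / L * real Q \<le> 1 / 4096 / L * (2 * L)"
      using Q_bounds L_ge by (intro mult_left_mono) auto
    then show "1 / 4096 / L * real Q \<le> 1 / 2048"
      using L_ge by simp
    have "exp 1 * (16 * L * (B * real (S - s))) \<le> 3 * (16 * L * (1 / 131072 * real p / L))"
      using SB_le[of "S - s"] exp_1_le_3 B_ge L_ge by (intro mult_mono) auto
    also have "\<dots> = 1 / 2048 * (3 / 4 * real p)" using L_ge by simp
    also have "\<dots> \<le> 1 / 2048 * (real (card ?V) - real (S - s) + 1)"
      using S_le(1)[of S] s sp unfolding cV by (intro mult_left_mono) (auto simp: of_nat_diff)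
    finally show "exp 1 * (16 * L * B) * real (S - s) \<le> 1 / 2048 * (real (card ?V) - real (S - s) + 1)"
      by (simp add: ac_simps)
    show "exp 2 * (1 / 2048) \<le> (1 / 256 :: real)" using exp_2_le_8 by simp
    show "S - s \<le> card ?V" using S_le(2) by (simp add: cV)
    show "cross_small \<eta> J" if J: "J \<in> subsets_of_size ?V (S - s)"
      and bd: "\<And>u. (\<Sum>i\<in>J. (ip p (h i) u)\<^sup>2) \<le> 1 / 256 * ip p u u" for J
      unfolding cross_small_def
    proof
      fix u :: "nat \<Rightarrow> real"
      let ?E = "\<lambda>I. \<Sum>i\<in>I. (u i)\<^sup>2"
      have finJ: "finite J" and disj: "\<eta> \<inter> J = {}"
        using J by (auto simp: subsets_of_size_def intro: finite_subset[of J "{..<p}"])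
      \<comment> \<open>The frame bound involves all p coordinates, the cross form only those in eta.\<close>
      define v where "v i = (if i \<in> \<eta> then u i else 0)" for i
      have vv: "ip p v v = ?E \<eta>"
      proof -
        have "ip p v v = (\<Sum>j<p. if j \<in> \<eta> then (u j)\<^sup>2 else 0)"
          unfolding ip_def v_def by (intro sum.cong) (auto simp: power2_eq_square)
        then show ?thesis using \<eta>' fin by (simp add: sum.If_cases Int_absorb1)
      qed
      have "cross_form gram J \<eta> u = (\<Sum>i\<in>J. u i * ip p (h i) v)"
        unfolding cross_form_def ip_h sum_distrib_left
        by (intro sum.cong refl) (auto simp: v_def ac_simps)
      then have "(cross_form gram J \<eta> u)\<^sup>2 \<le> ?E J * (\<Sum>i\<in>J. (ip p (h i) v)\<^sup>2)"
        using Cauchy_Schwarz_ineq_sum[of u "\<lambda>i. ip p (h i) v" J] by simp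
      also have "\<dots> \<le> ?E J * (1 / 256 * ?E \<eta>)"
        using bd[of v] vv by (intro mult_left_mono sum_nonneg) auto
      also have "\<dots> \<le> ?E (\<eta> \<union> J) * (1 / 256 * ?E (\<eta> \<union> J))"
        using fin finJ by (intro mult_mono sum_mono2 sum_nonneg mult_nonneg_nonneg) auto
      also have "\<dots> = (1 / 16 * ?E (\<eta> \<union> J))\<^sup>2" by (simp add: power2_eq_square)
      finally have "\<bar>cross_form gram J \<eta> u\<bar> \<le> \<bar>1 / 16 * ?E (\<eta> \<union> J)\<bar>"
        unfolding abs_le_square_iff .
      moreover have "0 \<le> ?E (\<eta> \<union> J)" by (rule sum_nonneg) simp
      ultimately show "\<bar>cross_form gram J \<eta> u\<bar> \<le> 1 / 16 * ?E (\<eta> \<union> J)" by simp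
    qed
  qed (use R fr B_ge Q_bounds L_ge in auto)
  also have "\<dots> \<le> real ((p - s) choose (S - s)) * (1 / real p)"
    using mult_left_mono[OF exp_Q(1), of "real ((p - s) choose (S - s))"] by (simp add: ac_simps cV)
  finally show ?thesis by simp
qed

end


context incoherent_frame
begin

definition riesz_on :: "nat set \<Rightarrow> bool" where
  "riesz_on I \<longleftrightarrow> (\<forall>u. 1 / 2 * (\<Sum>i\<in>I. (u i)\<^sup>2) \<le> ip n (synth x I u) (synth x I u))"

lemma synth_norm_eq:
  assumes "finite I" "I \<subseteq> {..<p}"
  shows "ip n (synth x I u) (synth x I u) = (\<Sum>i\<in>I. (u i)\<^sup>2) + hollow_form gram I u"
proof -
  have "ip n (synth x I u) (synth x I u) = (\<Sum>i\<in>I. \<Sum>j\<in>I. u i * u j * gram i j)"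
    unfolding ip_synth_right ip_commute[of n "synth x I u"] ip_synth_right sum_distrib_left
    by (simp add: ac_simps)
  also have "\<dots> = (\<Sum>i\<in>I. u i * u i * gram i i + (\<Sum>j\<in>I - {i}. u i * u j * gram i j))"
    using assms by (intro sum.cong refl sum.remove) auto
  also have "\<dots> = (\<Sum>i\<in>I. (u i)\<^sup>2) + hollow_form gram I u"
    unfolding hollow_form_def sum.distrib
    using assms unit by (intro arg_cong2[where f = "(+)"] sum.cong refl) (auto simp: power2_eq_square subset_iff)
  finally show ?thesis .
qed

lemma riesz_onI:
  assumes I: "I \<in> subsets_of_size {..<p} S"
    and few: "4 * card {\<eta>\<in>Pow I. \<not> cross_small \<eta> (I - \<eta>)} \<le> 2 ^ S"
  shows "riesz_on I"
  unfolding riesz_on_def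
proof
  fix u :: "nat \<Rightarrow> real"
  have I': "I \<subseteq> {..<p}" "card I = S" using I by (simp_all add: subsets_of_size_def)
  then have fin: "finite I" by (auto intro: finite_subset)
  have "{\<eta>\<in>Pow I. \<not> cross_small \<eta> (I - \<eta>)} =
    {\<eta>\<in>Pow I. \<not> (\<forall>u. \<bar>cross_form gram (I - \<eta>) \<eta> u\<bar> \<le> 1 / 16 * (\<Sum>i\<in>I. (u i)\<^sup>2))}"
    by (rule Collect_cong) (auto simp: cross_small_def Un_absorb1)
  then have "\<bar>hollow_form gram I u\<bar> \<le> 8 * (1 / 16) * (\<Sum>i\<in>I. (u i)\<^sup>2)"
    using few I' by (intro decoupling[OF fin]) (auto simp: ip_commute)
  then show "1 / 2 * (\<Sum>i\<in>I. (u i)\<^sup>2) \<le> ip n (synth x I u) (synth x I u)"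
    unfolding synth_norm_eq[OF fin I'(1)] by simp
qed

lemma few_cross_large_pairs:
  assumes s: "s \<le> S"
  shows "(\<Sum>\<eta>\<in>subsets_of_size {..<p} s. real (card {J\<in>subsets_of_size ({..<p} - \<eta>) (S - s). \<not> cross_small \<eta> J}))
    \<le> real (p choose S) * real (S choose s) * (3 / real p)"
proof -
  let ?c = "real ((p - s) choose (S - s))"
  let ?A = "subsets_of_size {..<p} s"
  let ?i = "\<lambda>P \<eta>. if P \<eta> then 0 else 1 :: real"
  have fin: "finite ?A" by (simp add: finite_subsets_of_size)
  have "(\<Sum>\<eta>\<in>?A. real (card {J\<in>subsets_of_size ({..<p} - \<eta>) (S - s). \<not> cross_small \<eta> J}))
    \<le> (\<Sum>\<eta>\<in>?A. ?c * (1 / real p + ?i bounded_on \<eta> + ?i spread_on \<eta>))"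
  proof (rule sum_mono)
    fix \<eta> assume \<eta>: "\<eta> \<in> ?A"
    show "real (card {J\<in>subsets_of_size ({..<p} - \<eta>) (S - s). \<not> cross_small \<eta> J})
      \<le> ?c * (1 / real p + ?i bounded_on \<eta> + ?i spread_on \<eta>)"
    proof (cases "bounded_on \<eta> \<and> spread_on \<eta>")
      case True
      then show ?thesis using few_cross_large[OF \<eta> _ _ s] by simp
    next
      case False
      have \<eta>': "\<eta> \<subseteq> {..<p}" "card \<eta> = s" using \<eta> by (simp_all add: subsets_of_size_def)
      then have "card ({..<p} - \<eta>) = p - s" by (simp add: card_Diff_subset finite_subset)
      then have "card (subsets_of_size ({..<p} - \<eta>) (S - s)) = (p - s) choose (S - s)"
        by (simp add: card_subsets_of_size)
      then have "real (card {J\<in>subsets_of_size ({..<p} - \<eta>) (S - s). \<not> cross_small \<eta> J}) \<le> ?c * 1"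
        by (metis (no_types, lifting) card_mono finite_subsets_of_size finite_Diff finite_lessThan
            mem_Collect_eq mult.right_neutral of_nat_mono subsetI)
      also have "\<dots> \<le> ?c * (1 / real p + ?i bounded_on \<eta> + ?i spread_on \<eta>)"
        using False by (intro mult_left_mono) auto
      finally show ?thesis .
    qed
  qed
  also have "\<dots> = ?c * (real (card ?A) / real p + real (card {\<eta>\<in>?A. \<not> bounded_on \<eta>})
      + real (card {\<eta>\<in>?A. \<not> spread_on \<eta>}))"
    using fin by (simp add: sum_distrib_left[symmetric] sum.distrib sum.If_cases Int_def)
  also have "\<dots> \<le> ?c * (real (p choose s) / real p + real (p choose s) / real p + real (p choose s) / real p)"
    using few_unbounded[OF s] few_unspread[OF s]
    by (intro mult_left_mono add_mono) (auto simp: card_subsets_of_size)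
  also have "\<dots> = real ((p choose s) * ((p - s) choose (S - s))) * (3 / real p)"
    by simp
  also have "(p choose s) * ((p - s) choose (S - s)) = (p choose S) * (S choose s)"
    using choose_mult[OF s S_le(2)] by simp
  finally show ?thesis by simp
qed

text \<open>By decoupling, a support that is not well conditioned has more than a quarter of its splittings
bad, which turns the count of bad pairs into a count of bad supports at the cost of a factor 4.\<close>
lemma few_not_riesz:
  "real (card {I\<in>subsets_of_size {..<p} S. \<not> riesz_on I}) \<le> real (p choose S) * (12 / real p)"
proof -
  let ?A = "subsets_of_size {..<p} S"
  let ?b = "\<lambda>\<eta> J. if cross_small \<eta> J then 0 else 1 :: real"
  have fin: "finite (subsets_of_size V s)" if "V \<subseteq> {..<p}" for V s
    using that by (simp add: finite_subsets_of_size finite_subset)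
  have card_eq: "real (card {\<eta>\<in>C. \<not> P \<eta>}) = (\<Sum>\<eta>\<in>C. if P \<eta> then 0 else 1)" if "finite C"
    for P and C :: "nat set set"
    using that by (simp add: sum.If_cases Int_def)
  have "2 ^ S / 4 * real (card {I\<in>?A. \<not> riesz_on I})
    \<le> (\<Sum>I\<in>?A. real (card {\<eta>\<in>Pow I. \<not> cross_small \<eta> (I - \<eta>)}))"
  proof (rule card_le_sum_of_ge)
    fix I assume I: "I \<in> ?A" "\<not> riesz_on I"
    then have "2 ^ S \<le> 4 * card {\<eta>\<in>Pow I. \<not> cross_small \<eta> (I - \<eta>)}"
      using riesz_onI by force
    then have "real (2 ^ S) \<le> real (4 * card {\<eta>\<in>Pow I. \<not> cross_small \<eta> (I - \<eta>)})"
      by (rule of_nat_mono)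
    then show "2 ^ S / 4 \<le> real (card {\<eta>\<in>Pow I. \<not> cross_small \<eta> (I - \<eta>)})" by simp
  qed (use fin in auto)
  also have "\<dots> = (\<Sum>I\<in>?A. \<Sum>\<eta>\<in>Pow I. ?b \<eta> (I - \<eta>))"
    by (intro sum.cong refl card_eq) (auto simp: subsets_of_size_def intro: finite_subset)
  also have "\<dots> = (\<Sum>s\<le>S. \<Sum>\<eta>\<in>subsets_of_size {..<p} s. \<Sum>J\<in>subsets_of_size ({..<p} - \<eta>) (S - s). ?b \<eta> J)"
    by (rule sum_subset_pairs) simp
  also have "\<dots> = (\<Sum>s\<le>S. \<Sum>\<eta>\<in>subsets_of_size {..<p} s.
      real (card {J\<in>subsets_of_size ({..<p} - \<eta>) (S - s). \<not> cross_small \<eta> J}))"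
    by (intro sum.cong refl card_eq[symmetric] fin) auto
  also have "\<dots> \<le> (\<Sum>s\<le>S. real (p choose S) * real (S choose s) * (3 / real p))"
    by (intro sum_mono few_cross_large_pairs) simp
  also have "\<dots> = real (p choose S) * (3 / real p) * real (\<Sum>s\<le>S. S choose s)"
    unfolding of_nat_sum sum_distrib_left by (intro sum.cong) auto
  also have "\<dots> = real (p choose S) * (3 / real p) * 2 ^ S"
    by (simp add: choose_row_sum)
  finally have "2 ^ S * real (card {I\<in>?A. \<not> riesz_on I}) \<le> 2 ^ S * (real (p choose S) * (12 / real p))"
    by (simp add: ac_simps)
  then show ?thesis by (simp only: mult_le_cancel_left_pos zero_less_power zero_less_numeral)
qed

text \<open>The function w ranges over the solutions of a linear system instead of being written with an
inverse matrix; for well conditioned I the solution is unique on I.\<close>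
definition signs_incoherent :: "nat set \<Rightarrow> nat set \<Rightarrow> bool" where
  "signs_incoherent I \<eta> \<longleftrightarrow> (\<forall>i\<in>{..<p} - I. \<forall>w. (\<forall>j\<in>I. ip n (x j) (synth x I w) = sign_on \<eta> j) \<longrightarrow>
     \<bar>ip n (x i) (synth x I w)\<bar> \<le> 1 / 4)"

text \<open>If w solves the system with right-hand side x_i, then synth x I w is the projection of x_i onto
the span of the columns in I. Its squared norm is the pairing of w with row i, hence small.\<close>
lemma projection_small:
  assumes I: "riesz_on I" "spread_on I" and i: "i \<in> {..<p} - I"
    and w: "\<And>j. j \<in> I \<Longrightarrow> ip n (x j) (synth x I w) = gram i j"
  shows "(\<Sum>j\<in>I. (w j)\<^sup>2) \<le> 1 / 1024 / L" "ip n (synth x I w) (synth x I w) \<le> 1 / L"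
proof -
  let ?W = "\<Sum>j\<in>I. (w j)\<^sup>2" and ?n = "ip n (synth x I w) (synth x I w)"
  have W0: "0 \<le> ?W" by (rule sum_nonneg) simp
  have lower: "1 / 2 * ?W \<le> ?n" using I(1) by (simp add: riesz_on_def)
  have "?n = (\<Sum>j\<in>I. w j * gram i j)"
    unfolding ip_synth_right using w by (simp add: ip_commute)
  then have "?n\<^sup>2 \<le> ?W * (\<Sum>j\<in>I. (gram i j)\<^sup>2)"
    using Cauchy_Schwarz_ineq_sum[of w "gram i" I] by simp
  also have "\<dots> \<le> ?W * (1 / 4096 / L)"
    using I(2) i W0 by (intro mult_left_mono) (auto simp: spread_on_def)
  finally have upper: "?n\<^sup>2 \<le> ?W * (1 / 4096 / L)" .
  have "?n * ?n \<le> ?n * (1 / 2048 / L)"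
  proof -
    have "?W * (1 / 4096 / L) \<le> (2 * ?n) * (1 / 4096 / L)"
      using lower L_ge by (intro mult_right_mono) auto
    then show ?thesis using upper by (simp add: power2_eq_square)
  qed
  then have n: "?n \<le> 1 / 2048 / L"
  proof (cases "?n = 0")
    case False
    then have "0 < ?n" using ip_nonneg[of n "synth x I w"] by simp
    then show ?thesis using \<open>?n * ?n \<le> ?n * (1 / 2048 / L)\<close> by (simp only: mult_le_cancel_left_pos)
  qed (use L_ge in simp)
  show "?W \<le> 1 / 1024 / L" using lower n by simp
  show "?n \<le> 1 / L" by (rule order_trans[OF n]) (use L_ge in \<open>simp add: field_simps\<close>)
qed

text \<open>The correlation of x_i with the signs is linear in the signs, with coefficients small by the previous
lemma, so Hoeffding's inequality and a union bound over i apply.\<close>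
lemma few_bad_signs:
  assumes I: "I \<in> subsets_of_size {..<p} S" "riesz_on I" "spread_on I"
    and solvable: "\<And>v. \<exists>w. \<forall>j\<in>I. ip n (x j) (synth x I w) = v j"
  shows "real (card {\<eta>\<in>Pow I. \<not> signs_incoherent I \<eta>}) \<le> 2 ^ S * (2 / real p)"
proof -
  have I': "I \<subseteq> {..<p}" "card I = S" using I(1) by (simp_all add: subsets_of_size_def)
  then have fin: "finite I" by (auto intro: finite_subset)
  have "\<forall>i. \<exists>w. \<forall>j\<in>I. ip n (x j) (synth x I w) = gram i j"
    using solvable by simp
  from choice[OF this]
  obtain w where w: "\<And>i j. j \<in> I \<Longrightarrow> ip n (x j) (synth x I (w i)) = gram i j"
    by blast
  let ?b = "\<lambda>i. {\<eta>\<in>Pow I. 1 / 4 < \<bar>\<Sum>j\<in>I. sign_on \<eta> j * w i j\<bar>}"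
  have tail: "real (card (?b i)) \<le> 2 ^ S * (2 / (real p * real p))" if i: "i \<in> {..<p} - I" for i
  proof -
    have "real (card (?b i)) \<le> 2 ^ card I * (2 * exp (- (1 / 4)\<^sup>2 / (2 * (1 / 1024 / L))))"
      using projection_small(1)[OF I(2,3) i w] L_ge by (intro sign_hoeffding[OF fin]) auto
    also have "\<dots> \<le> 2 ^ S * (2 * exp (- L + - L))"
      unfolding I'(2) using L_ge by (intro mult_left_mono) (auto simp: field_simps power2_eq_square)
    also have "exp (- L + - L) = 1 / (real p * real p)"
      unfolding exp_add exp_minus using p_pos by (simp add: field_simps)
    finally show ?thesis by simp
  qed
  have "{\<eta>\<in>Pow I. \<not> signs_incoherent I \<eta>} \<subseteq> (\<Union>i\<in>{..<p} - I. ?b i)"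
  proof
    fix \<eta> assume \<eta>: "\<eta> \<in> {\<eta>\<in>Pow I. \<not> signs_incoherent I \<eta>}"
    then obtain i v where i: "i \<in> {..<p} - I" and v: "\<And>j. j \<in> I \<Longrightarrow> ip n (x j) (synth x I v) = sign_on \<eta> j"
      and big: "1 / 4 < \<bar>ip n (x i) (synth x I v)\<bar>"
      unfolding signs_incoherent_def by (auto simp: not_le)
    \<comment> \<open>Self-adjointness of the inverse Gram matrix moves it from the signs to column i.\<close>
    have "ip n (x i) (synth x I v) = (\<Sum>j\<in>I. v j * gram i j)"
      by (rule ip_synth_right)
    also have "\<dots> = (\<Sum>j\<in>I. v j * ip n (synth x I (w i)) (x j))"
      using w by (simp add: ip_commute)
    also have "\<dots> = ip n (synth x I v) (synth x I (w i))"
      by (subst ip_commute, subst ip_synth_right) (rule refl)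
    also have "\<dots> = (\<Sum>j\<in>I. sign_on \<eta> j * w i j)"
      unfolding ip_synth_right using v by (simp add: ip_commute mult.commute)
    finally show "\<eta> \<in> (\<Union>i\<in>{..<p} - I. ?b i)" using big i \<eta> by auto
  qed
  then have "card {\<eta>\<in>Pow I. \<not> signs_incoherent I \<eta>} \<le> card (\<Union>i\<in>{..<p} - I. ?b i)"
    using fin by (intro card_mono) auto
  also have "\<dots> \<le> (\<Sum>i\<in>{..<p} - I. card (?b i))" by (intro card_UN_le) simp
  finally have "real (card {\<eta>\<in>Pow I. \<not> signs_incoherent I \<eta>}) \<le> real (\<Sum>i\<in>{..<p} - I. card (?b i))"
    by (rule of_nat_mono)
  also have "\<dots> = (\<Sum>i\<in>{..<p} - I. real (card (?b i)))" by (rule of_nat_sum)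
  also have "\<dots> \<le> (\<Sum>i\<in>{..<p} - I. 2 ^ S * (2 / (real p * real p)))"
    by (intro sum_mono tail)
  also have "\<dots> \<le> (\<Sum>i<p. 2 ^ S * (2 / (real p * real p)))"
    by (intro sum_mono2) auto
  also have "\<dots> = 2 ^ S * (2 / real p)" using p_pos by simp
  finally show ?thesis .
qed

lemma few_bad_signed_supports:
  assumes solvable: "\<And>I v. I \<subseteq> {..<p} \<Longrightarrow> riesz_on I \<Longrightarrow> \<exists>w. \<forall>j\<in>I. ip n (x j) (synth x I w) = v j"
  shows "(\<Sum>I\<in>subsets_of_size {..<p} S. real (card {\<eta>\<in>Pow I. \<not> (riesz_on I \<and> spread_on I \<and> signs_incoherent I \<eta>)}))
    \<le> real (p choose S) * 2 ^ S * (15 / real p)"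
proof -
  let ?A = "subsets_of_size {..<p} S"
  let ?i = "\<lambda>P I. if P I then 0 else 1 :: real"
  have fin: "finite ?A" by (simp add: finite_subsets_of_size)
  have "(\<Sum>I\<in>?A. real (card {\<eta>\<in>Pow I. \<not> (riesz_on I \<and> spread_on I \<and> signs_incoherent I \<eta>)}))
    \<le> (\<Sum>I\<in>?A. 2 ^ S * (2 / real p + ?i riesz_on I + ?i spread_on I))"
  proof (rule sum_mono)
    fix I assume I: "I \<in> ?A"
    then have I': "I \<subseteq> {..<p}" "card I = S" by (simp_all add: subsets_of_size_def)
    then have finI: "finite I" by (auto intro: finite_subset)
    show "real (card {\<eta>\<in>Pow I. \<not> (riesz_on I \<and> spread_on I \<and> signs_incoherent I \<eta>)})
      \<le> 2 ^ S * (2 / real p + ?i riesz_on I + ?i spread_on I)"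
    proof (cases "riesz_on I \<and> spread_on I")
      case True
      then show ?thesis using few_bad_signs[OF I _ _ solvable[OF I'(1)]] by simp
    next
      case False
      have "real (card {\<eta>\<in>Pow I. \<not> (riesz_on I \<and> spread_on I \<and> signs_incoherent I \<eta>)})
        \<le> real (card (Pow I))" using finI by (intro of_nat_mono card_mono) auto
      also have "\<dots> = 2 ^ S * 1" using finI I' by (simp add: card_Pow)
      also have "\<dots> \<le> 2 ^ S * (2 / real p + ?i riesz_on I + ?i spread_on I)"
        using False by (intro mult_left_mono) auto
      finally show ?thesis .
    qed
  qed
  also have "\<dots> = 2 ^ S * (real (card ?A) * (2 / real p) + real (card {I\<in>?A. \<not> riesz_on I})
      + real (card {I\<in>?A. \<not> spread_on I}))"
    using fin by (simp add: sum_distrib_left[symmetric] sum.distrib sum.If_cases Int_def)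
  also have "\<dots> \<le> 2 ^ S * (real (p choose S) * (2 / real p) + real (p choose S) * (12 / real p)
      + real (p choose S) / real p)"
    using few_not_riesz few_unspread[OF order_refl]
    by (intro mult_left_mono add_mono) (auto simp: card_subsets_of_size)
  also have "\<dots> = real (p choose S) * 2 ^ S * (15 / real p)"
    by (simp add: field_simps)
  finally show ?thesis .
qed

end


section \<open>Submatrices and the good sign vectors\<close>
definition column_fn :: "real mat \<Rightarrow> nat \<Rightarrow> nat \<Rightarrow> real" where
  "column_fn X j = (\<lambda>i. X $$ (i, j))"

text \<open>The vector of the values of w on I in increasing order, which matches the column order of
submatrices.\<close>
definition coords :: "nat set \<Rightarrow> (nat \<Rightarrow> real) \<Rightarrow> real vec" where
  "coords I w = vec (card I) (\<lambda>k. w (pick I k))"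

lemma bij_betw_pick:
  assumes "finite I"
  shows "bij_betw (pick I) {..<card I} I"
proof (rule bij_betw_imageI)
  show inj: "inj_on (pick I) {..<card I}"
  proof (rule inj_onI)
    fix a b assume "a \<in> {..<card I}" "b \<in> {..<card I}" and eq: "pick I a = pick I b"
    have "card {c\<in>I. c < pick I a} = a" "card {c\<in>I. c < pick I b} = b"
      using \<open>a \<in> {..<card I}\<close> \<open>b \<in> {..<card I}\<close> by (auto intro: card_pick_le)
    then show "a = b" unfolding eq by (rule trans[OF sym])
  qed
  have "pick I ` {..<card I} \<subseteq> I" using pick_in_set_le by auto
  then show "pick I ` {..<card I} = I"
    using assms inj by (intro card_subset_eq) (auto simp: card_image)
qed

lemma sum_pick: "finite I \<Longrightarrow> (\<Sum>k<card I. f (pick I k)) = sum f I"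
  by (rule sum.reindex_bij_betw[OF bij_betw_pick])

lemma dim_coords [simp]: "dim_vec (coords I w) = card I"
  by (simp add: coords_def)

lemma coords_carrier [simp]: "coords I w \<in> carrier_vec (card I)"
  by (simp add: coords_def)

lemma coords_index: "k < card I \<Longrightarrow> coords I w $ k = w (pick I k)"
  by (simp add: coords_def)

lemma coords_cong:
  assumes "finite I" "\<And>j. j \<in> I \<Longrightarrow> v j = w j"
  shows "coords I v = coords I w"
  using assms pick_in_set_le[of _ I] by (auto simp: coords_def)

lemma coords_exists:
  assumes "u \<in> carrier_vec (card I)"
  shows "\<exists>w. u = coords I w"
proof
  show "u = coords I (\<lambda>j. u $ card {a\<in>I. a < j})"
    using assms by (auto simp: coords_def card_pick_le)
qed

lemma coords_scalar_prod:
  assumes "finite I"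
  shows "coords I v \<bullet> coords I w = (\<Sum>j\<in>I. v j * w j)"
proof -
  have "coords I v \<bullet> coords I w = (\<Sum>k<card I. v (pick I k) * w (pick I k))"
    by (simp add: scalar_prod_def coords_index atLeast0LessThan)
  then show ?thesis using sum_pick[OF assms, of "\<lambda>j. v j * w j"] by simp
qed

lemma coords_eqD:
  assumes "finite I" "coords I v = coords I w" "j \<in> I"
  shows "v j = w j"
proof -
  obtain k where k: "k < card I" "j = pick I k"
    using bij_betw_pick[OF assms(1)] assms(3) by (auto simp: bij_betw_def)
  then show ?thesis using arg_cong[OF assms(2), of "\<lambda>u. u $ k"] by (simp add: coords_index)
qed

lemma l2_norm_nonneg: "0 \<le> l2_norm v"
  by (simp add: l2_norm_def scalar_prod_def sum_nonneg)

lemma l2_norm_coords: "finite I \<Longrightarrow> (l2_norm (coords I w))\<^sup>2 = (\<Sum>j\<in>I. (w j)\<^sup>2)"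
  by (simp add: l2_norm_def coords_scalar_prod sum_nonneg flip: power2_eq_square)

lemma vec_scalar_prod_ip: "vec d f \<bullet> vec d g = ip d f g"
  by (simp add: scalar_prod_def ip_def atLeast0LessThan)

lemma l2_norm_vec: "(l2_norm (vec d f))\<^sup>2 = ip d f f"
  by (simp add: l2_norm_def vec_scalar_prod_ip ip_nonneg)

lemma vec_restrict_eq:
  assumes "I \<subseteq> {..<dim_vec v}"
  shows "vec_restrict v I = coords I (\<lambda>j. v $ j)"
proof -
  have "{i. i < dim_vec v \<and> i \<in> I} = I" using assms by auto
  then show ?thesis by (simp add: vec_restrict_def coords_def)
qed

lemma col_eq_vec: "X \<in> carrier_mat n p \<Longrightarrow> j < p \<Longrightarrow> col X j = vec n (column_fn X j)"
  by (auto simp: column_fn_def)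

lemma cols_sub_carrier:
  assumes "X \<in> carrier_mat n p" "I \<subseteq> {..<p}"
  shows "cols_sub X I \<in> carrier_mat n (card I)"
proof -
  have "{j. j < p \<and> j \<in> I} = I" using assms by auto
  then show ?thesis using assms by (auto simp: cols_sub_def dim_submatrix)
qed

lemma cols_sub_index:
  assumes X: "X \<in> carrier_mat n p" "I \<subseteq> {..<p}" and "i < n" "k < card I"
  shows "cols_sub X I $$ (i, k) = column_fn X (pick I k) i"
proof -
  have "{j. j < p \<and> j \<in> I} = I" using X by auto
  then show ?thesis using assms by (simp add: cols_sub_def submatrix_index pick_UNIV column_fn_def)
qed

lemma cols_sub_mult:
  assumes X: "X \<in> carrier_mat n p" "I \<subseteq> {..<p}"
  shows "cols_sub X I *\<^sub>v coords I w = vec n (synth (column_fn X) I w)"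
proof -
  note C = cols_sub_carrier[OF X]
  have fin: "finite I" using X(2) by (auto intro: finite_subset)
  show ?thesis
  proof (rule eq_vecI)
    fix i assume "i < dim_vec (vec n (synth (column_fn X) I w))"
    then have i: "i < n" by simp
    have "(cols_sub X I *\<^sub>v coords I w) $ i =
      (\<Sum>k<card I. column_fn X (pick I k) i * w (pick I k))"
      using C i cols_sub_index[OF X i] by (simp add: scalar_prod_def coords_index atLeast0LessThan)
    also have "\<dots> = (\<Sum>j\<in>I. column_fn X j i * w j)"
      by (rule sum_pick[OF fin])
    finally show "(cols_sub X I *\<^sub>v coords I w) $ i = vec n (synth (column_fn X) I w) $ i"
      using i by (simp add: synth_def mult.commute)
  qed (use C in auto)
qed

lemma cols_sub_transpose_mult:
  assumes X: "X \<in> carrier_mat n p" "I \<subseteq> {..<p}"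
  shows "transpose_mat (cols_sub X I) *\<^sub>v vec n f = coords I (\<lambda>j. ip n (column_fn X j) f)"
proof -
  note C = cols_sub_carrier[OF X]
  show ?thesis
  proof (rule eq_vecI)
    fix k assume "k < dim_vec (coords I (\<lambda>j. ip n (column_fn X j) f))"
    then have k: "k < card I" by simp
    then show "(transpose_mat (cols_sub X I) *\<^sub>v vec n f) $ k = coords I (\<lambda>j. ip n (column_fn X j) f) $ k"
      using C cols_sub_index[OF X _ k]
      by (simp add: scalar_prod_def coords_index atLeast0LessThan ip_def)
  qed (use C in auto)
qed

lemma mat_mult_coords:
  assumes X: "X \<in> carrier_mat n p"
  shows "X *\<^sub>v vec p w = vec n (synth (column_fn X) {..<p} w)"
  using X by (auto simp: scalar_prod_def synth_def column_fn_def atLeast0LessThan mult.commute intro!: eq_vecI sum.cong)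

lemma l2_norm_mult_bound:
  assumes A: "A \<in> carrier_mat n m" and v: "v \<in> carrier_vec m"
  shows "(l2_norm (A *\<^sub>v v))\<^sup>2 \<le> (\<Sum>i<n. \<Sum>k<m. (A $$ (i, k))\<^sup>2) * (l2_norm v)\<^sup>2"
proof -
  have vv: "(l2_norm u)\<^sup>2 = (\<Sum>k<dim_vec u. (u $ k)\<^sup>2)" for u
    by (simp add: l2_norm_def scalar_prod_def atLeast0LessThan sum_nonneg flip: power2_eq_square)
  have "(l2_norm (A *\<^sub>v v))\<^sup>2 = (\<Sum>i<n. (\<Sum>k<m. A $$ (i, k) * v $ k)\<^sup>2)"
    unfolding vv using A v by (simp add: scalar_prod_def atLeast0LessThan)
  also have "\<dots> \<le> (\<Sum>i<n. (\<Sum>k<m. (A $$ (i, k))\<^sup>2) * (\<Sum>k<m. (v $ k)\<^sup>2))"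
    by (intro sum_mono Cauchy_Schwarz_ineq_sum)
  finally show ?thesis unfolding vv using v by (simp add: sum_distrib_right)
qed

lemma l2_norm_smult: "l2_norm (c \<cdot>\<^sub>v v) = \<bar>c\<bar> * l2_norm v"
  by (simp add: l2_norm_def real_sqrt_mult mult.assoc[symmetric] flip: power2_eq_square)

lemma l2_norm_le_op_norm:
  assumes A: "A \<in> carrier_mat n m" and v: "v \<in> carrier_vec m"
  shows "l2_norm (A *\<^sub>v v) \<le> op_norm A * l2_norm v"
proof (cases "l2_norm v = 0")
  case True
  then show ?thesis using l2_norm_mult_bound[OF A v] by simp
next
  case False
  then have pos: "0 < l2_norm v" using l2_norm_nonneg[of v] by simp
  let ?S = "{v \<in> carrier_vec (dim_col A). l2_norm v \<le> 1}"
  let ?c = "\<Sum>i<n. \<Sum>k<m. (A $$ (i, k))\<^sup>2"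
  have bdd: "bdd_above ((\<lambda>v. l2_norm (A *\<^sub>v v)) ` ?S)"
  proof (rule bdd_aboveI2)
    fix u assume u: "u \<in> ?S"
    have "(l2_norm (A *\<^sub>v u))\<^sup>2 \<le> ?c * (l2_norm u)\<^sup>2"
      using u A by (intro l2_norm_mult_bound) auto
    also have "\<dots> \<le> ?c * 1"
      using u l2_norm_nonneg[of u] by (intro mult_left_mono sum_nonneg power_le_one) auto
    finally show "l2_norm (A *\<^sub>v u) \<le> sqrt ?c" by (simp add: real_le_rsqrt)
  qed
  have "l2_norm (A *\<^sub>v ((1 / l2_norm v) \<cdot>\<^sub>v v)) \<le> op_norm A"
    unfolding op_norm_def using A v pos
    by (intro cSUP_upper[OF _ bdd]) (auto simp: l2_norm_smult)
  also have "A *\<^sub>v ((1 / l2_norm v) \<cdot>\<^sub>v v) = (1 / l2_norm v) \<cdot>\<^sub>v (A *\<^sub>v v)"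
    using A v by (rule mult_mat_vec)
  finally show ?thesis using pos by (simp add: l2_norm_smult field_simps)
qed

text \<open>The unit ball contains 0, so the supremum is over a nonempty set also in dimension zero; this is the
case of the empty support.\<close>
lemma op_norm_le:
  assumes A: "A \<in> carrier_mat n m" and c: "0 \<le> c"
    and le: "\<And>v. v \<in> carrier_vec m \<Longrightarrow> l2_norm (A *\<^sub>v v) \<le> c * l2_norm v"
  shows "op_norm A \<le> c"
  unfolding op_norm_def
proof (rule cSUP_least)
  have "0\<^sub>v (dim_col A) \<in> {v \<in> carrier_vec (dim_col A). l2_norm v \<le> 1}"
    by (simp add: l2_norm_def)
  then show "{v \<in> carrier_vec (dim_col A). l2_norm v \<le> 1} \<noteq> {}" by blast
  fix v assume v: "v \<in> {v \<in> carrier_vec (dim_col A). l2_norm v \<le> 1}"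
  then have "l2_norm (A *\<^sub>v v) \<le> c * l2_norm v" using A le by simp
  also have "\<dots> \<le> c * 1" using v c by (intro mult_left_mono) auto
  finally show "l2_norm (A *\<^sub>v v) \<le> c" by simp
qed

lemma linf_norm_le_iff: "0 \<le> c \<Longrightarrow> linf_norm v \<le> c \<longleftrightarrow> (\<forall>i<dim_vec v. \<bar>v $ i\<bar> \<le> c)"
  unfolding linf_norm_def by (subst Max_le_iff) auto

definition gram_mat :: "real mat \<Rightarrow> nat set \<Rightarrow> real mat" where
  "gram_mat X I = transpose_mat (cols_sub X I) * cols_sub X I"

lemma gram_mat_carrier:
  "X \<in> carrier_mat n p \<Longrightarrow> I \<subseteq> {..<p} \<Longrightarrow> gram_mat X I \<in> carrier_mat (card I) (card I)"
  unfolding gram_mat_def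
  by (rule mult_carrier_mat[OF transpose_carrier_mat[THEN iffD2]]) (rule cols_sub_carrier; assumption)+

lemma gram_mat_mult:
  assumes X: "X \<in> carrier_mat n p" "I \<subseteq> {..<p}"
  shows "gram_mat X I *\<^sub>v coords I w = coords I (\<lambda>j. ip n (column_fn X j) (synth (column_fn X) I w))"
proof -
  note C = cols_sub_carrier[OF X]
  have "gram_mat X I *\<^sub>v coords I w = transpose_mat (cols_sub X I) *\<^sub>v (cols_sub X I *\<^sub>v coords I w)"
    unfolding gram_mat_def using C by (intro assoc_mult_mat_vec) auto
  then show ?thesis by (simp only: cols_sub_mult[OF X] cols_sub_transpose_mult[OF X])
qed

lemma mat_inverse_the:
  assumes A: "A \<in> carrier_mat m m" and U: "A \<in> Units (ring_mat TYPE(real) m ())"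
  shows "A * the (mat_inverse A) = 1\<^sub>m m" "the (mat_inverse A) * A = 1\<^sub>m m"
    "the (mat_inverse A) \<in> carrier_mat m m"
proof -
  obtain B where "mat_inverse A = Some B"
    using mat_inverse(1)[OF A, where b = "()"] U by (cases "mat_inverse A") auto
  then show "A * the (mat_inverse A) = 1\<^sub>m m" "the (mat_inverse A) * A = 1\<^sub>m m"
    "the (mat_inverse A) \<in> carrier_mat m m"
    using mat_inverse(2)[OF A] by auto
qed

lemma invertible_mat_Units:
  assumes A: "A \<in> carrier_mat m m" and inv: "invertible_mat A"
  shows "A \<in> Units (ring_mat TYPE(real) m ())"
proof -
  obtain B where B: "inverts_mat A B" "inverts_mat B A" using inv by (auto simp: invertible_mat_def)
  have "dim_col B = m" using B(1) A by (metis carrier_matD(1) index_mult_mat(3) index_one_mat(3) inverts_mat_def)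
  moreover have "dim_row B = m" using B(2) A by (metis carrier_matD(2) index_mult_mat(3) index_one_mat(3) inverts_mat_def)
  ultimately have "B \<in> carrier_mat m m" by auto
  then show ?thesis using A B unfolding Units_def ring_mat_def inverts_mat_def by auto
qed

text \<open>Invertibility comes from a lower frame bound in lemma good_sign_vecsI and from the definition of a
good sign vector in lemma good_sign_vecsD. What follows from it is the same:
applying the inverse Gram matrix means solving a linear system indexed by I.\<close>
locale gram_inverse =
  fixes n p :: nat and X :: "real mat" and I :: "nat set"
  assumes X: "X \<in> carrier_mat n p" and I: "I \<subseteq> {..<p}"
    and U: "gram_mat X I \<in> Units (ring_mat TYPE(real) (card I) ())"
begin

abbreviation "x \<equiv> column_fn X"

definition Ginv :: "real mat" where "Ginv = the (mat_inverse (gram_mat X I))"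

lemma finI: "finite I"
  using I by (auto intro: finite_subset)

lemmas G_carrier = gram_mat_carrier[OF X I]

lemmas Ginv = mat_inverse_the[OF G_carrier U, folded Ginv_def]

lemma invertible_gram: "invertible_mat (gram_mat X I)"
  using G_carrier Ginv by (auto simp: invertible_mat_def inverts_mat_def)

lemma Ginv_mult:
  assumes "\<And>j. j \<in> I \<Longrightarrow> ip n (x j) (synth x I w) = v j"
  shows "Ginv *\<^sub>v coords I v = coords I w"
proof -
  have "coords I v = gram_mat X I *\<^sub>v coords I w"
    unfolding gram_mat_mult[OF X I] using assms by (intro coords_cong finI) auto
  then have "Ginv *\<^sub>v coords I v = (Ginv * gram_mat X I) *\<^sub>v coords I w"
    using assoc_mult_mat_vec[OF Ginv(3) G_carrier coords_carrier] by simp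
  then show ?thesis using Ginv by simp
qed

lemma solution_exists: "\<exists>w. \<forall>j\<in>I. ip n (x j) (synth x I w) = v j"
proof -
  have "Ginv *\<^sub>v coords I v \<in> carrier_vec (card I)" using Ginv by auto
  then obtain w where w: "Ginv *\<^sub>v coords I v = coords I w" using coords_exists by blast
  have "gram_mat X I *\<^sub>v (Ginv *\<^sub>v coords I v) = (gram_mat X I * Ginv) *\<^sub>v coords I v"
    using assoc_mult_mat_vec[OF G_carrier Ginv(3) coords_carrier] by simp
  then have "coords I (\<lambda>j. ip n (x j) (synth x I w)) = coords I v"
    using Ginv unfolding w gram_mat_mult[OF X I] by simp
  then show ?thesis using coords_eqD[OF finI] by blast
qed

lemma cols_Ginv_mult:
  assumes w: "\<And>j. j \<in> I \<Longrightarrow> ip n (x j) (synth x I w) = v j" and A: "A \<in> carrier_mat k (card I)"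
  shows "(A * Ginv) *\<^sub>v coords I v = A *\<^sub>v coords I w"
  using assoc_mult_mat_vec[OF A Ginv(3) coords_carrier] Ginv_mult[OF w] by simp

lemma off_support_correlations:
  assumes w: "\<And>j. j \<in> I \<Longrightarrow> ip n (x j) (synth x I w) = v j" and J: "J \<subseteq> {..<p}"
  shows "(transpose_mat (cols_sub X J) * cols_sub X I * Ginv) *\<^sub>v coords I v =
    coords J (\<lambda>i. ip n (x i) (synth x I w))"
proof -
  note C = cols_sub_carrier[OF X I] and CJ = cols_sub_carrier[OF X J]
  have "(transpose_mat (cols_sub X J) * cols_sub X I * Ginv) *\<^sub>v coords I v =
    (transpose_mat (cols_sub X J) * cols_sub X I) *\<^sub>v coords I w"
    using C CJ by (intro cols_Ginv_mult[OF w]) auto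
  also have "\<dots> = transpose_mat (cols_sub X J) *\<^sub>v (cols_sub X I *\<^sub>v coords I w)"
    using C CJ by (intro assoc_mult_mat_vec) auto
  finally show ?thesis by (simp only: cols_sub_mult[OF X I] cols_sub_transpose_mult[OF X J])
qed

lemma support_projection:
  assumes w: "\<And>j. j \<in> I \<Longrightarrow> ip n (x j) (synth x I w) = ip n (x j) f"
  shows "(cols_sub X I * Ginv * transpose_mat (cols_sub X I)) *\<^sub>v vec n f = vec n (synth x I w)"
proof -
  note C = cols_sub_carrier[OF X I]
  have "(cols_sub X I * Ginv * transpose_mat (cols_sub X I)) *\<^sub>v vec n f =
    (cols_sub X I * Ginv) *\<^sub>v (transpose_mat (cols_sub X I) *\<^sub>v vec n f)"
    using C Ginv by (intro assoc_mult_mat_vec[where ?n\<^sub>1 = n]) auto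
  also have "\<dots> = cols_sub X I *\<^sub>v coords I w"
    unfolding cols_sub_transpose_mult[OF X I] using w C by (intro cols_Ginv_mult) auto
  finally show ?thesis by (simp only: cols_sub_mult[OF X I])
qed

end

text \<open>A lower frame bound makes the Gram matrix injective, hence invertible.\<close>
lemma gram_inverse_of_riesz:
  assumes X: "X \<in> carrier_mat n p" and I: "I \<subseteq> {..<p}"
    and riesz: "\<And>u. 1 / 2 * (\<Sum>i\<in>I. (u i)\<^sup>2) \<le> ip n (synth (column_fn X) I u) (synth (column_fn X) I u)"
  shows "gram_inverse n p X I"
proof
  have fin: "finite I" using I by (auto intro: finite_subset)
  have "det (gram_mat X I) \<noteq> 0"
  proof
    assume "det (gram_mat X I) = 0"
    then obtain v where v: "v \<in> carrier_vec (card I)" "v \<noteq> 0\<^sub>v (card I)" "gram_mat X I *\<^sub>v v = 0\<^sub>v (card I)"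
      using det_0_iff_vec_prod_zero[OF gram_mat_carrier[OF X I]] by blast
    obtain w where w: "v = coords I w" using coords_exists[OF v(1)] by blast
    let ?y = "synth (column_fn X) I w"
    have "coords I (\<lambda>j. ip n (column_fn X j) ?y) = coords I (\<lambda>_. 0)"
      using v(3) unfolding w gram_mat_mult[OF X I] by (auto simp: coords_def)
    then have 0: "ip n (column_fn X j) ?y = 0" if "j \<in> I" for j using coords_eqD[OF fin] that by fastforce
    have "ip n ?y ?y = 0" by (subst ip_synth_right) (simp add: 0 ip_commute[of n ?y])
    then have "(\<Sum>i\<in>I. (w i)\<^sup>2) \<le> 0" using riesz[of w] by simp
    then have "\<forall>i\<in>I. w i = 0"
      using fin sum_nonneg_eq_0_iff[of I "\<lambda>i. (w i)\<^sup>2"] by (simp add: antisym sum_nonneg)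
    then have "coords I w = coords I (\<lambda>_. 0)" by (intro coords_cong fin) auto
    then show False using v(2) w by (auto simp: coords_def)
  qed
  then show "gram_mat X I \<in> Units (ring_mat TYPE(real) (card I) ())"
    by (rule det_non_zero_imp_unit[OF gram_mat_carrier[OF X I]])
qed (rule X I)+

lemma good_sign_vecs_alt:
  assumes X: "X \<in> carrier_mat n p"
  shows "b \<in> good_sign_vecs c1 X S \<longleftrightarrow> b \<in> sign_vecs p S \<and>
     (invertible_mat (gram_mat X (supp b)) \<and> op_norm (the (mat_inverse (gram_mat X (supp b)))) \<le> 2) \<and>
     linf_norm ((transpose_mat (cols_sub X ({..<p} - supp b)) * cols_sub X (supp b) *
        the (mat_inverse (gram_mat X (supp b)))) *\<^sub>v vec_restrict b (supp b)) \<le> 1 / 4 \<and>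
     (\<forall>i\<in>{..<p} - supp b. l2_norm ((cols_sub X (supp b) * the (mat_inverse (gram_mat X (supp b))) *
        transpose_mat (cols_sub X (supp b))) *\<^sub>v col X i) \<le> c1 / sqrt (ln (real p)))"
  using X unfolding good_sign_vecs_def gram_mat_def Let_def by auto

lemma sign_vecs_supp:
  assumes "b \<in> sign_vecs p S"
  shows "b \<in> carrier_vec p" "supp b \<subseteq> {..<p}" "card (supp b) = S"
    "vec_restrict b (supp b) = coords (supp b) (\<lambda>j. b $ j)"
proof -
  show "b \<in> carrier_vec p" "card (supp b) = S" using assms by (auto simp: sign_vecs_def)
  then show *: "supp b \<subseteq> {..<p}" by (auto simp: supp_def)
  show "vec_restrict b (supp b) = coords (supp b) (\<lambda>j. b $ j)"
    using * \<open>b \<in> carrier_vec p\<close> by (intro vec_restrict_eq) auto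
qed

text \<open>The factor 2 for the inverse comes from the lower frame bound 1/2.\<close>
lemma good_sign_vecsI:
  fixes X :: "real mat"
  defines "x \<equiv> column_fn X"
  assumes X: "X \<in> carrier_mat n p" and b: "b \<in> sign_vecs p S" and c1: "0 \<le> c1 / sqrt (ln (real p))"
    and riesz: "\<And>u. 1 / 2 * (\<Sum>i\<in>supp b. (u i)\<^sup>2) \<le> ip n (synth x (supp b) u) (synth x (supp b) u)"
    and incoh: "\<And>i w. i \<in> {..<p} - supp b \<Longrightarrow> (\<And>j. j \<in> supp b \<Longrightarrow> ip n (x j) (synth x (supp b) w) = b $ j) \<Longrightarrow>
       \<bar>ip n (x i) (synth x (supp b) w)\<bar> \<le> 1 / 4"
    and proj: "\<And>i w. i \<in> {..<p} - supp b \<Longrightarrow> (\<And>j. j \<in> supp b \<Longrightarrow> ip n (x j) (synth x (supp b) w) = ip n (x j) (x i)) \<Longrightarrow>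
       ip n (synth x (supp b) w) (synth x (supp b) w) \<le> (c1 / sqrt (ln (real p)))\<^sup>2"
  shows "b \<in> good_sign_vecs c1 X S"
proof -
  let ?I = "supp b"
  note bs = sign_vecs_supp[OF b]
  interpret gram_inverse n p X ?I
    using riesz unfolding x_def by (intro gram_inverse_of_riesz X bs)
  have norm: "l2_norm (Ginv *\<^sub>v u) \<le> 2 * l2_norm u" if u: "u \<in> carrier_vec (card ?I)" for u
  proof -
    obtain v where v: "u = coords ?I v" using coords_exists[OF u] by blast
    obtain w where w: "\<forall>j\<in>?I. ip n (column_fn X j) (synth (column_fn X) ?I w) = v j"
      using solution_exists by blast
    let ?W = "\<Sum>j\<in>?I. (w j)\<^sup>2" and ?V = "\<Sum>j\<in>?I. (v j)\<^sup>2" and ?y = "synth (column_fn X) ?I w"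
    have nn: "0 \<le> ?W" "0 \<le> ?V" by (auto intro: sum_nonneg)
    have "ip n ?y ?y = (\<Sum>j\<in>?I. w j * v j)"
      by (subst ip_synth_right) (use w in \<open>simp add: ip_commute[of n ?y]\<close>)
    then have "(ip n ?y ?y)\<^sup>2 \<le> ?W * ?V" using Cauchy_Schwarz_ineq_sum[of w v ?I] by simp
    moreover have "(1 / 2 * ?W)\<^sup>2 \<le> (ip n ?y ?y)\<^sup>2"
      using riesz[of w] nn unfolding x_def by (intro power_mono) auto
    ultimately have "?W * ?W \<le> ?W * (4 * ?V)" by (simp add: power2_eq_square field_simps)
    then have "?W \<le> 4 * ?V" using nn by (cases "?W = 0") (auto simp: mult_le_cancel_left)
    moreover have "Ginv *\<^sub>v u = coords ?I w" unfolding v using w by (intro Ginv_mult) auto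
    ultimately have "(l2_norm (Ginv *\<^sub>v u))\<^sup>2 \<le> (2 * l2_norm u)\<^sup>2"
      unfolding v by (simp add: l2_norm_coords[OF finI] power_mult_distrib)
    then show ?thesis by (rule power2_le_imp_le) (simp add: l2_norm_nonneg)
  qed
  have c1': "op_norm Ginv \<le> 2" by (rule op_norm_le[OF Ginv(3)]) (use norm in auto)
  have c2: "linf_norm ((transpose_mat (cols_sub X ({..<p} - ?I)) * cols_sub X ?I * Ginv) *\<^sub>v vec_restrict b ?I) \<le> 1 / 4"
  proof -
    obtain w where w: "\<forall>j\<in>?I. ip n (column_fn X j) (synth (column_fn X) ?I w) = b $ j"
      using solution_exists[of "\<lambda>j. b $ j"] by blast
    have eq: "(transpose_mat (cols_sub X ({..<p} - ?I)) * cols_sub X ?I * Ginv) *\<^sub>v vec_restrict b ?I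
      = coords ({..<p} - ?I) (\<lambda>i. ip n (column_fn X i) (synth (column_fn X) ?I w))"
      unfolding bs(4) using w by (intro off_support_correlations) auto
    show ?thesis unfolding eq
      using incoh[of _ w] w pick_in_set_le[of _ "{..<p} - ?I"]
      by (subst linf_norm_le_iff) (auto simp: coords_index x_def)
  qed
  have c3: "l2_norm ((cols_sub X ?I * Ginv * transpose_mat (cols_sub X ?I)) *\<^sub>v col X i) \<le> c1 / sqrt (ln (real p))"
    if i: "i \<in> {..<p} - ?I" for i
  proof -
    obtain w where w: "\<forall>j\<in>?I. ip n (column_fn X j) (synth (column_fn X) ?I w) = ip n (column_fn X j) (column_fn X i)"
      using solution_exists[of "\<lambda>j. ip n (column_fn X j) (column_fn X i)"] by blast
    have "(cols_sub X ?I * Ginv * transpose_mat (cols_sub X ?I)) *\<^sub>v col X i = vec n (synth (column_fn X) ?I w)"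
      using i w col_eq_vec[OF X, of i] by (simp add: support_projection)
    then have "(l2_norm ((cols_sub X ?I * Ginv * transpose_mat (cols_sub X ?I)) *\<^sub>v col X i))\<^sup>2 \<le> (c1 / sqrt (ln (real p)))\<^sup>2"
      using proj[OF i, of w] w by (simp add: l2_norm_vec x_def)
    then show ?thesis using c1 by (rule power2_le_imp_le)
  qed
  show ?thesis
    unfolding good_sign_vecs_alt[OF X] Ginv_def[symmetric]
    using b invertible_gram c1' c2 c3 by blast
qed

lemma good_sign_vecsD:
  fixes X :: "real mat"
  defines "x \<equiv> column_fn X"
  assumes X: "X \<in> carrier_mat n p" and good: "b \<in> good_sign_vecs c1 X S"
  shows "\<exists>w. (\<forall>j\<in>supp b. ip n (x j) (synth x (supp b) w) = v j) \<and> (\<Sum>j\<in>supp b. (w j)\<^sup>2) \<le> 4 * (\<Sum>j\<in>supp b. (v j)\<^sup>2)"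
    and "i \<in> {..<p} - supp b \<Longrightarrow> (\<And>j. j \<in> supp b \<Longrightarrow> ip n (x j) (synth x (supp b) w) = b $ j) \<Longrightarrow>
       \<bar>ip n (x i) (synth x (supp b) w)\<bar> \<le> 1 / 4"
proof -
  let ?I = "supp b"
  have b: "b \<in> sign_vecs p S" using good unfolding good_sign_vecs_alt[OF X] by blast
  note bs = sign_vecs_supp[OF b]
  interpret gram_inverse n p X ?I
    using good unfolding good_sign_vecs_alt[OF X]
    by unfold_locales (auto intro!: invertible_mat_Units X bs gram_mat_carrier[OF X bs(2)])
  have op: "op_norm Ginv \<le> 2"
    and li: "linf_norm ((transpose_mat (cols_sub X ({..<p} - ?I)) * cols_sub X ?I * Ginv) *\<^sub>v vec_restrict b ?I) \<le> 1 / 4"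
    using good unfolding good_sign_vecs_alt[OF X] Ginv_def by blast+
  show "\<exists>w. (\<forall>j\<in>?I. ip n (x j) (synth x ?I w) = v j) \<and> (\<Sum>j\<in>?I. (w j)\<^sup>2) \<le> 4 * (\<Sum>j\<in>?I. (v j)\<^sup>2)"
  proof -
    obtain w where w: "\<forall>j\<in>?I. ip n (column_fn X j) (synth (column_fn X) ?I w) = v j"
      using solution_exists by blast
    have "l2_norm (coords ?I w) = l2_norm (Ginv *\<^sub>v coords ?I v)"
      using w by (subst Ginv_mult) auto
    also have "\<dots> \<le> op_norm Ginv * l2_norm (coords ?I v)"
      by (rule l2_norm_le_op_norm[OF Ginv(3)]) simp
    also have "\<dots> \<le> 2 * l2_norm (coords ?I v)"
      using op by (intro mult_right_mono l2_norm_nonneg)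
    finally have "(l2_norm (coords ?I w))\<^sup>2 \<le> (2 * l2_norm (coords ?I v))\<^sup>2"
      by (intro power_mono l2_norm_nonneg)
    then show ?thesis using w by (auto simp: l2_norm_coords[OF finI] power_mult_distrib x_def)
  qed
  show "\<bar>ip n (x i) (synth x ?I w)\<bar> \<le> 1 / 4"
    if i: "i \<in> {..<p} - ?I" and w: "\<And>j. j \<in> ?I \<Longrightarrow> ip n (x j) (synth x ?I w) = b $ j"
  proof -
    let ?J = "{..<p} - ?I"
    have eq: "(transpose_mat (cols_sub X ?J) * cols_sub X ?I * Ginv) *\<^sub>v vec_restrict b ?I
      = coords ?J (\<lambda>i. ip n (column_fn X i) (synth (column_fn X) ?I w))"
      unfolding bs(4) using w by (intro off_support_correlations) (auto simp: x_def)
    obtain k where k: "k < card ?J" "i = pick ?J k"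
      using bij_betw_pick[of ?J] i by (auto simp: bij_betw_def)
    show ?thesis
      using li k unfolding eq by (subst (asm) linf_norm_le_iff) (auto simp: coords_index x_def)
  qed
qed

text \<open>The operator norm bounds synthesis by definition, and analysis by duality.\<close>
lemma column_frame_bound:
  assumes X: "X \<in> carrier_mat n p"
  shows "(\<Sum>j<p. (ip n (column_fn X j) u)\<^sup>2) \<le> (op_norm X)\<^sup>2 * ip n u u"
proof -
  let ?c = "\<lambda>j. ip n (column_fn X j) u" and ?y = "synth (column_fn X) {..<p} (\<lambda>j. ip n (column_fn X j) u)"
  let ?N = "\<Sum>j<p. (?c j)\<^sup>2"
  have N0: "0 \<le> ?N" by (rule sum_nonneg) simp
  have "l2_norm (X *\<^sub>v vec p ?c) \<le> op_norm X * l2_norm (vec p ?c)"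
    by (rule l2_norm_le_op_norm[OF X]) simp
  then have "(l2_norm (X *\<^sub>v vec p ?c))\<^sup>2 \<le> (op_norm X * l2_norm (vec p ?c))\<^sup>2"
    by (intro power_mono l2_norm_nonneg)
  then have y: "ip n ?y ?y \<le> (op_norm X)\<^sup>2 * ?N"
    by (simp add: mat_mult_coords[OF X] power_mult_distrib l2_norm_vec) (simp add: ip_def power2_eq_square)
  have "?N = ip n u ?y" by (simp add: ip_synth_right ip_commute power2_eq_square)
  then have "?N * ?N \<le> ip n u u * ip n ?y ?y"
    using ip_Cauchy_Schwarz[of n u ?y] by (simp add: power2_eq_square)
  also have "\<dots> \<le> ip n u u * ((op_norm X)\<^sup>2 * ?N)" by (intro mult_left_mono y ip_nonneg)
  finally have "?N * ?N \<le> ?N * ((op_norm X)\<^sup>2 * ip n u u)" by (simp add: ac_simps)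
  then show ?thesis using N0 ip_nonneg[of n u] by (cases "?N = 0") (auto simp: mult_le_cancel_left)
qed

lemma column_coherence:
  assumes X: "X \<in> carrier_mat n p" and ij: "i < p" "j < p" "i \<noteq> j"
  shows "\<bar>ip n (column_fn X i) (column_fn X j)\<bar> \<le> coherence X"
proof -
  have *: "\<bar>ip n (column_fn X i) (column_fn X j)\<bar> \<le> coherence X" if ij: "i < j" "j < p" for i j
  proof -
    let ?P = "{(i, j). i < j \<and> j < dim_col X}"
    have "finite ?P" by (rule finite_subset[of _ "{..<dim_col X} \<times> {..<dim_col X}"]) auto
    then have "(case (i, j) of (i, j) \<Rightarrow> \<bar>col X i \<bullet> col X j\<bar>) \<le> coherence X"
      unfolding coherence_def using X ij by (intro cSUP_upper bdd_above_finite finite_imageI) auto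
    then show ?thesis using col_eq_vec[OF X, of i] col_eq_vec[OF X, of j] ij by (simp add: vec_scalar_prod_ip)
  qed
  show ?thesis
    using *[of i j] *[of j i] ij by (cases i j rule: linorder_cases) (auto simp: ip_commute)
qed


section \<open>Most sign vectors are good\<close>
text \<open>Sign vectors are parametrized by their support and the set where they are positive, so that random signs become
random subsets of the support, as in the decoupling.\<close>
definition signed_vec :: "nat \<Rightarrow> nat set \<times> nat set \<Rightarrow> real vec" where
  "signed_vec p = (\<lambda>(I, \<eta>). vec p (\<lambda>j. if j \<in> I then sign_on \<eta> j else 0))"

lemma supp_signed_vec: "I \<subseteq> {..<p} \<Longrightarrow> supp (signed_vec p (I, \<eta>)) = I"
  by (auto simp: supp_def signed_vec_def sign_on_def subset_iff split: if_splits)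

lemma bij_betw_signed_vec:
  "bij_betw (signed_vec p) (Sigma (subsets_of_size {..<p} S) Pow) (sign_vecs p S)"
proof (rule bij_betw_byWitness[where f' = "\<lambda>b. (supp b, {j\<in>supp b. b $ j = 1})"])
  show "\<forall>a\<in>Sigma (subsets_of_size {..<p} S) Pow.
      (supp (signed_vec p a), {j\<in>supp (signed_vec p a). signed_vec p a $ j = 1}) = a"
  proof
    fix a assume a: "a \<in> Sigma (subsets_of_size {..<p} S) Pow"
    obtain I \<eta> where [simp]: "a = (I, \<eta>)" by (cases a)
    have I: "I \<subseteq> {..<p}" "\<eta> \<subseteq> I" using a by (auto simp: subsets_of_size_def)
    have "{j\<in>I. signed_vec p (I, \<eta>) $ j = 1} = \<eta>"
      using I by (auto simp: signed_vec_def sign_on_def subset_iff split: if_splits)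
    then show "(supp (signed_vec p a), {j\<in>supp (signed_vec p a). signed_vec p a $ j = 1}) = a"
      using I by (simp add: supp_signed_vec)
  qed
  show "\<forall>b\<in>sign_vecs p S. signed_vec p (supp b, {j\<in>supp b. b $ j = 1}) = b"
  proof
    fix b assume b: "b \<in> sign_vecs p S"
    show "signed_vec p (supp b, {j\<in>supp b. b $ j = 1}) = b"
    proof (rule eq_vecI)
      fix j assume "j < dim_vec b"
      then have "j < p" "b $ j \<in> {-1, 0, 1}" using b by (auto simp: sign_vecs_def)
      then show "signed_vec p (supp b, {j\<in>supp b. b $ j = 1}) $ j = b $ j"
        using \<open>j < dim_vec b\<close> by (auto simp: signed_vec_def supp_def sign_on_def)
    qed (use b in \<open>auto simp: sign_vecs_def signed_vec_def\<close>)
  qed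
  show "signed_vec p ` Sigma (subsets_of_size {..<p} S) Pow \<subseteq> sign_vecs p S"
  proof
    fix b assume "b \<in> signed_vec p ` Sigma (subsets_of_size {..<p} S) Pow"
    then obtain I \<eta> where b: "b = signed_vec p (I, \<eta>)" and I: "I \<subseteq> {..<p}" "card I = S"
      by (auto simp: subsets_of_size_def)
    then show "b \<in> sign_vecs p S"
      using supp_signed_vec[OF I(1), of \<eta>] by (auto simp: sign_vecs_def signed_vec_def sign_on_def)
  qed
  show "(\<lambda>b. (supp b, {j\<in>supp b. b $ j = 1})) ` sign_vecs p S \<subseteq> Sigma (subsets_of_size {..<p} S) Pow"
    by (auto simp: sign_vecs_def subsets_of_size_def supp_def)
qed

lemma finite_signed_supports: "finite (Sigma (subsets_of_size {..<p} S) Pow)"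
  by (intro finite_SigmaI finite_subsets_of_size finite_lessThan finite_Pow_iff[THEN iffD2])
    (metis (mono_tags) finite_lessThan finite_subset mem_Collect_eq subsets_of_size_def)

lemma finite_sign_vecs: "finite (sign_vecs p S)"
  using bij_betw_finite[OF bij_betw_signed_vec] finite_signed_supports by blast

lemma card_sign_vecs: "card (sign_vecs p S) = (p choose S) * 2 ^ S"
proof -
  have fin: "finite I" if "I \<in> subsets_of_size {..<p} S" for I
    using that by (auto simp: subsets_of_size_def intro: finite_subset)
  have "card (sign_vecs p S) = card (Sigma (subsets_of_size {..<p} S) Pow)"
    using bij_betw_same_card[OF bij_betw_signed_vec, of p S] by simp
  also have "\<dots> = (\<Sum>I\<in>subsets_of_size {..<p} S. card (Pow I))"
    by (rule card_SigmaI) (use fin in \<open>auto intro: finite_subsets_of_size\<close>)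
  also have "\<dots> = (\<Sum>I\<in>subsets_of_size {..<p} S. 2 ^ S)"
  proof (rule sum.cong[OF refl])
    fix I assume I: "I \<in> subsets_of_size {..<p} S"
    then have "card I = S" by (simp add: subsets_of_size_def)
    then show "card (Pow I) = 2 ^ S" using fin[OF I] by (simp add: card_Pow)
  qed
  finally show ?thesis by (simp add: card_subsets_of_size)
qed

lemma good_sign_vecs_subset: "dim_col X = p \<Longrightarrow> good_sign_vecs c1 X S \<subseteq> sign_vecs p S"
  by (auto simp: good_sign_vecs_def)

lemma most_sign_vecs_good:
  assumes X: "X \<in> carrier_mat n p" and p: "exp 1 \<le> real p"
    and unit: "\<forall>j<p. l2_norm (col X j) = 1"
    and coh: "coherence X \<le> (1 / 512) / ln (real p)"
    and S: "S \<le> nat \<lfloor>1 / 131072 * real p / ((op_norm X)\<^sup>2 * ln (real p))\<rfloor>"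
  shows "real (card (good_sign_vecs 1 X S)) / real (card (sign_vecs p S)) \<ge> 1 - 15 / real p"
proof -
  let ?x = "column_fn X"
  have p0: "0 < real p" using p exp_gt_zero[of "1::real"] by linarith
  have L: "1 \<le> ln (real p)" using p p0 by (simp add: ln_ge_iff)
  interpret incoherent_frame n p ?x "(op_norm X)\<^sup>2" S
  proof
    show "exp 1 \<le> real p" by (rule p)
    show "ip n (?x j) (?x j) = 1" if "j < p" for j
    proof -
      have "l2_norm (vec n (?x j)) = 1" using unit that col_eq_vec[OF X that] by metis
      then show ?thesis using l2_norm_vec[of n "?x j"] by simp
    qed
    show "(\<Sum>j<p. (ip n (?x j) u)\<^sup>2) \<le> (op_norm X)\<^sup>2 * ip n u u" for u
      by (rule column_frame_bound[OF X])
    show "\<bar>ip n (?x i) (?x j)\<bar> \<le> 1 / 512 / ln (real p)" if "i < p" "j < p" "i \<noteq> j" for i j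
      using column_coherence[OF X that] coh by linarith
    let ?d = "(op_norm X)\<^sup>2 * ln (real p)"
    have d0: "0 \<le> ?d" using L by simp
    have "real S \<le> 1 / 131072 * real p / ?d"
    proof -
      \<comment> \<open>The floor is converted to nat without loss as its argument is nonnegative, also if ?d is 0.\<close>
      have "0 \<le> 1 / 131072 * real p / ?d" using d0 by simp
      then show ?thesis using S by (simp add: le_nat_floor le_nat_iff le_floor_iff)
    qed
    then show "real S * ?d \<le> 1 / 131072 * real p"
    proof (cases "?d = 0")
      case False
      then have "0 < ?d" using d0 by (metis order_le_less)
      then show ?thesis using \<open>real S \<le> 1 / 131072 * real p / ?d\<close> by (simp only: pos_le_divide_eq)
    qed simp
  qed
  have sub: "sign_vecs p S - good_sign_vecs 1 X S \<subseteq> signed_vec p `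
    Sigma (subsets_of_size {..<p} S) (\<lambda>I. {\<eta>\<in>Pow I. \<not> (riesz_on I \<and> spread_on I \<and> signs_incoherent I \<eta>)})"
  proof
    fix b assume b: "b \<in> sign_vecs p S - good_sign_vecs 1 X S"
    then have "b \<in> signed_vec p ` Sigma (subsets_of_size {..<p} S) Pow"
      using bij_betw_imp_surj_on[OF bij_betw_signed_vec] by blast
    then obtain I \<eta> where I: "I \<in> subsets_of_size {..<p} S" "\<eta> \<subseteq> I" and b_eq: "b = signed_vec p (I, \<eta>)"
      by blast
    have I': "I \<subseteq> {..<p}" using I by (simp add: subsets_of_size_def)
    have supp: "supp b = I" unfolding b_eq by (rule supp_signed_vec[OF I'])
    have bj: "b $ j = sign_on \<eta> j" if "j \<in> I" for j
      using that I' unfolding b_eq signed_vec_def by auto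
    have "\<not> (riesz_on I \<and> spread_on I \<and> signs_incoherent I \<eta>)"
    proof
      assume good: "riesz_on I \<and> spread_on I \<and> signs_incoherent I \<eta>"
      have "b \<in> good_sign_vecs 1 X S"
      proof (rule good_sign_vecsI[OF X])
        show "b \<in> sign_vecs p S" using b by simp
        show "0 \<le> 1 / sqrt (ln (real p))" using L by simp
        show "1 / 2 * (\<Sum>i\<in>supp b. (u i)\<^sup>2) \<le> ip n (synth ?x (supp b) u) (synth ?x (supp b) u)" for u
          using good unfolding supp riesz_on_def by blast
        show "\<bar>ip n (?x i) (synth ?x (supp b) w)\<bar> \<le> 1 / 4"
          if "i \<in> {..<p} - supp b" "\<And>j. j \<in> supp b \<Longrightarrow> ip n (?x j) (synth ?x (supp b) w) = b $ j" for i w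
          using good that bj unfolding supp signs_incoherent_def by auto
        show "ip n (synth ?x (supp b) w) (synth ?x (supp b) w) \<le> (1 / sqrt (ln (real p)))\<^sup>2"
          if "i \<in> {..<p} - supp b" "\<And>j. j \<in> supp b \<Longrightarrow> ip n (?x j) (synth ?x (supp b) w) = ip n (?x j) (?x i)" for i w
          using projection_small(2)[of I i w] good that L unfolding supp
          by (simp add: power_divide ip_commute)
      qed
      then show False using b by simp
    qed
    then show "b \<in> signed_vec p ` Sigma (subsets_of_size {..<p} S)
        (\<lambda>I. {\<eta>\<in>Pow I. \<not> (riesz_on I \<and> spread_on I \<and> signs_incoherent I \<eta>)})"
      using I b_eq by auto
  qed
  have fin: "finite (Sigma (subsets_of_size {..<p} S)
      (\<lambda>I. {\<eta>\<in>Pow I. \<not> (riesz_on I \<and> spread_on I \<and> signs_incoherent I \<eta>)}))"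
    by (rule finite_subset[OF _ finite_signed_supports[of p S]]) auto
  have solvable: "\<exists>w. \<forall>j\<in>I. ip n (?x j) (synth ?x I w) = v j" if I: "I \<subseteq> {..<p}" "riesz_on I" for I v
  proof -
    interpret gram_inverse n p X I
      using I unfolding riesz_on_def by (intro gram_inverse_of_riesz X) auto
    show ?thesis by (rule solution_exists)
  qed
  have "card (sign_vecs p S - good_sign_vecs 1 X S) \<le> card (Sigma (subsets_of_size {..<p} S)
      (\<lambda>I. {\<eta>\<in>Pow I. \<not> (riesz_on I \<and> spread_on I \<and> signs_incoherent I \<eta>)}))"
    by (rule surj_card_le[OF fin sub])
  also have "\<dots> = (\<Sum>I\<in>subsets_of_size {..<p} S. card {\<eta>\<in>Pow I. \<not> (riesz_on I \<and> spread_on I \<and> signs_incoherent I \<eta>)})"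
    proof (rule card_SigmaI)
    have "finite I" if "I \<in> subsets_of_size {..<p} S" for I
      using that by (auto simp: subsets_of_size_def intro: finite_subset)
    then show "\<forall>I\<in>subsets_of_size {..<p} S. finite {\<eta>\<in>Pow I. \<not> (riesz_on I \<and> spread_on I \<and> signs_incoherent I \<eta>)}"
      by simp
  qed (simp add: finite_subsets_of_size)
  finally have "real (card (sign_vecs p S - good_sign_vecs 1 X S)) \<le>
    real (\<Sum>I\<in>subsets_of_size {..<p} S. card {\<eta>\<in>Pow I. \<not> (riesz_on I \<and> spread_on I \<and> signs_incoherent I \<eta>)})"
    by (rule of_nat_mono)
  also have "\<dots> = (\<Sum>I\<in>subsets_of_size {..<p} S.
      real (card {\<eta>\<in>Pow I. \<not> (riesz_on I \<and> spread_on I \<and> signs_incoherent I \<eta>)}))"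
    by (rule of_nat_sum)
  also have "\<dots> \<le> real (p choose S) * 2 ^ S * (15 / real p)"
    by (rule few_bad_signed_supports[OF solvable])
  finally have bad: "real (card (sign_vecs p S - good_sign_vecs 1 X S)) \<le> real (card (sign_vecs p S)) * (15 / real p)"
    by (simp add: card_sign_vecs)
  have gs: "good_sign_vecs 1 X S \<subseteq> sign_vecs p S" using X by (intro good_sign_vecs_subset) auto
  have "real (card (sign_vecs p S - good_sign_vecs 1 X S)) =
    real (card (sign_vecs p S)) - real (card (good_sign_vecs 1 X S))"
    using gs finite_sign_vecs[of p S] by (simp add: card_Diff_subset finite_subset card_mono of_nat_diff)
  then have "real (card (sign_vecs p S)) * (1 - 15 / real p) \<le> real (card (good_sign_vecs 1 X S))"
    using bad by (simp add: algebra_simps)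
  moreover have "0 < real (card (sign_vecs p S))" using S_le(2) by (simp add: card_sign_vecs)
  ultimately show ?thesis by (simp add: field_simps)
qed


section \<open>Gaussian noise\<close>
text \<open>Completing the square turns the tilted density into a shifted normal density.\<close>
lemma normal_exp_moment:
  assumes \<sigma>: "0 < \<sigma>"
  shows "(\<integral>\<^sup>+x. ennreal (exp (a * x)) \<partial>density lborel (\<lambda>x. ennreal (normal_density 0 \<sigma> x))) = ennreal (exp (a\<^sup>2 * \<sigma>\<^sup>2 / 2))"
proof -
  have shift: "normal_density 0 \<sigma> x * exp (a * x) = exp (a\<^sup>2 * \<sigma>\<^sup>2 / 2) * normal_density (a * \<sigma>\<^sup>2) \<sigma> x" for x
  proof -
    have "- (x - 0)\<^sup>2 / (2 * \<sigma>\<^sup>2) + a * x = a\<^sup>2 * \<sigma>\<^sup>2 / 2 + (- (x - a * \<sigma>\<^sup>2)\<^sup>2 / (2 * \<sigma>\<^sup>2))"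
      using \<sigma> by (simp add: field_simps power2_eq_square)
    then have "exp (- (x - 0)\<^sup>2 / (2 * \<sigma>\<^sup>2)) * exp (a * x) = exp (a\<^sup>2 * \<sigma>\<^sup>2 / 2) * exp (- (x - a * \<sigma>\<^sup>2)\<^sup>2 / (2 * \<sigma>\<^sup>2))"
      by (simp only: exp_add[symmetric])
    then show ?thesis unfolding normal_density_def by (simp add: ac_simps)
  qed
  have "(\<integral>\<^sup>+x. ennreal (exp (a * x)) \<partial>density lborel (\<lambda>x. ennreal (normal_density 0 \<sigma> x))) =
    (\<integral>\<^sup>+x. ennreal (normal_density 0 \<sigma> x) * ennreal (exp (a * x)) \<partial>lborel)"
    by (subst nn_integral_density) auto
  also have "\<dots> = (\<integral>\<^sup>+x. ennreal (exp (a\<^sup>2 * \<sigma>\<^sup>2 / 2)) * ennreal (normal_density (a * \<sigma>\<^sup>2) \<sigma> x) \<partial>lborel)"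
    using \<sigma> by (simp flip: ennreal_mult' add: shift)
  also have "\<dots> = ennreal (exp (a\<^sup>2 * \<sigma>\<^sup>2 / 2)) * (\<integral>\<^sup>+x. ennreal (normal_density (a * \<sigma>\<^sup>2) \<sigma> x) \<partial>lborel)"
    by (rule nn_integral_cmult) auto
  also have "(\<integral>\<^sup>+x. ennreal (normal_density (a * \<sigma>\<^sup>2) \<sigma> x) \<partial>lborel) = 1"
  proof -
    interpret prob_space "density lborel (\<lambda>x. ennreal (normal_density (a * \<sigma>\<^sup>2) \<sigma> x))"
      using \<sigma> by (rule prob_space_normal_density)
    show ?thesis using emeasure_space_1 by (simp add: emeasure_density)
  qed
  finally show ?thesis by simp
qed

lemma prob_space_gaussian_noise: "0 < \<sigma> \<Longrightarrow> prob_space (gaussian_noise n \<sigma>)"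
  unfolding gaussian_noise_def by (intro prob_space_PiM prob_space_normal_density)

lemma measurable_ip_noise [measurable]: "(\<lambda>z. ip n u z) \<in> borel_measurable (gaussian_noise n \<sigma>)"
proof -
  have "(\<lambda>z. z i) \<in> borel_measurable (gaussian_noise n \<sigma>)" if "i \<in> {..<n}" for i
    using measurable_component_singleton[OF that, of "\<lambda>_. density lborel (\<lambda>x. ennreal (normal_density 0 \<sigma> x))"]
    unfolding gaussian_noise_def by simp
  then show ?thesis unfolding ip_def by (intro borel_measurable_sum borel_measurable_times) auto
qed

lemma gaussian_exp_moment:
  assumes \<sigma>: "0 < \<sigma>"
  shows "(\<integral>\<^sup>+z. ennreal (exp (ip n u z)) \<partial>gaussian_noise n \<sigma>) = ennreal (exp (\<sigma>\<^sup>2 * ip n u u / 2))"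
proof -
  let ?N = "density lborel (\<lambda>x. ennreal (normal_density 0 \<sigma> x))"
  interpret prob_space ?N using \<sigma> by (rule prob_space_normal_density)
  interpret product_sigma_finite "\<lambda>_::nat. ?N" by unfold_locales
  have "(\<integral>\<^sup>+z. ennreal (exp (ip n u z)) \<partial>gaussian_noise n \<sigma>) =
    (\<integral>\<^sup>+z. (\<Prod>i\<in>{..<n}. ennreal (exp (u i * z i))) \<partial>(\<Pi>\<^sub>M i\<in>{..<n}. ?N))"
    unfolding gaussian_noise_def ip_def by (simp add: exp_sum prod_ennreal)
  also have "\<dots> = (\<Prod>i\<in>{..<n}. (\<integral>\<^sup>+x. ennreal (exp (u i * x)) \<partial>?N))"
    by (rule product_nn_integral_prod) auto
  also have "\<dots> = ennreal (\<Prod>i\<in>{..<n}. exp ((u i)\<^sup>2 * \<sigma>\<^sup>2 / 2))"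
    using \<sigma> by (simp add: normal_exp_moment prod_ennreal)
  also have "(\<Prod>i\<in>{..<n}. exp ((u i)\<^sup>2 * \<sigma>\<^sup>2 / 2)) = exp (\<sigma>\<^sup>2 * ip n u u / 2)"
    by (simp add: exp_sum[symmetric] ip_def power2_eq_square sum_distrib_left sum_divide_distrib ac_simps)
  finally show ?thesis .
qed

lemma gaussian_tail_upper:
  assumes \<sigma>: "0 < \<sigma>" and u: "ip n u u \<le> 1" and t: "0 \<le> t"
  shows "measure (gaussian_noise n \<sigma>) {z \<in> space (gaussian_noise n \<sigma>). t * \<sigma> < ip n u z} \<le> exp (- t\<^sup>2 / 2)"
proof -
  let ?M = "gaussian_noise n \<sigma>"
  interpret prob_space ?M using \<sigma> by (rule prob_space_gaussian_noise)
  define s where "s = t / \<sigma>"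
  have s: "0 \<le> s" "s * (t * \<sigma>) = t\<^sup>2" "s\<^sup>2 * \<sigma>\<^sup>2 = t\<^sup>2"
    using \<sigma> t by (simp_all add: s_def power2_eq_square)
  have su: "ip n (\<lambda>i. s * u i) z = s * ip n u z" for z by (simp add: ip_linear_left)
  have "emeasure ?M {z \<in> space ?M. t * \<sigma> < ip n u z} \<le>
    emeasure ?M {z \<in> space ?M. 1 \<le> ennreal (exp (- t\<^sup>2)) * ennreal (exp (ip n (\<lambda>i. s * u i) z))}"
  proof (intro emeasure_mono subsetI)
    fix z assume z: "z \<in> {z \<in> space ?M. t * \<sigma> < ip n u z}"
    then have "s * (t * \<sigma>) \<le> s * ip n u z" using s by (intro mult_left_mono) auto
    then have "1 \<le> exp (- t\<^sup>2) * exp (s * ip n u z)" using s by (simp flip: exp_add)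
    then have "ennreal 1 \<le> ennreal (exp (- t\<^sup>2) * exp (s * ip n u z))" by (rule ennreal_leI)
    then show "z \<in> {z \<in> space ?M. 1 \<le> ennreal (exp (- t\<^sup>2)) * ennreal (exp (ip n (\<lambda>i. s * u i) z))}"
      using z unfolding su by (simp add: ennreal_mult')
  qed measurable
  also have "\<dots> \<le> ennreal (exp (- t\<^sup>2)) * (\<integral>\<^sup>+z. ennreal (exp (ip n (\<lambda>i. s * u i) z)) * indicator (space ?M) z \<partial>?M)"
    by (rule nn_integral_Markov_inequality[THEN order_trans[rotated]]) (auto intro!: emeasure_mono)
  also have "(\<integral>\<^sup>+z. ennreal (exp (ip n (\<lambda>i. s * u i) z)) * indicator (space ?M) z \<partial>?M) =
    (\<integral>\<^sup>+z. ennreal (exp (ip n (\<lambda>i. s * u i) z)) \<partial>?M)"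
    by (intro nn_integral_cong) auto
  also have "\<dots> = ennreal (exp (\<sigma>\<^sup>2 * (s\<^sup>2 * ip n u u) / 2))"
    unfolding gaussian_exp_moment[OF \<sigma>] by (simp add: ip_linear_left ip_linear_right power2_eq_square ac_simps)
  also have "\<dots> \<le> ennreal (exp (t\<^sup>2 / 2))"
  proof (intro ennreal_leI)
    have "\<sigma>\<^sup>2 * (s\<^sup>2 * ip n u u) = t\<^sup>2 * ip n u u" using s(3) by (simp add: ac_simps)
    also have "\<dots> \<le> t\<^sup>2 * 1" by (intro mult_left_mono u) simp
    finally show "exp (\<sigma>\<^sup>2 * (s\<^sup>2 * ip n u u) / 2) \<le> exp (t\<^sup>2 / 2)" by simp
  qed
  also have "ennreal (exp (- t\<^sup>2)) * ennreal (exp (t\<^sup>2 / 2)) = ennreal (exp (- t\<^sup>2 / 2))"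
    by (simp flip: ennreal_mult' exp_add)
  finally show ?thesis
    by (simp add: emeasure_eq_measure mult_left_mono)
qed

lemma gaussian_union_bound:
  assumes \<sigma>: "0 < \<sigma>" and u: "\<And>j. j < p \<Longrightarrow> ip n (u j) (u j) \<le> 1" and t: "0 \<le> t"
  shows "measure (gaussian_noise n \<sigma>) {z \<in> space (gaussian_noise n \<sigma>). \<forall>j<p. \<bar>ip n (u j) z\<bar> \<le> t * \<sigma>}
    \<ge> 1 - 2 * real p * exp (- t\<^sup>2 / 2)"
proof -
  let ?M = "gaussian_noise n \<sigma>"
  interpret prob_space ?M using \<sigma> by (rule prob_space_gaussian_noise)
  let ?P = "\<lambda>v. {z \<in> space ?M. t * \<sigma> < ip n v z}"
  have neg: "ip n (\<lambda>i. - u j i) z = - ip n (u j) z" for j z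
    using ip_linear_left(4)[of n "-1" "u j" z] by simp
  have neg2: "ip n (\<lambda>i. - u j i) (\<lambda>i. - u j i) = ip n (u j) (u j)" for j
    by (simp add: ip_def)
  have m [measurable]: "?P v \<in> sets ?M" for v by measurable
  have "{z \<in> space ?M. \<not> (\<forall>j<p. \<bar>ip n (u j) z\<bar> \<le> t * \<sigma>)} \<subseteq> (\<Union>j<p. ?P (u j) \<union> ?P (\<lambda>i. - u j i))"
    unfolding neg by (auto simp: abs_le_iff not_le)
  then have "prob {z \<in> space ?M. \<not> (\<forall>j<p. \<bar>ip n (u j) z\<bar> \<le> t * \<sigma>)} \<le> prob (\<Union>j<p. ?P (u j) \<union> ?P (\<lambda>i. - u j i))"
    by (intro finite_measure_mono) auto
  also have "\<dots> \<le> (\<Sum>j<p. prob (?P (u j) \<union> ?P (\<lambda>i. - u j i)))"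
    by (intro finite_measure_subadditive_finite) auto
  also have "\<dots> \<le> (\<Sum>j<p. exp (- t\<^sup>2 / 2) + exp (- t\<^sup>2 / 2))"
  proof (intro sum_mono)
    fix j assume "j \<in> {..<p}"
    then have "ip n (u j) (u j) \<le> 1" using u by simp
    then have "prob (?P (u j)) + prob (?P (\<lambda>i. - u j i)) \<le> exp (- t\<^sup>2 / 2) + exp (- t\<^sup>2 / 2)"
      by (intro add_mono gaussian_tail_upper \<sigma> t) (simp_all only: neg2)
    then show "prob (?P (u j) \<union> ?P (\<lambda>i. - u j i)) \<le> exp (- t\<^sup>2 / 2) + exp (- t\<^sup>2 / 2)"
      using measure_Un_le[OF m m, of "u j" "\<lambda>i. - u j i"] by linarith
  qed
  also have "\<dots> = 2 * real p * exp (- t\<^sup>2 / 2)" by simp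
  finally have "prob {z \<in> space ?M. \<not> (\<forall>j<p. \<bar>ip n (u j) z\<bar> \<le> t * \<sigma>)} \<le> 2 * real p * exp (- t\<^sup>2 / 2)" .
  moreover have "{z \<in> space ?M. \<forall>j<p. \<bar>ip n (u j) z\<bar> \<le> t * \<sigma>} \<in> events" by measurable
  then have "prob {z \<in> space ?M. \<not> (\<forall>j<p. \<bar>ip n (u j) z\<bar> \<le> t * \<sigma>)} =
    1 - prob {z \<in> space ?M. \<forall>j<p. \<bar>ip n (u j) z\<bar> \<le> t * \<sigma>}"
    by (rule prob_neg)
  ultimately show ?thesis by linarith
qed


section \<open>The lasso\<close>
locale lasso =
  fixes n p :: nat and x :: "nat \<Rightarrow> nat \<Rightarrow> real" and \<tau> :: real
  assumes \<tau>_pos: "0 < \<tau>"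
begin

abbreviation fit :: "(nat \<Rightarrow> real) \<Rightarrow> nat \<Rightarrow> real" where
  "fit b \<equiv> synth x {..<p} b"

definition l1 :: "(nat \<Rightarrow> real) \<Rightarrow> real" where
  "l1 b = (\<Sum>j<p. \<bar>b j\<bar>)"

abbreviation sqn :: "(nat \<Rightarrow> real) \<Rightarrow> real" where
  "sqn f \<equiv> ip n f f"

abbreviation fdiff :: "(nat \<Rightarrow> real) \<Rightarrow> (nat \<Rightarrow> real) \<Rightarrow> nat \<Rightarrow> real" (infixl "-\<^sub>f" 65) where
  "f -\<^sub>f g \<equiv> (\<lambda>k. f k - g k)"

definition objective :: "(nat \<Rightarrow> real) \<Rightarrow> (nat \<Rightarrow> real) \<Rightarrow> real" where
  "objective y b = 1 / 2 * sqn (y -\<^sub>f fit b) + \<tau> * l1 b"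

definition minimizer :: "(nat \<Rightarrow> real) \<Rightarrow> (nat \<Rightarrow> real) \<Rightarrow> bool" where
  "minimizer y b \<longleftrightarrow> (\<forall>b'. objective y b \<le> objective y b')"

lemma l1_nonneg: "0 \<le> l1 b"
  by (simp add: l1_def sum_nonneg)

text \<open>The objective at 0 bounds the l1 norm of all better candidates because tau > 0, so the search can be
confined to a compact box; coordinates from p on do not influence the objective.\<close>
lemma objective_exists_minimizer: "\<exists>b. minimizer y b"
proof -
  define K where "K = objective y (\<lambda>_. 0) / \<tau>"
  have obj0: "0 \<le> objective y b" for b
    unfolding objective_def using \<tau>_pos by (intro add_nonneg_nonneg mult_nonneg_nonneg ip_nonneg l1_nonneg) auto
  have K0: "0 \<le> K" unfolding K_def using obj0 \<tau>_pos by simp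
  define Bx where "Bx = PiE UNIV (\<lambda>i. if i < p then {-K..K} else {0::real})"
  have "compact Bx"
  proof -
    have "compactin (product_topology (\<lambda>_. euclidean) UNIV) Bx"
      unfolding Bx_def compactin_PiE by simp
    then show ?thesis by (simp add: euclidean_product_topology)
  qed
  moreover have "(\<lambda>_. 0) \<in> Bx" using K0 by (auto simp: Bx_def)
  moreover have "continuous_on Bx (objective y)"
    unfolding objective_def ip_def synth_def l1_def by (intro continuous_intros continuous_on_product_coordinates[THEN continuous_on_subset]) auto
  ultimately obtain b where b: "b \<in> Bx" "\<And>b'. b' \<in> Bx \<Longrightarrow> objective y b \<le> objective y b'"
    using continuous_attains_inf[of Bx "objective y"] by blast
  have "objective y b \<le> objective y b'" for b'
  proof (cases "objective y b' \<le> objective y (\<lambda>_. 0)")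
    case True
    define c where "c i = (if i < p then b' i else 0)" for i
    have same: "objective y c = objective y b'"
      unfolding objective_def l1_def synth_def c_def by simp
    have "\<tau> * l1 b' \<le> objective y b'"
      unfolding objective_def using ip_nonneg[of n "y -\<^sub>f fit b'"] by simp
    then have "l1 b' \<le> K" using True \<tau>_pos by (simp add: K_def field_simps)
    moreover have "\<bar>b' i\<bar> \<le> l1 b'" if "i < p" for i
      unfolding l1_def using that by (intro member_le_sum) auto
    ultimately have "\<bar>b' i\<bar> \<le> K" if "i < p" for i using that by (meson order_trans)
    then have "c \<in> Bx" by (auto simp: Bx_def c_def abs_le_iff minus_le_iff)
    then show ?thesis using b(2) same by metis
  next
    case False
    then show ?thesis using b(2)[OF \<open>(\<lambda>_. 0) \<in> Bx\<close>] by simp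
  qed
  then show ?thesis unfolding minimizer_def by blast
qed

lemma objective_convex_path:
  assumes t: "0 \<le> t" "t \<le> 1"
  shows "objective y (\<lambda>j. a j + t * (b j - a j)) \<le>
    1 / 2 * sqn (y -\<^sub>f fit a) - t * ip n (y -\<^sub>f fit a) (fit b -\<^sub>f fit a) + t\<^sup>2 / 2 * sqn (fit b -\<^sub>f fit a)
      + \<tau> * ((1 - t) * l1 a + t * l1 b)"
proof -
  let ?c = "\<lambda>j. a j + t * (b j - a j)"
  have path: "y -\<^sub>f fit ?c = (\<lambda>k. (y k - fit a k) - t * (fit b k - fit a k))"
    by (rule ext) (simp add: synth_def algebra_simps sum.distrib sum_subtractf sum_distrib_left)
  have q: "sqn (y -\<^sub>f fit ?c) = sqn (y -\<^sub>f fit a) - 2 * t * ip n (y -\<^sub>f fit a) (fit b -\<^sub>f fit a) + t\<^sup>2 * sqn (fit b -\<^sub>f fit a)"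
    unfolding path unfolding ip_def sum_distrib_left sum.distrib[symmetric] sum_subtractf[symmetric]
    by (intro sum.cong refl) (simp add: power2_eq_square algebra_simps)
  have "l1 ?c \<le> (\<Sum>j<p. (1 - t) * \<bar>a j\<bar> + t * \<bar>b j\<bar>)"
    unfolding l1_def
  proof (rule sum_mono)
    fix j
    have "a j + t * (b j - a j) = (1 - t) * a j + t * b j" by (simp add: algebra_simps)
    also have "\<bar>\<dots>\<bar> \<le> \<bar>(1 - t) * a j\<bar> + \<bar>t * b j\<bar>" by (rule abs_triangle_ineq)
    finally show "\<bar>a j + t * (b j - a j)\<bar> \<le> (1 - t) * \<bar>a j\<bar> + t * \<bar>b j\<bar>"
      using t by (simp add: abs_mult)
  qed
  also have "\<dots> = (1 - t) * l1 a + t * l1 b"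
    by (simp add: l1_def sum.distrib sum_distrib_left)
  finally have "\<tau> * l1 ?c \<le> \<tau> * ((1 - t) * l1 a + t * l1 b)"
    using \<tau>_pos by (intro mult_left_mono) auto
  then show ?thesis unfolding objective_def q by (simp add: field_simps)
qed

text \<open>The first-order condition along the segment from a to b. The quadratic part is differentiated
exactly, while convexity suffices for the l1 norm.\<close>
lemma minimizer_variational:
  assumes a: "minimizer y a"
  shows "ip n (y -\<^sub>f fit a) (fit b -\<^sub>f fit a) \<le> \<tau> * (l1 b - l1 a)"
proof (rule field_le_epsilon)
  fix e :: real assume e: "0 < e"
  let ?i = "ip n (y -\<^sub>f fit a) (fit b -\<^sub>f fit a)" and ?q = "sqn (fit b -\<^sub>f fit a)"
  define t where "t = min 1 (e / (?q + 1))"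
  have q0: "0 \<le> ?q" by (rule ip_nonneg)
  have t: "0 < t" "t \<le> 1" using e q0 by (auto simp: t_def)
  have tq: "t * ?q \<le> e"
  proof -
    have "t * ?q \<le> e / (?q + 1) * ?q" using q0 by (intro mult_right_mono) (auto simp: t_def)
    also have "\<dots> \<le> e" using e q0 by (simp add: field_simps)
    finally show ?thesis .
  qed
  have "objective y a \<le> objective y (\<lambda>j. a j + t * (b j - a j))"
    using a by (simp add: minimizer_def)
  then have "1 / 2 * sqn (y -\<^sub>f fit a) + \<tau> * l1 a \<le>
    1 / 2 * sqn (y -\<^sub>f fit a) - t * ?i + t\<^sup>2 / 2 * ?q + \<tau> * ((1 - t) * l1 a + t * l1 b)"
    using objective_convex_path[of t y a b] t by (simp add: objective_def)
  then have "t * ?i \<le> t * (\<tau> * (l1 b - l1 a) + t * ?q / 2)"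
    by (simp add: algebra_simps power2_eq_square)
  then have "?i \<le> \<tau> * (l1 b - l1 a) + t * ?q / 2" using t by simp
  then show "?i \<le> \<tau> * (l1 b - l1 a) + e" using tq e by simp
qed

text \<open>The fit is the proximal map of a convex function: adding the two first-order conditions gives
monotonicity. Both uniqueness of the fit and its measurability follow.\<close>
lemma fit_nonexpansive:
  assumes a: "minimizer y a" and a': "minimizer y' a'"
  shows "sqn (fit a -\<^sub>f fit a') \<le> sqn (y -\<^sub>f y')"
proof -
  let ?d = "fit a -\<^sub>f fit a'"
  have "ip n (y -\<^sub>f fit a) (fit a' -\<^sub>f fit a) + ip n (y' -\<^sub>f fit a') (fit a -\<^sub>f fit a') \<le> 0"
    using minimizer_variational[OF a, of a'] minimizer_variational[OF a', of a] by (simp add: algebra_simps)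
  moreover have "ip n (y -\<^sub>f fit a) (fit a' -\<^sub>f fit a) + ip n (y' -\<^sub>f fit a') (fit a -\<^sub>f fit a') =
    sqn ?d - ip n (y -\<^sub>f y') ?d"
    unfolding ip_def sum.distrib[symmetric] sum_subtractf[symmetric]
    by (intro sum.cong refl) (simp add: algebra_simps)
  ultimately have le: "sqn ?d \<le> ip n (y -\<^sub>f y') ?d" by simp
  then have "(sqn ?d)\<^sup>2 \<le> (ip n (y -\<^sub>f y') ?d)\<^sup>2" by (intro power_mono ip_nonneg)
  also have "\<dots> \<le> sqn (y -\<^sub>f y') * sqn ?d" by (rule ip_Cauchy_Schwarz)
  finally have "sqn ?d * sqn ?d \<le> sqn ?d * sqn (y -\<^sub>f y')" by (simp add: power2_eq_square ac_simps)
  then show ?thesis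
    using ip_nonneg[of n ?d] ip_nonneg[of n "y -\<^sub>f y'"] by (cases "sqn ?d = 0") (auto simp: mult_le_cancel_left)
qed

lemma loss_unique:
  assumes "minimizer y a" "minimizer y a'"
  shows "sqn (f -\<^sub>f fit a) = sqn (f -\<^sub>f fit a')"
proof -
  have "sqn (fit a -\<^sub>f fit a') \<le> 0"
    using fit_nonexpansive[OF assms] by (simp add: ip_def)
  then have "(\<Sum>k<n. (fit a k - fit a' k)\<^sup>2) = 0"
    using ip_nonneg[of n "fit a -\<^sub>f fit a'"] by (simp add: ip_def power2_eq_square)
  then have "fit a k = fit a' k" if "k < n" for k
    using that by (simp add: sum_nonneg_eq_0_iff)
  then show ?thesis unfolding ip_def by (intro sum.cong) auto
qed

text \<open>The vector g replaces the noise on the support, absorbing the sign term of the l1 norm there, and the l1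
penalty off the support absorbs the difference of noise and g. What is left is the pairing of g with h = fit a - fit b, and
2 <g, h> <= |g|^2 + |h|^2, where the first-order condition also supplies |h|^2 on the other side.\<close>
lemma oracle_inequality:
  assumes a: "minimizer (\<lambda>k. f k + z k) a"
    and I: "I \<subseteq> {..<p}" and bI: "\<And>j. j < p \<Longrightarrow> j \<notin> I \<Longrightarrow> b j = 0"
    and g: "\<And>j. j \<in> I \<Longrightarrow> ip n (x j) g = ip n (x j) z - \<tau> * sgn (b j)" and gI: "g = synth x I w"
    and off: "\<And>i. i \<in> {..<p} - I \<Longrightarrow> \<bar>ip n (x i) z - ip n (x i) g\<bar> \<le> \<tau>"
  shows "sqn (f -\<^sub>f fit a) \<le> sqn (f -\<^sub>f fit b) + sqn g"
proof -
  define h where "h j = a j - b j" for j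
  let ?h = "fit a -\<^sub>f fit b"
  have fh: "?h = fit h"
    by (rule ext) (simp add: synth_def h_def algebra_simps sum_subtractf)
  have split: "(\<Sum>j<p. u j) = (\<Sum>j\<in>{..<p} - I. u j) + (\<Sum>j\<in>I. u j)" for u :: "nat \<Rightarrow> real"
    using I by (intro sum.subset_diff) auto
  have "ip n z ?h = (\<Sum>j<p. h j * ip n (x j) z)"
    unfolding fh ip_synth_right by (simp add: ip_commute)
  moreover have "ip n g ?h = (\<Sum>j<p. h j * ip n (x j) g)"
    unfolding fh ip_synth_right by (simp add: ip_commute)
  ultimately have "ip n z ?h - ip n g ?h + \<tau> * (l1 b - l1 a) =
    (\<Sum>j<p. h j * (ip n (x j) z - ip n (x j) g) + \<tau> * (\<bar>b j\<bar> - \<bar>a j\<bar>))"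
    by (simp add: l1_def sum.distrib sum_subtractf sum_distrib_left algebra_simps)
  also have "\<dots> \<le> (\<Sum>j<p. 0)"
  proof (rule sum_mono)
    fix j assume j: "j \<in> {..<p}"
    show "h j * (ip n (x j) z - ip n (x j) g) + \<tau> * (\<bar>b j\<bar> - \<bar>a j\<bar>) \<le> 0"
    proof (cases "j \<in> I")
      case True
      \<comment> \<open>On the support the l1 norm is bounded below by its tangent at b.\<close>
      have "\<bar>b j\<bar> + sgn (b j) * h j \<le> \<bar>a j\<bar>"
        by (auto simp: h_def sgn_if)
      then have "\<tau> * (\<bar>b j\<bar> + sgn (b j) * h j) \<le> \<tau> * \<bar>a j\<bar>" using \<tau>_pos by (intro mult_left_mono) auto
      moreover have "ip n (x j) z - ip n (x j) g = \<tau> * sgn (b j)" using g[OF True] by simp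
      then have "h j * (ip n (x j) z - ip n (x j) g) = \<tau> * (sgn (b j) * h j)" by simp
      ultimately show ?thesis by (simp add: right_diff_distrib distrib_left)
    next
      case False
      have "h j * (ip n (x j) z - ip n (x j) g) \<le> \<bar>h j\<bar> * \<bar>ip n (x j) z - ip n (x j) g\<bar>"
        by (metis abs_ge_self abs_mult)
      also have "\<dots> \<le> \<bar>h j\<bar> * \<tau>" using off[of j] j False by (intro mult_left_mono) auto
      finally show ?thesis using bI[of j] j False by (simp add: h_def algebra_simps)
    qed
  qed
  finally have zg: "ip n z ?h + \<tau> * (l1 b - l1 a) \<le> ip n g ?h" by simp
  have "ip n ((\<lambda>k. f k + z k) -\<^sub>f fit a) (fit b -\<^sub>f fit a) \<le> \<tau> * (l1 b - l1 a)"
    by (rule minimizer_variational[OF a])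
  moreover have "ip n ((\<lambda>k. f k + z k) -\<^sub>f fit a) (fit b -\<^sub>f fit a) =
    1 / 2 * (sqn (f -\<^sub>f fit a) + sqn ?h - sqn (f -\<^sub>f fit b)) - ip n z ?h"
    unfolding ip_def sum.distrib[symmetric] sum_subtractf[symmetric] sum_distrib_left
    by (intro sum.cong refl) (simp add: algebra_simps)
  ultimately have "1 / 2 * (sqn (f -\<^sub>f fit a) + sqn ?h - sqn (f -\<^sub>f fit b)) \<le> ip n g ?h"
    using zg by linarith
  moreover have "2 * ip n g ?h \<le> sqn g + sqn ?h"
  proof -
    have "0 \<le> sqn (g -\<^sub>f ?h)" by (rule ip_nonneg)
    also have "sqn (g -\<^sub>f ?h) = sqn g + sqn ?h - 2 * ip n g ?h"
      unfolding ip_def sum.distrib[symmetric] sum_subtractf[symmetric] sum_distrib_left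
      by (intro sum.cong refl) (simp add: algebra_simps)
    finally show ?thesis by simp
  qed
  ultimately show ?thesis by simp
qed

text \<open>Any choice of minimizers will do, since the loss is nonexpansive in the noise.\<close>
lemma continuous_loss:
  assumes m: "\<And>z. minimizer (\<lambda>k. f k + z k) (a z)"
  shows "continuous_on UNIV (\<lambda>z. sqrt (sqn (f -\<^sub>f fit (a z))))"
proof -
  have tri: "sqrt (sqn u) \<le> sqrt (sqn v) + sqrt (sqn (u -\<^sub>f v))" for u v
    using L2_set_triangle_ineq[of v "u -\<^sub>f v" "{..<n}"]
    by (simp add: L2_set_def ip_def power2_eq_square)
  have lip: "\<bar>sqrt (sqn (f -\<^sub>f fit (a z))) - sqrt (sqn (f -\<^sub>f fit (a z')))\<bar> \<le> sqrt (sqn (z -\<^sub>f z'))" for z z'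
  proof -
    have "sqrt (sqn (f -\<^sub>f fit (a u))) \<le> sqrt (sqn (f -\<^sub>f fit (a v))) + sqrt (sqn (u -\<^sub>f v))" for u v
    proof -
      have "sqn ((f -\<^sub>f fit (a u)) -\<^sub>f (f -\<^sub>f fit (a v))) = sqn (fit (a u) -\<^sub>f fit (a v))"
        unfolding ip_def by (intro sum.cong refl) (simp add: algebra_simps)
      also have "\<dots> \<le> sqn (u -\<^sub>f v)"
        using fit_nonexpansive[OF m[of u] m[of v]] by simp
      finally have "sqrt (sqn ((f -\<^sub>f fit (a u)) -\<^sub>f (f -\<^sub>f fit (a v)))) \<le> sqrt (sqn (u -\<^sub>f v))"
        by (rule real_sqrt_le_mono)
      then show ?thesis using tri[of "f -\<^sub>f fit (a u)" "f -\<^sub>f fit (a v)"] by linarith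
    qed
    note this[of z z'] this[of z' z]
    moreover have "sqrt (sqn (z -\<^sub>f z')) = sqrt (sqn (z' -\<^sub>f z))"
      unfolding ip_def by (intro arg_cong[where f = sqrt] sum.cong refl) (simp add: algebra_simps)
    ultimately show ?thesis by linarith
  qed
  have "isCont (\<lambda>z. sqrt (sqn (f -\<^sub>f fit (a z)))) z" for z
  proof -
    have "continuous_on UNIV (\<lambda>z'. sqrt (sqn (z' -\<^sub>f z)))"
      unfolding ip_def by (intro continuous_intros continuous_on_product_coordinates)
    then have "isCont (\<lambda>z'. sqrt (sqn (z' -\<^sub>f z))) z"
      by (simp add: continuous_on_eq_continuous_at)
    then have "((\<lambda>z'. sqrt (sqn (z' -\<^sub>f z))) \<longlongrightarrow> sqrt (sqn (z -\<^sub>f z))) (at z)"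
      by (simp only: isCont_def)
    moreover have "sqrt (sqn (z -\<^sub>f z)) = 0" by (simp add: ip_def)
    ultimately have lim: "((\<lambda>z'. sqrt (sqn (z' -\<^sub>f z))) \<longlongrightarrow> 0) (at z)" by simp
    have "((\<lambda>z'. sqrt (sqn (f -\<^sub>f fit (a z'))) - sqrt (sqn (f -\<^sub>f fit (a z)))) \<longlongrightarrow> 0) (at z)"
      by (rule Lim_null_comparison[OF _ lim]) (simp add: lip)
    then show ?thesis unfolding isCont_def by (simp add: LIM_zero_iff)
  qed
  then show ?thesis by (simp add: continuous_at_imp_continuous_on)
qed

end


section \<open>The oracle inequality with high probability\<close>
text \<open>The directions u are the columns on the support and, off the support, the columns minus their
projections onto its span; all of them have norm at most 1. Off the support the noise uses
3/4 tau, and the correlations with the signs use the remaining 1/4. On the support the right-hand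
side v is at most 7/4 tau, and the bound 2 for the inverse Gram matrix gives sqn g <= 2 * S * (7/4 tau)^2.\<close>
lemma good_sign_vec_directions:
  fixes X :: "real mat"
  defines "x \<equiv> column_fn X"
  assumes X: "X \<in> carrier_mat n p" and good: "s \<in> good_sign_vecs c1 X S"
    and unit: "\<And>j. j < p \<Longrightarrow> ip n (x j) (x j) = 1"
  shows "\<exists>u. (\<forall>j<p. ip n (u j) (u j) \<le> 1) \<and>
    (\<forall>\<tau> z f a b. 0 < \<tau> \<longrightarrow> (\<forall>j<p. \<bar>ip n (u j) z\<bar> \<le> 3 / 4 * \<tau>) \<longrightarrow>
       lasso.minimizer n p x \<tau> (\<lambda>k. f k + z k) a \<longrightarrow> (\<forall>j<p. sgn (b j) = s $ j) \<longrightarrow>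
       ip n (\<lambda>k. f k - synth x {..<p} a k) (\<lambda>k. f k - synth x {..<p} a k)
       \<le> ip n (\<lambda>k. f k - synth x {..<p} b k) (\<lambda>k. f k - synth x {..<p} b k) + 49 / 8 * real S * \<tau>\<^sup>2)"
proof -
  let ?I = "supp s"
  have s: "s \<in> sign_vecs p S" using good X by (auto simp: good_sign_vecs_def)
  note ss = sign_vecs_supp[OF s]
  have solve: "\<exists>w. (\<forall>j\<in>?I. ip n (x j) (synth x ?I w) = v j) \<and> (\<Sum>j\<in>?I. (w j)\<^sup>2) \<le> 4 * (\<Sum>j\<in>?I. (v j)\<^sup>2)" for v
    unfolding x_def by (rule good_sign_vecsD(1)[OF X good])
  have "\<forall>i. \<exists>w. \<forall>j\<in>?I. ip n (x j) (synth x ?I w) = ip n (x j) (x i)"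
  proof
    fix i
    show "\<exists>w. \<forall>j\<in>?I. ip n (x j) (synth x ?I w) = ip n (x j) (x i)"
      using solve[of "\<lambda>j. ip n (x j) (x i)"] by blast
  qed
  from choice[OF this] obtain W where W: "\<And>i j. j \<in> ?I \<Longrightarrow> ip n (x j) (synth x ?I (W i)) = ip n (x j) (x i)"
    by blast
  define P where "P i = synth x ?I (W i)" for i
  define u where "u i = (if i \<in> ?I then x i else (\<lambda>k. x i k - P i k))" for i
  have norm: "ip n (u i) (u i) \<le> 1" if i: "i < p" for i
  proof (cases "i \<in> ?I")
    case True
    then show ?thesis using unit[OF i] by (simp add: u_def)
  next
    case False
    have "ip n (P i) (P i) = (\<Sum>j\<in>?I. W i j * ip n (P i) (x j))"
      unfolding P_def by (rule ip_synth_right)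
    also have "\<dots> = (\<Sum>j\<in>?I. W i j * ip n (x i) (x j))"
      using W by (intro sum.cong refl) (simp add: P_def ip_commute)
    also have "\<dots> = ip n (x i) (P i)" by (simp add: P_def ip_synth_right)
    finally have "ip n (P i) (P i) = ip n (x i) (P i)" .
    then have "ip n (u i) (u i) = 1 - ip n (P i) (P i)"
      using False unit[OF i] by (simp add: u_def ip_linear_right ip_linear_left ip_commute)
    then show ?thesis using ip_nonneg[of n "P i"] by simp
  qed
  have ineq: "ip n (\<lambda>k. f k - synth x {..<p} a k) (\<lambda>k. f k - synth x {..<p} a k)
       \<le> ip n (\<lambda>k. f k - synth x {..<p} b k) (\<lambda>k. f k - synth x {..<p} b k) + 49 / 8 * real S * \<tau>\<^sup>2"
    if \<tau>: "0 < \<tau>" and ev: "\<forall>j<p. \<bar>ip n (u j) z\<bar> \<le> 3 / 4 * \<tau>"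
      and a: "lasso.minimizer n p x \<tau> (\<lambda>k. f k + z k) a" and b: "\<forall>j<p. sgn (b j) = s $ j" for \<tau> z f a b
  proof -
    interpret lasso n p x \<tau> by unfold_locales (rule \<tau>)
    define v where "v j = ip n (x j) z - \<tau> * sgn (b j)" for j
    obtain w where w: "\<And>j. j \<in> ?I \<Longrightarrow> ip n (x j) (synth x ?I w) = v j"
      and w_le: "(\<Sum>j\<in>?I. (w j)\<^sup>2) \<le> 4 * (\<Sum>j\<in>?I. (v j)\<^sup>2)"
      using solve[of v] by blast
    obtain ws where ws: "\<And>j. j \<in> ?I \<Longrightarrow> ip n (x j) (synth x ?I ws) = s $ j"
      using solve[of "\<lambda>j. s $ j"] by blast
    define g where "g = synth x ?I w"
    define gs where "gs = synth x ?I ws"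
    define gz where "gz = synth x ?I (\<lambda>j. w j + \<tau> * ws j)"
    have Ip: "j < p" if "j \<in> ?I" for j using ss(2) that by auto
    have gz_split: "ip n y gz = ip n y g + \<tau> * ip n y gs" for y
      unfolding gz_def g_def gs_def ip_synth_right
      by (simp add: algebra_simps sum.distrib sum_distrib_left)
    have gz: "ip n (x j) gz = ip n (x j) z" if j: "j \<in> ?I" for j
      using w[OF j] ws[OF j] b Ip[OF j] unfolding gz_split by (simp add: g_def gs_def v_def)
    have off: "\<bar>ip n (x i) z - ip n (x i) g\<bar> \<le> \<tau>" if i: "i \<in> {..<p} - ?I" for i
    proof -
      have "ip n (x i) gz = (\<Sum>j\<in>?I. (w j + \<tau> * ws j) * ip n (P i) (x j))"
        unfolding gz_def ip_synth_right using W by (intro sum.cong refl) (simp add: P_def ip_commute)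
      also have "\<dots> = ip n gz (P i)"
        unfolding gz_def by (subst ip_commute, subst ip_synth_right) (rule refl)
      also have "\<dots> = (\<Sum>j\<in>?I. W i j * ip n z (x j))"
        unfolding P_def ip_synth_right using gz by (intro sum.cong refl) (simp add: ip_commute)
      also have "\<dots> = ip n (P i) z"
        unfolding P_def by (subst (2) ip_commute, subst ip_synth_right) (rule refl)
      finally have "ip n (x i) z - ip n (x i) gz = ip n (u i) z"
        using i by (simp add: u_def ip_linear_left)
      then have "\<bar>ip n (x i) z - ip n (x i) gz\<bar> \<le> 3 / 4 * \<tau>" using ev i by simp
      moreover have "\<bar>ip n (x i) gs\<bar> \<le> 1 / 4"
        unfolding gs_def x_def using i ws by (intro good_sign_vecsD(2)[OF X good]) (auto simp: x_def)
      then have "\<bar>\<tau> * ip n (x i) gs\<bar> \<le> \<tau> * (1 / 4)" using \<tau> by (simp add: abs_mult)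
      ultimately show ?thesis unfolding gz_split by linarith
    qed
    have "sqn (f -\<^sub>f fit a) \<le> sqn (f -\<^sub>f fit b) + sqn g"
    proof (rule oracle_inequality[OF a ss(2) _ _ g_def off])
      show "b j = 0" if "j < p" "j \<notin> ?I" for j
        using b that ss(1) by (auto simp: supp_def sgn_0_0)
      show "ip n (x j) g = ip n (x j) z - \<tau> * sgn (b j)" if "j \<in> ?I" for j
        using w[OF that] by (simp add: g_def v_def)
    qed
    moreover have "sqn g \<le> 2 * (\<Sum>j\<in>?I. (v j)\<^sup>2)"
    proof -
      have V0: "0 \<le> (\<Sum>j\<in>?I. (v j)\<^sup>2)" by (rule sum_nonneg) simp
      have "sqn g = (\<Sum>j\<in>?I. w j * ip n g (x j))" unfolding g_def by (rule ip_synth_right)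
      also have "\<dots> = (\<Sum>j\<in>?I. w j * v j)" using w by (intro sum.cong refl) (simp add: g_def ip_commute)
      finally have "(sqn g)\<^sup>2 \<le> (\<Sum>j\<in>?I. (w j)\<^sup>2) * (\<Sum>j\<in>?I. (v j)\<^sup>2)"
        using Cauchy_Schwarz_ineq_sum[of w v ?I] by simp
      also have "\<dots> \<le> (4 * (\<Sum>j\<in>?I. (v j)\<^sup>2)) * (\<Sum>j\<in>?I. (v j)\<^sup>2)"
        using w_le V0 by (rule mult_right_mono)
      also have "\<dots> = (2 * (\<Sum>j\<in>?I. (v j)\<^sup>2))\<^sup>2" by (simp add: power2_eq_square)
      finally show ?thesis by (rule power2_le_imp_le) (use V0 in simp)
    qed
    moreover have "(\<Sum>j\<in>?I. (v j)\<^sup>2) \<le> (\<Sum>j\<in>?I. 49 / 16 * \<tau>\<^sup>2)"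
    proof (rule sum_mono)
      fix j assume j: "j \<in> ?I"
      have "\<bar>ip n (x j) z\<bar> \<le> 3 / 4 * \<tau>" using ev[rule_format, OF Ip[OF j]] j by (simp add: u_def)
      moreover have "\<bar>\<tau> * sgn (b j)\<bar> \<le> \<tau>" using \<tau> by (simp add: abs_mult sgn_if)
      ultimately have "\<bar>v j\<bar> \<le> 7 / 4 * \<tau>" unfolding v_def by linarith
      then have "\<bar>v j\<bar>\<^sup>2 \<le> (7 / 4 * \<tau>)\<^sup>2" by (rule power_mono) simp
      then show "(v j)\<^sup>2 \<le> 49 / 16 * \<tau>\<^sup>2" by (simp add: power_mult_distrib power_divide)
    qed
    ultimately show ?thesis using ss(3) by simp
  qed
  show ?thesis using norm ineq by blast
qed

lemma mat_mult_synth: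
  assumes X: "X \<in> carrier_mat n p" and v: "v \<in> carrier_vec p"
  shows "X *\<^sub>v v = vec n (synth (column_fn X) {..<p} (\<lambda>j. v $ j))"
proof -
  have "v = vec p (\<lambda>j. v $ j)" using v by auto
  then show ?thesis using mat_mult_coords[OF X, of "\<lambda>j. v $ j"] by simp
qed

lemma l2_norm_vec_diff: "(l2_norm (vec n f - vec n g))\<^sup>2 = ip n (\<lambda>k. f k - g k) (\<lambda>k. f k - g k)"
proof -
  have "vec n f - vec n g = vec n (\<lambda>k. f k - g k)" by auto
  then show ?thesis by (simp only: l2_norm_vec)
qed

context lasso
begin

lemma lasso_objective_eq:
  assumes X: "X \<in> carrier_mat n p" and x: "x = column_fn X" and v: "v \<in> carrier_vec p"
  shows "lasso_objective X (vec n y) \<tau> v = objective y (\<lambda>j. v $ j)"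
  using v unfolding lasso_objective_def mat_mult_synth[OF X v] l2_norm_vec_diff x[symmetric]
  by (simp add: objective_def l1_norm_def l1_def)

lemma is_lasso_iff:
  assumes X: "X \<in> carrier_mat n p" and x: "x = column_fn X"
  shows "is_lasso X (vec n y) \<tau> v \<longleftrightarrow> v \<in> carrier_vec p \<and> minimizer y (\<lambda>j. v $ j)"
proof -
  have vec: "objective y b = objective y (\<lambda>j. vec p b $ j)" for b
    unfolding objective_def l1_def synth_def by simp
  have "minimizer y b \<longleftrightarrow> (\<forall>v\<in>carrier_vec p. objective y b \<le> objective y (\<lambda>j. v $ j))" for b
    unfolding minimizer_def using vec by (metis vec_carrier)
  then show ?thesis
    using X lasso_objective_eq[OF X x] unfolding is_lasso_def is_arg_min_def
    by (auto simp: not_less)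
qed

end

lemma INF_UN:
  fixes F :: "'b \<Rightarrow> 'a::complete_lattice"
  shows "(INF b\<in>(\<Union>s\<in>G. B s). F b) = (INF s\<in>G. INF b\<in>B s. F b)"
  by (intro antisym INF_greatest) (auto intro: INF_lower INF_lower2)

text \<open>With tau^2 = 8 L sigma^2 the error term 49/8 S tau^2 is 49 L S sigma^2, well below the
(1 + sqrt 2)(12 + 10 sqrt 2) * 2 L S sigma^2 of the claim. The threshold 3/4 tau is 3/2 sqrt(2 L)
standard deviations, so the union bound over p directions costs at most 2p * exp(-2 L).\<close>
lemma lasso_oracle_probability:
  fixes c1 :: real and S0 :: nat
  assumes X: "X \<in> carrier_mat n p" and p: "exp 1 \<le> real p"
    and unit: "\<forall>j<p. l2_norm (col X j) = 1" and \<sigma>: "0 < \<sigma>" and \<beta>: "\<beta> \<in> carrier_vec p"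
  defines "R \<equiv> (MIN S\<in>{..S0}. INF b\<in>{b \<in> carrier_vec p. sgn_vec b \<in> good_sign_vecs c1 X S}.
      ereal ((1 + sqrt 2) * ((l2_norm (X *\<^sub>v \<beta> - X *\<^sub>v b))\<^sup>2
        + (12 + 10 * sqrt 2) * (2 * ln (real p)) * real S * \<sigma>\<^sup>2)))"
  shows "measure (gaussian_noise n \<sigma>) {z \<in> space (gaussian_noise n \<sigma>).
      \<forall>\<beta>hat. is_lasso X (X *\<^sub>v \<beta> + vec n z) (2 * sqrt (2 * ln (real p)) * \<sigma>) \<beta>hat \<longrightarrow>
        ereal ((l2_norm (X *\<^sub>v \<beta> - X *\<^sub>v \<beta>hat))\<^sup>2) \<le> R} \<ge> 1 - 2 / real p"
proof -
  let ?x = "column_fn X" and ?M = "gaussian_noise n \<sigma>"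
  define L where "L = ln (real p)"
  define \<tau> where "\<tau> = 2 * sqrt (2 * L) * \<sigma>"
  have p0: "0 < real p" using p exp_gt_zero[of "1::real"] by linarith
  have L: "1 \<le> L" using p p0 by (simp add: L_def ln_ge_iff)
  have \<tau>_pos: "0 < \<tau>" using L \<sigma> by (simp add: \<tau>_def)
  have \<tau>2: "\<tau>\<^sup>2 = 8 * L * \<sigma>\<^sup>2" using L by (simp add: \<tau>_def power_mult_distrib)
  interpret lasso n p ?x \<tau> by unfold_locales (rule \<tau>_pos)
  interpret prob_space ?M using \<sigma> by (rule prob_space_gaussian_noise)
  define f where "f = fit (\<lambda>j. \<beta> $ j)"
  have X\<beta>: "X *\<^sub>v \<beta> = vec n f" unfolding f_def by (rule mat_mult_synth[OF X \<beta>])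
  have Xv: "(l2_norm (X *\<^sub>v \<beta> - X *\<^sub>v v))\<^sup>2 = sqn (f -\<^sub>f fit (\<lambda>j. v $ j))" if "v \<in> carrier_vec p" for v
    unfolding X\<beta> mat_mult_synth[OF X that] by (rule l2_norm_vec_diff)
  have y: "X *\<^sub>v \<beta> + vec n z = vec n (\<lambda>k. f k + z k)" for z unfolding X\<beta> by auto
  have unit': "ip n (?x j) (?x j) = 1" if "j < p" for j
  proof -
    have "l2_norm (vec n (?x j)) = 1" using unit that col_eq_vec[OF X that] by metis
    then show ?thesis using l2_norm_vec[of n "?x j"] by simp
  qed
  have "\<forall>z. \<exists>a. minimizer (\<lambda>k. f k + z k) a" using objective_exists_minimizer by simp
  from choice[OF this] obtain a where a: "\<And>z. minimizer (\<lambda>k. f k + z k) (a z)" by blast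
  define \<phi> where "\<phi> z = sqrt (sqn (f -\<^sub>f fit (a z)))" for z
  have \<phi>2: "(\<phi> z)\<^sup>2 = sqn (f -\<^sub>f fit (a z))" for z by (simp add: \<phi>_def ip_nonneg)

  \<comment> \<open>All minimisers have the same fit, so the event only concerns the continuous function \<phi>.\<close>
  have event: "(\<forall>\<beta>hat. is_lasso X (X *\<^sub>v \<beta> + vec n z) \<tau> \<beta>hat \<longrightarrow> ereal ((l2_norm (X *\<^sub>v \<beta> - X *\<^sub>v \<beta>hat))\<^sup>2) \<le> R)
    \<longleftrightarrow> ereal ((\<phi> z)\<^sup>2) \<le> R" for z
  proof -
    have loss: "(l2_norm (X *\<^sub>v \<beta> - X *\<^sub>v v))\<^sup>2 = (\<phi> z)\<^sup>2" if "is_lasso X (X *\<^sub>v \<beta> + vec n z) \<tau> v" for v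
      using that loss_unique[OF _ a[of z], of "\<lambda>j. v $ j" f] unfolding y is_lasso_iff[OF X refl] \<phi>2
      by (simp add: Xv)
    have "minimizer (\<lambda>k. f k + z k) (\<lambda>j. vec p (a z) $ j)"
    proof -
      have "objective (\<lambda>k. f k + z k) (\<lambda>j. vec p (a z) $ j) = objective (\<lambda>k. f k + z k) (a z)"
        unfolding objective_def l1_def synth_def by simp
      then show ?thesis using a[of z] unfolding minimizer_def by simp
    qed
    then have "is_lasso X (X *\<^sub>v \<beta> + vec n z) \<tau> (vec p (a z))"
      unfolding y is_lasso_iff[OF X refl] by simp
    then show ?thesis using loss by metis
  qed
  \<comment> \<open>The noise is extensional on {..<n}; as a function on all naturals it is measurable for the Borel sets.\<close>
  have \<phi>_meas [measurable]: "\<phi> \<in> borel_measurable ?M"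
  proof -
    have "(\<lambda>z. z) \<in> measurable ?M (PiM UNIV (\<lambda>_::nat. borel :: real measure))"
    proof (rule measurable_PiM_single')
      fix i :: nat
      show "(\<lambda>z. z i) \<in> borel_measurable ?M"
      proof (cases "i < n")
        case True
        then show ?thesis
          using measurable_component_singleton[of i "{..<n}" "\<lambda>_. density lborel (\<lambda>x. ennreal (normal_density 0 \<sigma> x))"]
          unfolding gaussian_noise_def by simp
      next
        case False
        then have "z i = undefined" if "z \<in> space ?M" for z
          using that by (auto simp: gaussian_noise_def space_PiM PiE_def extensional_def)
        then show ?thesis by (subst measurable_cong[where g = "\<lambda>_. undefined"]) auto
      qed
    qed simp
    moreover have "\<phi> \<in> borel_measurable (PiM UNIV (\<lambda>_::nat. borel :: real measure))"
      using borel_measurable_continuous_onI[OF continuous_loss[OF a]]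
      unfolding \<phi>_def measurable_def sets_PiM_equal_borel by (simp add: space_PiM)
    ultimately show ?thesis using measurable_compose by blast
  qed
  have meas: "{z \<in> space ?M. ereal ((\<phi> z)\<^sup>2) \<le> R} \<in> events" by measurable

  let ?B = "\<lambda>S. {b \<in> carrier_vec p. sgn_vec b \<in> good_sign_vecs c1 X S}"
  let ?F = "\<lambda>S b. ereal ((1 + sqrt 2) * ((l2_norm (X *\<^sub>v \<beta> - X *\<^sub>v b))\<^sup>2
        + (12 + 10 * sqrt 2) * (2 * ln (real p)) * real S * \<sigma>\<^sup>2))"
  have "R \<in> (\<lambda>S. INF b\<in>?B S. ?F S b) ` {..S0}" unfolding R_def by (intro Min_in) auto
  then obtain S where R: "R = (INF b\<in>?B S. ?F S b)" by blast
  have "\<exists>u. (\<forall>j<p. ip n (u j) (u j) \<le> 1) \<and> (\<forall>z. (\<forall>j<p. \<bar>ip n (u j) z\<bar> \<le> 3 / 4 * \<tau>) \<longrightarrow> ereal ((\<phi> z)\<^sup>2) \<le> R)"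
  proof (cases "?B S = {}")
    case True
    have "R = \<infinity>" unfolding R True by (simp add: top_ereal_def)
    then show ?thesis by (intro exI[of _ "\<lambda>_ _. 0"]) (simp add: ip_def)
  next
    case False
    \<comment> \<open>Finitely many sign patterns: the infimum is that over one of them.\<close>
    let ?G = "sgn_vec ` ?B S"
    have G: "finite ?G" "?G \<noteq> {}"
    proof -
      have "?G \<subseteq> sign_vecs p S" using good_sign_vecs_subset[of X p c1 S] X by auto
      then show "finite ?G" by (rule finite_subset[OF _ finite_sign_vecs])
      show "?G \<noteq> {}" using False by simp
    qed
    have "?B S = (\<Union>s\<in>?G. {b \<in> ?B S. sgn_vec b = s})" by auto
    then have "R = (INF b\<in>(\<Union>s\<in>?G. {b \<in> ?B S. sgn_vec b = s}). ?F S b)" unfolding R by simp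
    also have "\<dots> = (INF s\<in>?G. INF b\<in>{b \<in> ?B S. sgn_vec b = s}. ?F S b)"
      by (rule INF_UN)
    also have "\<dots> = Min ((\<lambda>s. INF b\<in>{b \<in> ?B S. sgn_vec b = s}. ?F S b) ` ?G)"
      using G by (intro Min_Inf[symmetric]) auto
    finally have "R \<in> (\<lambda>s. INF b\<in>{b \<in> ?B S. sgn_vec b = s}. ?F S b) ` ?G"
      using Min_in[of "(\<lambda>s. INF b\<in>{b \<in> ?B S. sgn_vec b = s}. ?F S b) ` ?G"] G by simp
    then obtain s where s: "s \<in> ?G" and Rs: "R = (INF b\<in>{b \<in> ?B S. sgn_vec b = s}. ?F S b)" by blast
    have good: "s \<in> good_sign_vecs c1 X S" using s by auto
    obtain u where u: "\<forall>j<p. ip n (u j) (u j) \<le> 1" and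
      ineq: "\<And>z b. (\<forall>j<p. \<bar>ip n (u j) z\<bar> \<le> 3 / 4 * \<tau>) \<Longrightarrow> (\<forall>j<p. sgn (b j) = s $ j) \<Longrightarrow>
        sqn (f -\<^sub>f fit (a z)) \<le> sqn (f -\<^sub>f fit b) + 49 / 8 * real S * \<tau>\<^sup>2"
      using good_sign_vec_directions[OF X good unit'] \<tau>_pos a by blast
    have "ereal ((\<phi> z)\<^sup>2) \<le> R" if z: "\<forall>j<p. \<bar>ip n (u j) z\<bar> \<le> 3 / 4 * \<tau>" for z
      unfolding Rs
    proof (rule INF_greatest)
      fix b assume b: "b \<in> {b \<in> ?B S. sgn_vec b = s}"
      then have bc: "b \<in> carrier_vec p" and bs: "\<forall>j<p. sgn (b $ j) = s $ j" by (auto simp: sgn_vec_def)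
      let ?d = "sqn (f -\<^sub>f fit (\<lambda>j. b $ j))" and ?s = "L * real S * \<sigma>\<^sup>2"
      have d0: "0 \<le> ?d" "0 \<le> ?s" using L by (auto simp: ip_nonneg)
      have "(\<phi> z)\<^sup>2 \<le> ?d + 49 / 8 * real S * \<tau>\<^sup>2" unfolding \<phi>2 by (rule ineq[OF z bs])
      also have "\<dots> = 1 * ?d + 49 * ?s" by (simp add: \<tau>2)
      also have "\<dots> \<le> (1 + sqrt 2) * ?d + ((1 + sqrt 2) * ((12 + 10 * sqrt 2) * 2)) * ?s"
      proof (intro add_mono mult_right_mono d0)
        have "1 \<le> sqrt 2" by simp
        moreover have "(1 + sqrt 2) * ((12 + 10 * sqrt 2) * 2) = 64 + 44 * sqrt 2"
          by (simp add: algebra_simps)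
        ultimately show "49 \<le> (1 + sqrt 2) * ((12 + 10 * sqrt 2) * 2)" by simp
      qed simp
      also have "\<dots> = (1 + sqrt 2) * ((l2_norm (X *\<^sub>v \<beta> - X *\<^sub>v b))\<^sup>2
        + (12 + 10 * sqrt 2) * (2 * ln (real p)) * real S * \<sigma>\<^sup>2)"
        unfolding Xv[OF bc] L_def by (simp add: algebra_simps)
      finally show "ereal ((\<phi> z)\<^sup>2) \<le> ?F S b" by simp
    qed
    then show ?thesis using u by blast
  qed
  then obtain u where u: "\<And>j. j < p \<Longrightarrow> ip n (u j) (u j) \<le> 1"
    and imp: "\<And>z. (\<forall>j<p. \<bar>ip n (u j) z\<bar> \<le> 3 / 4 * \<tau>) \<Longrightarrow> ereal ((\<phi> z)\<^sup>2) \<le> R" by blast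
  define t where "t = 3 / 4 * (2 * sqrt (2 * L))"
  have t: "0 \<le> t" "t * \<sigma> = 3 / 4 * \<tau>" using L by (simp_all add: t_def \<tau>_def)
  have "t\<^sup>2 = 9 / 2 * L" using L by (simp add: t_def power_mult_distrib power_divide)
  then have "exp (- t\<^sup>2 / 2) \<le> exp (- L + - L)" using L by simp
  also have "\<dots> = 1 / (real p * real p)"
    unfolding exp_add exp_minus L_def using p0 by (simp add: field_simps)
  finally have "2 * real p * exp (- t\<^sup>2 / 2) \<le> 2 * real p * (1 / (real p * real p))"
    by (intro mult_left_mono) auto
  then have "1 - 2 / real p \<le> 1 - 2 * real p * exp (- t\<^sup>2 / 2)" using p0 by simp
  also have "\<dots> \<le> prob {z \<in> space ?M. \<forall>j<p. \<bar>ip n (u j) z\<bar> \<le> 3 / 4 * \<tau>}"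
    using gaussian_union_bound[OF \<sigma> u t(1)] unfolding t(2) .
  also have "\<dots> \<le> prob {z \<in> space ?M. ereal ((\<phi> z)\<^sup>2) \<le> R}"
    using imp by (intro finite_measure_mono meas) auto
  also have "{z \<in> space ?M. ereal ((\<phi> z)\<^sup>2) \<le> R} = {z \<in> space ?M.
      \<forall>\<beta>hat. is_lasso X (X *\<^sub>v \<beta> + vec n z) (2 * sqrt (2 * ln (real p)) * \<sigma>) \<beta>hat \<longrightarrow>
        ereal ((l2_norm (X *\<^sub>v \<beta> - X *\<^sub>v \<beta>hat))\<^sup>2) \<le> R}"
    using event unfolding \<tau>_def L_def by blast
  finally show ?thesis .
qed


theorem mainTheorem4:
  shows "\<exists>A0 c0 c1 C :: real. A0 > 0 \<and> c0 > 0 \<and> c1 > 0 \<and> C > 0 \<and>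
    (\<forall>(n::nat) (p::nat) (X::real mat) (\<sigma>::real).
       p \<ge> 2 \<longrightarrow> X \<in> carrier_mat n p \<longrightarrow> (\<forall>j<p. l2_norm (col X j) = 1) \<longrightarrow>
       coherence X \<le> A0 / ln (real p) \<longrightarrow> \<sigma> > 0 \<longrightarrow>
       (let S0 = nat \<lfloor>c0 * real p / ((op_norm X)\<^sup>2 * ln (real p))\<rfloor>;
            lam = 2 * sqrt (2 * ln (real p));
            C0' = 12 + 10 * sqrt 2
        in (\<forall>S\<le>S0. real (card (good_sign_vecs c1 X S)) / real (card (sign_vecs p S))
                      \<ge> 1 - C / real p) \<and>
           (\<forall>\<beta>\<in>carrier_vec p.
              measure (gaussian_noise n \<sigma>)
                {z \<in> space (gaussian_noise n \<sigma>).
                   \<forall>\<beta>hat. is_lasso X (X *\<^sub>v \<beta> + vec n z) (lam * \<sigma>) \<beta>hat \<longrightarrow>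
                     ereal ((l2_norm (X *\<^sub>v \<beta> - X *\<^sub>v \<beta>hat))\<^sup>2)
                     \<le> (MIN S\<in>{..S0}. INF b\<in>{b \<in> carrier_vec p. sgn_vec b \<in> good_sign_vecs c1 X S}.
                          ereal ((1 + sqrt 2) *
                            ((l2_norm (X *\<^sub>v \<beta> - X *\<^sub>v b))\<^sup>2
                             + C0' * (2 * ln (real p)) * real S * \<sigma>\<^sup>2)))}
              \<ge> 1 - C / real p)))"
proof (rule exI[of _ "1 / 512"], rule exI[of _ "1 / 131072"], rule exI[of _ 1], rule exI[of _ 15], intro conjI allI impI)
  fix n p :: nat and X :: "real mat" and \<sigma> :: real
  assume p2: "2 \<le> p" and X: "X \<in> carrier_mat n p" and unit: "\<forall>j<p. l2_norm (col X j) = 1"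
    and coh: "coherence X \<le> 1 / 512 / ln (real p)" and \<sigma>: "0 < \<sigma>"
  show "let S0 = nat \<lfloor>1 / 131072 * real p / ((op_norm X)\<^sup>2 * ln (real p))\<rfloor>;
            lam = 2 * sqrt (2 * ln (real p));
            C0' = 12 + 10 * sqrt 2
        in (\<forall>S\<le>S0. real (card (good_sign_vecs 1 X S)) / real (card (sign_vecs p S))
                      \<ge> 1 - 15 / real p) \<and>
           (\<forall>\<beta>\<in>carrier_vec p.
              measure (gaussian_noise n \<sigma>)
                {z \<in> space (gaussian_noise n \<sigma>).
                   \<forall>\<beta>hat. is_lasso X (X *\<^sub>v \<beta> + vec n z) (lam * \<sigma>) \<beta>hat \<longrightarrow>
                     ereal ((l2_norm (X *\<^sub>v \<beta> - X *\<^sub>v \<beta>hat))\<^sup>2)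
                     \<le> (MIN S\<in>{..S0}. INF b\<in>{b \<in> carrier_vec p. sgn_vec b \<in> good_sign_vecs 1 X S}.
                          ereal ((1 + sqrt 2) *
                            ((l2_norm (X *\<^sub>v \<beta> - X *\<^sub>v b))\<^sup>2
                             + C0' * (2 * ln (real p)) * real S * \<sigma>\<^sup>2)))}
              \<ge> 1 - 15 / real p)"
  proof (cases "p = 2")
    \<comment> \<open>For p = 2 the lower bounds are negative; from p = 3 on, ln p is at least 1.\<close>
    case True
    then have neg: "1 - 15 / real p \<le> 0" by simp
    show ?thesis
      unfolding Let_def by (intro conjI allI ballI impI order_trans[OF neg]) simp_all
  next
    case False
    then have "3 \<le> real p" using p2 by simp
    then have p: "exp 1 \<le> real p" using exp_1_le_3 by linarith
    have "1 - 15 / real p \<le> 1 - 2 / real p" using p2 by (simp add: divide_right_mono)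
    then show ?thesis
      unfolding Let_def
      by (intro conjI allI ballI impI most_sign_vecs_good[OF X p unit coh]
          order_trans[OF _ lasso_oracle_probability[OF X p unit \<sigma>]])
  qed
qed simp_all


end
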